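(* Let $M$ be a compact Hausdorff space, $f:M\to M$ a continuous automorphism (a homeomorphism) that is ergodic with respect to an $f$-invariant Borel probability measure $\mu$, and suppose that $\varphi:\Sigma\times M\to\mathbb{R}$ is uniformly relatively H\"older continuous, with associated Ruelle operators $\mathcal{L}_x$, H\"older space $\mathcal{H}$ and families $\{h_x\}$, $\{\rho_x\}$. Then, for each $\varepsilon>0$, there exist $m\in\mathbb{N}$, a continuous family of positive operators $\{A_x:\mathcal{H}\to\mathcal{H}\}_{x\in M}$ and a continuous bundle $\{W_x: x\in M\}$ of $m$-dimensional subspaces of $\mathcal{H}$ such that, for all $x\in M$: (1) $h_x\in W_x$, and $W_x$ is $\varepsilon$-dense in $\{g\in\mathcal{H}:\|g\|_{\mathcal{H}}\le 1\}$ with respect to $\|\cdot\|_\infty$; (2) $A_x$ maps $W_x$ to $W_{f(x)}$, and $\|A_x(g)-\mathcal{L}_x(g)\|_\infty\le\varepsilon\|g\|_\infty$ for all $g\in W_x$. Furthermore, the maximal Lyapunov exponent $\lambda_1$ associated with $A$ (acting on the bundle $W_M$) is equal to $\int\log\rho_x\,d\mu$, $E^{\lambda_1}_x=\{t h_x: t\in\mathbb{R}\}$, the splitting $E^{\lambda_1}_M\oplus E^{<\lambda_1}_M\subset W_M$ is dominated, and either (i) the Lyapunov spectrum of $A$ contains two points, or (ii) the Lyapunov spectrum of $A$ contains at least three points and the Oseledets subbundles define a dominated splitting.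
   Context: Fix $\ell\in\mathbb{N}$. $\Sigma=\{1,\dots,\ell\}^{\mathbb{N}}$ is the one-sided full shift space of sequences $w=(w_0w_1\ldots)$, and $\theta$ is the left shift. For $r\in(0,1)$, $d_r(v,w)=r^{\min\{i\ge 0: v_i\neq w_i\}}$ for $v\neq w$; $D_r(g)=\sup_{v\neq w}|g(v)-g(w)|/d_r(v,w)$, $\|g\|_{\mathcal{H}}=\|g\|_\infty+D_r(g)$, $\mathcal{H}=\mathcal{H}_r=\{g:\Sigma\to\mathbb{R}:\|g\|_{\mathcal{H}}<\infty\}$. $\varphi$, $(w,x)\mapsto\varphi_x(w)$, is uniformly relatively ($r$-)H\"older continuous if $\varphi$ is continuous and there is $r\in(0,1)$ such that $\varphi_x\in\mathcal{H}_r$ for all $x$ and $x\mapsto D_r(\varphi_x)$ is continuous. Ruelle operators: $\mathcal{L}_x(h)(w)=\sum_{v:\theta(v)=w}h(v)e^{\varphi_x(v)}$. There are uniquely determined families of Borel probability measures $\{m_x\}$ on $\Sigma$, constants $\rho_x>0$ and strictly positive H\"older functions $\{h_x\}$ (with uniformly bounded H\"older coefficients) such that $\mathcal{L}_x^*(m_{f(x)})=\rho_x m_x$, $\mathcal{L}_x(h_x)=\rho_x h_{f(x)}$ and $\int h_x\,dm_x=1$ for all $x\in M$. An operator is positive if it maps nonnegative functions to nonnegative functions. "$W_x$ is $\varepsilon$-dense in $B$" means every element of $B$ is within distance $\varepsilon$ of some element of $W_x$. Lyapunov exponents and Oseledets splitting of the cocycle $A_x:W_x\to W_{f(x)}$,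 with $A^k_x=A_{f^{k-1}(x)}\cdots A_x$: by Oseledets' theorem (for possibly non-invertible cocycles over an invertible ergodic base) there are $\lambda_1>\dots>\lambda_k\ge-\infty$ (the Lyapunov spectrum) and, for $\mu$-a.e. $x$, a splitting $W_x=E^{\lambda_1}_x\oplus\dots\oplus E^{\lambda_k}_x$ with $A_x(E_x^{\lambda_i})=E_{f(x)}^{\lambda_i}$ if $\lambda_i>-\infty$, $A_x(E^{-\infty}_x)\subset E^{-\infty}_{f(x)}$, and $\lim_n\frac1n\log\|A_x^nv\|=\lambda_i$ for $v\in E^{\lambda_i}_x\setminus\{0\}$. Moreover $E^{<\lambda}_x=\{v\in W_x:\limsup_{n\to\infty}\frac1n\log\|A_x^nv\|<\lambda\}$. A subscript $M$ denotes the bundle over all of $M$. A nontrivial $A$-invariant splitting $F^1\oplus F^2$ over an $f$-invariant set $\Lambda\subset M$ is $k$-dominated if $E^{-\infty}_\Lambda$ is well defined (possibly empty) and a subset of $F^2_\Lambda$ and, for every $x\in\Lambda$, $\|A^k_x|_{F^2_x}\|/\mathfrak{m}(A^k_x|_{F^1_x})\le\frac12$, where $\mathfrak{m}(B)=\|B^{-1}\|^{-1}$ is the co-norm; it is dominated if it is $k$-dominated for some $k\ge 1$. An $A$-invariant splitting $F^1\oplus\dots\oplus F^k$ is dominated if $(F^1\oplus\dots\oplus F^j)\oplus(F^{j+1}\oplus\dots\oplus F^k)$ is dominated for each $j=1,\dots,k-1$. The Oseledets subbundles define a dominated splitting if there is a dominated splitting over $M$ coinciding with the Oseledets splitting (ordered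 by decreasing exponent) almost everywhere.
   Formalization: ℓ ≥ 2 is assumed (for ℓ = 1 the spectrum has one point and the claim fails), and the dominated splitting over M has first bundle ℝh_x everywhere and second bundle equal to E^{<λ1}_x for μ-a.e. x, since at non-generic x the pointwise E^{<λ1}_x can be all of W_x. *)

theory Defs
  imports "HOL-Probability.Probability"
begin

section \<open>The full shift\<close>

text \<open>
  The alphabet is a finite type \<open>'l\<close> with the discrete topology, so \<open>nat \<Rightarrow> 'l\<close> carries the
  product topology, which is the topology of each of the metrics \<open>shift_dist r\<close>.
\<close>

definition left_shift :: "(nat \<Rightarrow> 'l) \<Rightarrow> nat \<Rightarrow> 'l" where
  "left_shift w = (\<lambda>i. w (Suc i))"

definition shift_dist :: "real \<Rightarrow> (nat \<Rightarrow> 'l) \<Rightarrow> (nat \<Rightarrow> 'l) \<Rightarrow> real" where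
  "shift_dist r v w = (if v = w then 0 else r ^ (LEAST i. v i \<noteq> w i))"


section \<open>The space of Hoelder functions\<close>

definition holder_quotients :: "real \<Rightarrow> ((nat \<Rightarrow> 'l) \<Rightarrow> real) \<Rightarrow> real set" where
  "holder_quotients r g = {\<bar>g v - g w\<bar> / shift_dist r v w | v w. v \<noteq> w}"

text \<open>
  \<open>Sup\<close> is the supremum of a set of reals, so \<open>holder_const\<close> and \<open>holder_norm\<close> are meaningful
  only for functions satisfying \<open>is_holder\<close>, which says that both suprema are finite.
\<close>

definition holder_const :: "real \<Rightarrow> ((nat \<Rightarrow> 'l) \<Rightarrow> real) \<Rightarrow> real" where
  "holder_const r g = Sup (holder_quotients r g)"

definition is_holder :: "real \<Rightarrow> ((nat \<Rightarrow> 'l) \<Rightarrow> real) \<Rightarrow> bool" where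
  "is_holder r g \<longleftrightarrow> bounded (range g) \<and> bdd_above (holder_quotients r g)"

definition holder_norm :: "real \<Rightarrow> ((nat \<Rightarrow> 'l) \<Rightarrow> real) \<Rightarrow> real" where
  "holder_norm r g = (SUP w. \<bar>g w\<bar>) + holder_const r g"

text \<open>
  Hoelder functions are continuous (lemma \<open>is_holder_bcontfun\<close> below), so the Hoelder space can
  be taken inside the Banach space of bounded continuous functions, whose \<open>norm\<close> is the
  supremum norm.
\<close>

definition holder_space ::
    "real \<Rightarrow> ((nat \<Rightarrow> 'l::{finite,discrete_topology}) \<Rightarrow>\<^sub>C real) set" where
  "holder_space r = {g. is_holder r (apply_bcontfun g)}"

lemma is_holder_bcontfun:
  fixes g :: "(nat \<Rightarrow> 'l::{finite,discrete_topology}) \<Rightarrow> real"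
  assumes r: "0 < r" "r < 1" and g: "is_holder r g"
  shows "g \<in> bcontfun"
proof -
  obtain C where C: "\<And>y. y \<in> holder_quotients r g \<Longrightarrow> y \<le> C"
    using g by (auto simp: is_holder_def bdd_above_def)
  have "continuous_on UNIV g"
    unfolding continuous_on_def
  proof
    fix w :: "nat \<Rightarrow> 'l"
    show "(g \<longlongrightarrow> g w) (at w within UNIV)"
    proof (rule tendstoI)
      fix e :: real assume e: "e > 0"
      obtain n where n: "r ^ n < e / (\<bar>C\<bar> + 1)"
        using real_arch_pow_inv[of "e / (\<bar>C\<bar> + 1)" r] e r by auto
      have bound: "dist (g v) (g w) < e" if v: "\<forall>i<n. v i = w i" for v
      proof (cases "v = w")
        case False
        define k where "k = (LEAST i. v i \<noteq> w i)"
        have "v k \<noteq> w k"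
          unfolding k_def by (rule LeastI_ex) (use False in auto)
        hence "n \<le> k" using v by (meson not_less)
        have d: "shift_dist r v w = r ^ k" using False by (simp add: shift_dist_def k_def)
        have "\<bar>g v - g w\<bar> / r ^ k \<le> C"
          unfolding d[symmetric] by (rule C) (use False in \<open>auto simp: holder_quotients_def\<close>)
        hence "\<bar>g v - g w\<bar> \<le> C * r ^ k" using r by (simp add: field_simps)
        also have "\<dots> \<le> (\<bar>C\<bar> + 1) * r ^ k" using r by (intro mult_right_mono) auto
        also have "\<dots> \<le> (\<bar>C\<bar> + 1) * r ^ n"
          using r \<open>n \<le> k\<close> by (intro mult_left_mono power_decreasing) auto
        also have "\<dots> < e" using n by (simp add: field_simps)
        finally show ?thesis by (simp add: dist_real_def)
      qed (use e in auto)
      have "open {v. \<forall>i\<in>{..<n}. v i \<in> {w i}}"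
      proof -
        have "{v. \<forall>i\<in>{..<n}. v i \<in> {w i}} =
                PiE UNIV (\<lambda>i. if i < n then {w i} else (UNIV :: 'l set))"
          by (auto simp: PiE_def Pi_def)
        thus ?thesis
          by (auto intro!: open_PiE simp: discrete_topology_class.open_discrete
                elim: finite_subset[rotated])
      qed
      hence "eventually (\<lambda>v. v \<in> {v. \<forall>i\<in>{..<n}. v i \<in> {w i}}) (nhds w)"
        by (rule eventually_nhds_in_open) auto
      hence "eventually (\<lambda>v. dist (g v) (g w) < e) (nhds w)"
        by eventually_elim (rule bound, auto)
      thus "eventually (\<lambda>v. dist (g v) (g w) < e) (at w within UNIV)"
        by (auto simp: eventually_at_filter elim: eventually_mono)
    qed
  qed
  thus ?thesis using g by (simp add: is_holder_def bcontfun_def)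
qed

definition uniformly_relatively_holder ::
    "real \<Rightarrow> ('m::topological_space \<Rightarrow> (nat \<Rightarrow> 'l::{finite,discrete_topology}) \<Rightarrow> real) \<Rightarrow> bool"
where
  "uniformly_relatively_holder r \<phi> \<longleftrightarrow>
     continuous_on UNIV (\<lambda>(w, x). \<phi> x w) \<and>
     (\<forall>x. is_holder r (\<phi> x)) \<and>
     continuous_on UNIV (\<lambda>x. holder_const r (\<phi> x))"


section \<open>Ruelle operators\<close>

definition ruelle_fun ::
    "((nat \<Rightarrow> 'l) \<Rightarrow> real) \<Rightarrow> ((nat \<Rightarrow> 'l) \<Rightarrow> real) \<Rightarrow> (nat \<Rightarrow> 'l) \<Rightarrow> real" where
  "ruelle_fun \<psi> g w = (\<Sum>v | left_shift v = w. g v * exp (\<psi> v))"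

definition ruelle ::
    "((nat \<Rightarrow> 'l::{finite,discrete_topology}) \<Rightarrow> real) \<Rightarrow>
       ((nat \<Rightarrow> 'l) \<Rightarrow>\<^sub>C real) \<Rightarrow> ((nat \<Rightarrow> 'l) \<Rightarrow>\<^sub>C real)" where
  "ruelle \<psi> g = Bcontfun (ruelle_fun \<psi> (apply_bcontfun g))"

lemma left_shift_vimage:
  "{v. left_shift v = w} = range (\<lambda>a. case_nat a w)"
  by (auto simp: left_shift_def fun_eq_iff image_iff split: nat.splits)

lemma ruelle_fun_eq:
  fixes w :: "nat \<Rightarrow> 'l::finite"
  shows "ruelle_fun \<psi> g w = (\<Sum>a\<in>UNIV. g (case_nat a w) * exp (\<psi> (case_nat a w)))"
proof -
  have "inj (\<lambda>a. case_nat a w)"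
    by (rule injI) (metis old.nat.simps(4))
  thus ?thesis
    unfolding ruelle_fun_def left_shift_vimage by (simp add: sum.reindex)
qed

lemma apply_ruelle:
  fixes \<psi> :: "(nat \<Rightarrow> 'l::{finite,discrete_topology}) \<Rightarrow> real"
  assumes r: "0 < r" "r < 1" and \<psi>: "is_holder r \<psi>"
  shows "apply_bcontfun (ruelle \<psi> g) = ruelle_fun \<psi> (apply_bcontfun g)"
proof -
  have \<psi>_cont: "continuous_on UNIV \<psi>" and \<psi>_bdd: "bounded (range \<psi>)"
    using is_holder_bcontfun[OF assms] by (auto simp: bcontfun_def)
  have pre: "continuous_on UNIV (\<lambda>w. case_nat a w :: nat \<Rightarrow> 'l)" for a
  proof (rule continuous_on_coordinatewise_then_product)
    fix i
    show "continuous_on UNIV (\<lambda>w. case_nat a w i :: 'l)"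
      by (cases i) (auto intro: continuous_on_product_coordinates)
  qed
  have "continuous_on UNIV (ruelle_fun \<psi> (apply_bcontfun g))"
    unfolding ruelle_fun_eq
    by (intro continuous_intros continuous_on_compose2[OF \<psi>_cont pre]
          continuous_on_compose2[OF continuous_on_apply_bcontfun[of UNIV g] pre]) auto
  moreover have "bounded (range (ruelle_fun \<psi> (apply_bcontfun g)))"
  proof -
    obtain B where B: "\<And>w. \<bar>\<psi> w\<bar> \<le> B" using \<psi>_bdd by (auto simp: bounded_iff)
    have "\<bar>ruelle_fun \<psi> (apply_bcontfun g) w\<bar> \<le> (\<Sum>a\<in>(UNIV::'l set). norm g * exp B)" for w
      unfolding ruelle_fun_eq
    proof (rule order_trans[OF sum_abs sum_mono])
      fix a
      have "\<bar>g (case_nat a w)\<bar> \<le> norm g" using norm_bounded[of g] by simp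
      moreover have "\<psi> (case_nat a w) \<le> B" using B[of "case_nat a w"] by linarith
      ultimately show "\<bar>g (case_nat a w) * exp (\<psi> (case_nat a w))\<bar> \<le> norm g * exp B"
        by (simp add: abs_mult mult_mono)
    qed
    thus ?thesis by (auto simp: bounded_iff)
  qed
  ultimately show ?thesis
    unfolding ruelle_def by (subst Bcontfun_inverse) (auto simp: bcontfun_def)
qed

text \<open>
  The dual eigenmeasures \<open>\<nu>\<close>, eigenvalues \<open>\<rho>\<close> and eigenfunctions \<open>h\<close> of the family of Ruelle
  operators over \<open>f\<close>. The equation \<open>L\<^sub>x\<^sup>* (\<nu> (f x)) = \<rho> x \<nu> x\<close> is
  written out by integrating continuous functions.
\<close>

definition ruelle_triple ::
    "real \<Rightarrow> ('m \<Rightarrow> 'm) \<Rightarrow> ('m \<Rightarrow> (nat \<Rightarrow> 'l::{finite,discrete_topology}) \<Rightarrow> real) \<Rightarrow>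
       ('m \<Rightarrow> (nat \<Rightarrow> 'l) measure) \<Rightarrow> ('m \<Rightarrow> real) \<Rightarrow> ('m \<Rightarrow> (nat \<Rightarrow> 'l) \<Rightarrow>\<^sub>C real) \<Rightarrow> bool"
where
  "ruelle_triple r f \<phi> \<nu> \<rho> h \<longleftrightarrow>
     (\<forall>x. prob_space (\<nu> x) \<and> sets (\<nu> x) = sets borel) \<and>
     (\<forall>x. \<rho> x > 0) \<and>
     (\<forall>x. h x \<in> holder_space r \<and> (\<forall>w. h x w > 0)) \<and>
     (\<exists>C. \<forall>x. holder_const r (h x) \<le> C) \<and>
     (\<forall>x g. (\<integral>w. ruelle (\<phi> x) g w \<partial>\<nu> (f x)) = \<rho> x * (\<integral>w. apply_bcontfun g w \<partial>\<nu> x)) \<and>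
     (\<forall>x. ruelle (\<phi> x) (h x) = \<rho> x *\<^sub>R h (f x)) \<and>
     (\<forall>x. (\<integral>w. h x w \<partial>\<nu> x) = 1)"


section \<open>Ergodic automorphisms\<close>

definition ergodic_for :: "('m::topological_space \<Rightarrow> 'm) \<Rightarrow> 'm measure \<Rightarrow> bool" where
  "ergodic_for f \<mu> \<longleftrightarrow>
     prob_space \<mu> \<and> sets \<mu> = sets borel \<and> f \<in> measurable \<mu> \<mu> \<and> distr \<mu> \<mu> f = \<mu> \<and>
     (\<forall>B\<in>sets \<mu>. f -` B = B \<longrightarrow> measure \<mu> B = 0 \<or> measure \<mu> B = 1)"


section \<open>Operators on the Hoelder space and bundles of subspaces\<close>

text \<open>Operators are functions on the ambient space, of which only the values on
  \<open>holder_space r\<close> matter.\<close>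

definition holder_operator ::
    "real \<Rightarrow> (((nat \<Rightarrow> 'l::{finite,discrete_topology}) \<Rightarrow>\<^sub>C real) \<Rightarrow> ((nat \<Rightarrow> 'l) \<Rightarrow>\<^sub>C real)) \<Rightarrow> bool"
where
  "holder_operator r B \<longleftrightarrow>
     (\<forall>g\<in>holder_space r. B g \<in> holder_space r) \<and>
     (\<forall>g\<in>holder_space r. \<forall>g'\<in>holder_space r. B (g + g') = B g + B g') \<and>
     (\<forall>g\<in>holder_space r. \<forall>c. B (c *\<^sub>R g) = c *\<^sub>R B g) \<and>
     (\<exists>K. \<forall>g\<in>holder_space r. holder_norm r (B g) \<le> K * holder_norm r g)"

definition positive_operator ::
    "real \<Rightarrow> (((nat \<Rightarrow> 'l::{finite,discrete_topology}) \<Rightarrow>\<^sub>C real) \<Rightarrow> ((nat \<Rightarrow> 'l) \<Rightarrow>\<^sub>C real)) \<Rightarrow> bool"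
where
  "positive_operator r B \<longleftrightarrow>
     (\<forall>g\<in>holder_space r. (\<forall>w. 0 \<le> apply_bcontfun g w) \<longrightarrow> (\<forall>w. 0 \<le> apply_bcontfun (B g) w))"

text \<open>
  Continuity of families of operators and of bundles refers to the supremum norm. The Hoelder norm
  would be unsuitable: \<open>x \<mapsto> h x\<close> is in general discontinuous for it.
\<close>

definition continuous_operator_family ::
    "real \<Rightarrow> ('m::topological_space \<Rightarrow>
       ((nat \<Rightarrow> 'l::{finite,discrete_topology}) \<Rightarrow>\<^sub>C real) \<Rightarrow> ((nat \<Rightarrow> 'l) \<Rightarrow>\<^sub>C real)) \<Rightarrow> bool"
where
  "continuous_operator_family r A \<longleftrightarrow>
     (\<forall>x0. \<forall>e>0. eventually
        (\<lambda>x. \<forall>g\<in>holder_space r. norm (A x g - A x0 g) \<le> e * norm g) (nhds x0))"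

definition continuous_bundle ::
    "nat \<Rightarrow> ('m::topological_space \<Rightarrow> 'v::real_normed_vector set) \<Rightarrow> bool" where
  "continuous_bundle m W \<longleftrightarrow>
     (\<forall>x0. \<exists>U e. open U \<and> x0 \<in> U \<and>
        (\<forall>i<m. continuous_on U (e i)) \<and>
        (\<forall>x\<in>U. inj_on (\<lambda>i. e i x) {..<m} \<and> independent ((\<lambda>i. e i x) ` {..<m}) \<and>
                span ((\<lambda>i. e i x) ` {..<m}) = W x))"

definition sup_dense_in :: "real \<Rightarrow> 'v::metric_space set \<Rightarrow> 'v set \<Rightarrow> bool" where
  "sup_dense_in \<epsilon> V B \<longleftrightarrow> (\<forall>g\<in>B. \<exists>u\<in>V. dist g u \<le> \<epsilon>)"


section \<open>Lyapunov exponents and Oseledets splittings\<close>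

primrec cocycle :: "('m \<Rightarrow> 'm) \<Rightarrow> ('m \<Rightarrow> 'v \<Rightarrow> 'v) \<Rightarrow> nat \<Rightarrow> 'm \<Rightarrow> 'v \<Rightarrow> 'v" where
  "cocycle f A 0 x = id"
| "cocycle f A (Suc n) x = A ((f ^^ n) x) \<circ> cocycle f A n x"

definition log_ereal :: "real \<Rightarrow> ereal" where
  "log_ereal t = (if t \<le> 0 then -\<infinity> else ereal (ln t))"

definition growth ::
    "('m \<Rightarrow> 'm) \<Rightarrow> ('m \<Rightarrow> 'v \<Rightarrow> 'v::real_normed_vector) \<Rightarrow> 'm \<Rightarrow> 'v \<Rightarrow> nat \<Rightarrow> ereal" where
  "growth f A x v n = ereal (1 / real n) * log_ereal (norm (cocycle f A n x v))"

definition slow_space ::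
    "('m \<Rightarrow> 'm) \<Rightarrow> ('m \<Rightarrow> 'v \<Rightarrow> 'v::real_normed_vector) \<Rightarrow> ('m \<Rightarrow> 'v set) \<Rightarrow> ereal \<Rightarrow> 'm \<Rightarrow> 'v set"
where
  "slow_space f A W lam x = {v \<in> W x. limsup (growth f A x v) < lam}"

definition minus_infinity_space ::
    "('m \<Rightarrow> 'm) \<Rightarrow> ('m \<Rightarrow> 'v \<Rightarrow> 'v::real_normed_vector) \<Rightarrow> ('m \<Rightarrow> 'v set) \<Rightarrow> 'm \<Rightarrow> 'v set"
where
  "minus_infinity_space f A W x = {v \<in> W x. growth f A x v \<longlonglongrightarrow> -\<infinity>}"

definition subspace_sum :: "nat set \<Rightarrow> (nat \<Rightarrow> 'v::real_vector set) \<Rightarrow> 'v set" where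
  "subspace_sum I F = {(\<Sum>i\<in>I. v i) | v. \<forall>i\<in>I. v i \<in> F i}"

definition direct_sum_decomp :: "'v::real_vector set \<Rightarrow> nat set \<Rightarrow> (nat \<Rightarrow> 'v set) \<Rightarrow> bool" where
  "direct_sum_decomp V I F \<longleftrightarrow>
     (\<forall>i\<in>I. subspace (F i)) \<and> V = subspace_sum I F \<and>
     (\<forall>v. (\<forall>i\<in>I. v i \<in> F i) \<and> (\<Sum>i\<in>I. v i) = 0 \<longrightarrow> (\<forall>i\<in>I. v i = 0))"

text \<open>
  \<open>lam 0 > \<dots> > lam (k - 1)\<close> is the Lyapunov spectrum and \<open>E i x\<close> the Oseledets subspace
  of \<open>lam i\<close> at \<open>x\<close>.
\<close>

definition oseledets ::
    "('m \<Rightarrow> 'm) \<Rightarrow> 'm measure \<Rightarrow> ('m \<Rightarrow> 'v \<Rightarrow> 'v::real_normed_vector) \<Rightarrow> ('m \<Rightarrow> 'v set) \<Rightarrow>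
       nat \<Rightarrow> (nat \<Rightarrow> ereal) \<Rightarrow> (nat \<Rightarrow> 'm \<Rightarrow> 'v set) \<Rightarrow> bool" where
  "oseledets f \<mu> A W k lam E \<longleftrightarrow>
     (\<forall>i j. i < j \<and> j < k \<longrightarrow> lam j < lam i) \<and> (\<forall>i<k. lam i < \<infinity>) \<and>
     (AE x in \<mu>.
        direct_sum_decomp (W x) {..<k} (\<lambda>i. E i x) \<and>
        (\<forall>i<k. E i x \<noteq> {0} \<and>
           (lam i \<noteq> -\<infinity> \<longrightarrow> A x ` E i x = E i (f x)) \<and>
           (lam i = -\<infinity> \<longrightarrow> A x ` E i x \<subseteq> E i (f x)) \<and>
           (\<forall>v\<in>E i x - {0}. growth f A x v \<longlonglongrightarrow> lam i)))"


section \<open>Dominated splittings\<close>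

text \<open>
  \<open>norm_on B F\<close> is the operator norm of the restriction of \<open>B\<close> to \<open>F\<close>; below \<open>F\<close> is always
  finite-dimensional and \<open>B\<close> linear on it, so the supremum is finite.
\<close>

definition norm_on :: "('v \<Rightarrow> 'v::real_normed_vector) \<Rightarrow> 'v set \<Rightarrow> real" where
  "norm_on B F = Sup {norm (B v) | v. v \<in> F \<and> norm v \<le> 1}"

text \<open>The co-norm of \<open>B\<close> restricted to \<open>F\<close>, for \<open>B\<close> injective on \<open>F \<noteq> {0}\<close>.\<close>

definition conorm_on :: "('v \<Rightarrow> 'v::real_normed_vector) \<Rightarrow> 'v set \<Rightarrow> real" where
  "conorm_on B F = inverse (norm_on (inv_into F B) (B ` F))"

text \<open>
  Splittings into \<open>n\<close> subbundles over an \<open>f\<close>-invariant set; the fibres of a subbundle are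
  nontrivial and have constant dimension.
\<close>

definition invariant_splitting ::
    "('m \<Rightarrow> 'm) \<Rightarrow> ('m \<Rightarrow> 'v \<Rightarrow> 'v::real_normed_vector) \<Rightarrow> ('m \<Rightarrow> 'v set) \<Rightarrow> 'm set \<Rightarrow>
       nat \<Rightarrow> (nat \<Rightarrow> 'm \<Rightarrow> 'v set) \<Rightarrow> bool" where
  "invariant_splitting f A W \<Lambda> n F \<longleftrightarrow>
     f ` \<Lambda> = \<Lambda> \<and>
     (\<forall>x\<in>\<Lambda>. direct_sum_decomp (W x) {..<n} (\<lambda>i. F i x) \<and>
        (\<forall>i<n. F i x \<noteq> {0} \<and> A x ` F i x \<subseteq> F i (f x))) \<and>
     (\<forall>i<n. \<forall>x\<in>\<Lambda>. \<forall>y\<in>\<Lambda>. dim (F i x) = dim (F i y))"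

definition k_dominated ::
    "nat \<Rightarrow> ('m \<Rightarrow> 'm) \<Rightarrow> ('m \<Rightarrow> 'v \<Rightarrow> 'v::real_normed_vector) \<Rightarrow> ('m \<Rightarrow> 'v set) \<Rightarrow> 'm set \<Rightarrow>
       ('m \<Rightarrow> 'v set) \<Rightarrow> ('m \<Rightarrow> 'v set) \<Rightarrow> bool" where
  "k_dominated k f A W \<Lambda> F1 F2 \<longleftrightarrow>
     invariant_splitting f A W \<Lambda> 2 (\<lambda>i. if i = 0 then F1 else F2) \<and>
     (\<forall>x\<in>\<Lambda>. minus_infinity_space f A W x \<subseteq> F2 x \<and>
        inj_on (cocycle f A k x) (F1 x) \<and>
        norm_on (cocycle f A k x) (F2 x) / conorm_on (cocycle f A k x) (F1 x) \<le> 1 / 2)"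

definition dominated ::
    "('m \<Rightarrow> 'm) \<Rightarrow> ('m \<Rightarrow> 'v \<Rightarrow> 'v::real_normed_vector) \<Rightarrow> ('m \<Rightarrow> 'v set) \<Rightarrow> 'm set \<Rightarrow>
       ('m \<Rightarrow> 'v set) \<Rightarrow> ('m \<Rightarrow> 'v set) \<Rightarrow> bool" where
  "dominated f A W \<Lambda> F1 F2 \<longleftrightarrow> (\<exists>k\<ge>1. k_dominated k f A W \<Lambda> F1 F2)"

definition dominated_splitting ::
    "('m \<Rightarrow> 'm) \<Rightarrow> ('m \<Rightarrow> 'v \<Rightarrow> 'v::real_normed_vector) \<Rightarrow> ('m \<Rightarrow> 'v set) \<Rightarrow> 'm set \<Rightarrow>
       nat \<Rightarrow> (nat \<Rightarrow> 'm \<Rightarrow> 'v set) \<Rightarrow> bool" where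
  "dominated_splitting f A W \<Lambda> n F \<longleftrightarrow>
     invariant_splitting f A W \<Lambda> n F \<and>
     (\<forall>j. 1 \<le> j \<and> j < n \<longrightarrow>
        dominated f A W \<Lambda>
          (\<lambda>x. subspace_sum {..<j} (\<lambda>i. F i x)) (\<lambda>x. subspace_sum {j..<n} (\<lambda>i. F i x)))"

text \<open>
  A family of subspaces (given almost everywhere) defines a dominated splitting if it
  agrees almost everywhere with a dominated splitting over the whole base.
\<close>

definition defines_dominated_splitting ::
    "('m \<Rightarrow> 'm) \<Rightarrow> 'm measure \<Rightarrow> ('m \<Rightarrow> 'v \<Rightarrow> 'v::real_normed_vector) \<Rightarrow> ('m \<Rightarrow> 'v set) \<Rightarrow>
       nat \<Rightarrow> (nat \<Rightarrow> 'm \<Rightarrow> 'v set) \<Rightarrow> bool" where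
  "defines_dominated_splitting f \<mu> A W n E \<longleftrightarrow>
     (\<exists>F. dominated_splitting f A W UNIV n F \<and> (AE x in \<mu>. \<forall>i<n. F i x = E i x))"

end

theory Submission
  imports Defs
begin

text \<open>
  The operators \<open>A x\<close> can be taken to be the Ruelle operators themselves: every ball of the
  Hoelder space can be approximated by finite-dimensional bundles that the Ruelle operators
  preserve \<^emph>\<open>exactly\<close> and on which they are nilpotent modulo \<open>h x\<close>. The Lyapunov
  spectrum is then \<open>{\<integral> ln \<rho> d\<mu>, -\<infinity>}\<close>, and domination is trivial because some power of the
  cocycle vanishes on the complement of the line spanned by \<open>h x\<close>.

  Conjugating by \<open>h\<close> turns \<open>ruelle (\<phi> x)\<close> into a Markov operator
  \<open>T x u (w) = (\<Sum>a. P x (a w) * u (a w))\<close> with \<open>T x 1 = 1\<close>. Composition with the shift,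
  \<open>U u = u \<circ> left_shift\<close>, is a right inverse of every \<open>T x\<close> and an isometry of the supremum
  norm. Therefore
  \<open>u = (u - U (T u)) + U (T u - U (T (T u))) + \<dots> + U ^ N (T ^ N u)\<close>,
  the decomposition of \<open>u\<close> into (reverse) martingale differences. All terms but the last have the
  form \<open>U ^ j k\<close> with \<open>T k = 0\<close>, and for Hoelder \<open>u\<close> the last one is nearly constant when \<open>N\<close>
  is large, by uniform mixing (\<open>uniform_mixing\<close>). Replacing each kernel element by one taken from
  the finite-dimensional space of all \<open>v - U (T v)\<close>, where \<open>v\<close> depends on \<open>n\<close> coordinates only,
  costs an arbitrarily small error (\<open>comb_approx\<close>). The functions obtained in this way form a
  finite-dimensional space, and \<open>T\<close> maps \<open>U ^ j k\<close> to \<open>U ^ (j - 1) k\<close>, respectively to \<open>0\<close> if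
  \<open>j = 0\<close>: the bundle is invariant and \<open>T ^ N\<close> maps it to the constants (\<open>T_iter_comb\<close>).
  This does not conflict with the nonzero eigenvalues that \<open>T\<close> may have on Hoelder functions
  of mean 0: density refers to the supremum norm, which does not see how irregular
  \<open>U ^ j k\<close> is.

  Two more ingredients are needed. The bundle is continuous because \<open>\<rho>\<close> and \<open>h\<close> are
  (\<open>\<rho>_cont\<close>, \<open>h_joint\<close>): mixing exhibits them as uniform limits of expressions that involve only
  iterates of the Ruelle operators on the constant function 1. And the growth rate along \<open>h x\<close> is
  the time average of \<open>ln \<rho>\<close>, which Birkhoff's theorem (\<open>birkhoff_ergodic\<close>) evaluates almost
  everywhere.
\<close>

section \<open>Hoelder functions on the shift\<close>

text \<open>
  The Hoelder condition in terms of agreement of initial words. In this form it passes directly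
  to prepended and shifted sequences.
\<close>

definition holder_bound :: "real \<Rightarrow> real \<Rightarrow> ((nat \<Rightarrow> 'l) \<Rightarrow> real) \<Rightarrow> bool" where
  "holder_bound r C g \<longleftrightarrow> (\<forall>k v w. (\<forall>i<k. v i = w i) \<longrightarrow> \<bar>g v - g w\<bar> \<le> C * r ^ k)"

definition osc_bound :: "real \<Rightarrow> ((nat \<Rightarrow> 'l) \<Rightarrow> real) \<Rightarrow> bool" where
  "osc_bound c g \<longleftrightarrow> (\<forall>v w. \<bar>g v - g w\<bar> \<le> c)"

lemma holder_boundI:
  assumes "\<And>k v w. \<forall>i<k. v i = w i \<Longrightarrow> \<bar>g v - g w\<bar> \<le> C * r ^ k"
  shows "holder_bound r C g"
  using assms by (simp add: holder_bound_def)

lemma holder_boundD: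
  assumes "holder_bound r C g" "\<forall>i<k. v i = w i"
  shows "\<bar>g v - g w\<bar> \<le> C * r ^ k"
  using assms by (simp add: holder_bound_def)

lemma osc_boundI: "(\<And>v w. \<bar>g v - g w\<bar> \<le> c) \<Longrightarrow> osc_bound c g"
  by (simp add: osc_bound_def)

lemma osc_boundD: "osc_bound c g \<Longrightarrow> \<bar>g v - g w\<bar> \<le> c"
  by (simp add: osc_bound_def)

lemma osc_bound_nonneg: "osc_bound c g \<Longrightarrow> 0 \<le> c"
  using osc_boundD[of c g undefined undefined] by simp

lemma holder_bound_osc: "holder_bound r C g \<Longrightarrow> osc_bound C g"
  using holder_boundD[of r C g 0] by (simp add: osc_bound_def)

lemma holder_bound_nonneg: "holder_bound r C g \<Longrightarrow> 0 \<le> C"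
  using holder_bound_osc osc_bound_nonneg by blast

lemma holder_bound_mono: "holder_bound r C g \<Longrightarrow> C \<le> C' \<Longrightarrow> 0 < r \<Longrightarrow> holder_bound r C' g"
  unfolding holder_bound_def
  by (meson mult_right_mono order_trans zero_le_power less_imp_le)

lemma osc_bound_mono: "osc_bound c g \<Longrightarrow> c \<le> c' \<Longrightarrow> osc_bound c' g"
  unfolding osc_bound_def by (meson order_trans)

lemma holder_bound_iff_quotients:
  assumes r: "0 < r" "r < 1" and C: "0 \<le> C"
  shows "holder_bound r C g \<longleftrightarrow> (\<forall>y\<in>holder_quotients r g. y \<le> C)"
proof
  assume g: "holder_bound r C g"
  show "\<forall>y\<in>holder_quotients r g. y \<le> C"
  proof
    fix y assume "y \<in> holder_quotients r g"
    then obtain v w where vw: "v \<noteq> w" "y = \<bar>g v - g w\<bar> / shift_dist r v w"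
      by (auto simp: holder_quotients_def)
    define k where "k = (LEAST i. v i \<noteq> w i)"
    have "\<forall>i<k. v i = w i"
      unfolding k_def by (auto dest: not_less_Least)
    hence "\<bar>g v - g w\<bar> \<le> C * r ^ k" by (rule holder_boundD[OF g])
    thus "y \<le> C" using vw r by (simp add: shift_dist_def k_def pos_divide_le_eq)
  qed
next
  assume q: "\<forall>y\<in>holder_quotients r g. y \<le> C"
  show "holder_bound r C g"
  proof (rule holder_boundI)
    fix k and v w :: "nat \<Rightarrow> 'a"
    assume agree: "\<forall>i<k. v i = w i"
    show "\<bar>g v - g w\<bar> \<le> C * r ^ k"
    proof (cases "v = w")
      case False
      define j where "j = (LEAST i. v i \<noteq> w i)"
      have "v j \<noteq> w j" unfolding j_def by (rule LeastI_ex) (use False in auto)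
      hence "k \<le> j" using agree by (meson not_less)
      have "\<bar>g v - g w\<bar> / shift_dist r v w \<le> C"
        using q False by (auto simp: holder_quotients_def)
      hence "\<bar>g v - g w\<bar> \<le> C * r ^ j"
        using False r by (simp add: shift_dist_def j_def field_simps)
      also have "\<dots> \<le> C * r ^ k"
        using r C \<open>k \<le> j\<close> by (intro mult_left_mono power_decreasing) auto
      finally show ?thesis .
    qed (use r C in simp)
  qed
qed

lemma is_holder_iff:
  assumes r: "0 < r" "r < 1"
  shows "is_holder r g \<longleftrightarrow> (\<exists>C. holder_bound r C g)"
proof
  assume "is_holder r g"
  then obtain C where "\<And>y. y \<in> holder_quotients r g \<Longrightarrow> y \<le> C"
    by (auto simp: is_holder_def bdd_above_def)
  hence "holder_bound r (max C 0) g"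
    by (subst holder_bound_iff_quotients[OF r]) (auto simp: le_max_iff_disj)
  thus "\<exists>C. holder_bound r C g" ..
next
  assume "\<exists>C. holder_bound r C g"
  then obtain C where C: "holder_bound r C g" ..
  have "\<forall>y\<in>holder_quotients r g. y \<le> C"
    using holder_bound_iff_quotients[OF r holder_bound_nonneg[OF C]] C by blast
  moreover have "\<bar>g v\<bar> \<le> \<bar>g undefined\<bar> + C" for v
    using osc_boundD[OF holder_bound_osc[OF C], of v undefined] by linarith
  ultimately show "is_holder r g"
    by (auto simp: is_holder_def bounded_iff bdd_above_def)
qed

lemma holder_quotients_nonempty:
  assumes card: "CARD('l::finite) \<ge> 2"
  shows "holder_quotients r (g :: (nat \<Rightarrow> 'l) \<Rightarrow> real) \<noteq> {}"
proof -
  obtain a b :: 'l where "a \<noteq> b"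
    using card by (metis (full_types) One_nat_def UNIV_I card_1_singleton_iff card_le_Suc0_iff_eq
        finite_class.finite_UNIV not_less_eq_eq numeral_2_eq_2)
  hence "(\<lambda>_::nat. a) \<noteq> (\<lambda>_. b)" by (auto dest: fun_cong)
  thus ?thesis unfolding holder_quotients_def by blast
qed

lemma holder_const_le:
  assumes r: "0 < r" "r < 1" and card: "CARD('l::finite) \<ge> 2"
    and g: "holder_bound r C (g :: (nat \<Rightarrow> 'l) \<Rightarrow> real)"
  shows "holder_const r g \<le> C"
proof -
  show ?thesis
    unfolding holder_const_def
    using holder_quotients_nonempty[OF card, of r g] holder_bound_iff_quotients[OF r holder_bound_nonneg[OF g], of g] g
    by (auto intro: cSup_least)
qed

lemma holder_bound_holder_const:
  assumes r: "0 < r" "r < 1" and card: "CARD('l::finite) \<ge> 2"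
    and g: "is_holder r (g :: (nat \<Rightarrow> 'l) \<Rightarrow> real)"
  shows "holder_bound r (holder_const r g) g"
proof -
  obtain y where y: "y \<in> holder_quotients r g"
    using holder_quotients_nonempty[OF card, of r g] by blast
  have bdd: "bdd_above (holder_quotients r g)" using g by (simp add: is_holder_def)
  have "0 \<le> y" using y r by (auto simp: holder_quotients_def shift_dist_def)
  also have "y \<le> holder_const r g"
    unfolding holder_const_def by (rule cSup_upper[OF y bdd])
  finally show ?thesis
    using bdd by (subst holder_bound_iff_quotients[OF r])
      (auto simp: holder_const_def intro: cSup_upper)
qed

lemma holder_bound_const: "0 < r \<Longrightarrow> 0 \<le> C \<Longrightarrow> holder_bound r C (\<lambda>_. c)"
  by (rule holder_boundI) simp

lemma holder_bound_add:
  assumes "holder_bound r C g" "holder_bound r C' g'"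
  shows "holder_bound r (C + C') (\<lambda>w. g w + g' w)"
proof (rule holder_boundI)
  fix k and v w :: "nat \<Rightarrow> 'a" assume ag: "\<forall>i<k. v i = w i"
  show "\<bar>g v + g' v - (g w + g' w)\<bar> \<le> (C + C') * r ^ k"
    using holder_boundD[OF assms(1) ag] holder_boundD[OF assms(2) ag]
    by (simp add: distrib_right)
qed

lemma holder_bound_cmult:
  assumes "holder_bound r C g"
  shows "holder_bound r (\<bar>c\<bar> * C) (\<lambda>w. c * g w)"
proof (rule holder_boundI)
  fix k and v w :: "nat \<Rightarrow> 'a" assume ag: "\<forall>i<k. v i = w i"
  have "\<bar>c * g v - c * g w\<bar> = \<bar>c\<bar> * \<bar>g v - g w\<bar>" by (simp add: abs_mult flip: right_diff_distrib)
  thus "\<bar>c * g v - c * g w\<bar> \<le> \<bar>c\<bar> * C * r ^ k"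
    using mult_left_mono[OF holder_boundD[OF assms ag], of "\<bar>c\<bar>"] by (simp add: mult.assoc)
qed

lemma holder_bound_sum:
  assumes "0 < r" "finite I" "\<And>i. i \<in> I \<Longrightarrow> holder_bound r (C i) (g i)"
  shows "holder_bound r (\<Sum>i\<in>I. C i) (\<lambda>w. \<Sum>i\<in>I. g i w)"
  using assms(2,3)
  by (induction I rule: finite_induct) (simp_all add: holder_bound_const[OF assms(1)] holder_bound_add)

lemma holder_bound_mult:
  assumes r: "0 < r" and g: "holder_bound r C g" "\<And>w. \<bar>g w\<bar> \<le> G"
    and g': "holder_bound r C' g'" "\<And>w. \<bar>g' w\<bar> \<le> G'"
  shows "holder_bound r (C * G' + G * C') (\<lambda>w. g w * g' w)"
proof (rule holder_boundI)
  fix k and v w :: "nat \<Rightarrow> 'a" assume ag: "\<forall>i<k. v i = w i"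
  have "g v * g' v - g w * g' w = (g v - g w) * g' v + g w * (g' v - g' w)"
    by (simp add: algebra_simps)
  also have "\<bar>\<dots>\<bar> \<le> \<bar>g v - g w\<bar> * \<bar>g' v\<bar> + \<bar>g w\<bar> * \<bar>g' v - g' w\<bar>"
    by (metis abs_mult abs_triangle_ineq)
  also have "\<dots> \<le> (C * r ^ k) * G' + G * (C' * r ^ k)"
    using holder_boundD[OF g(1) ag] holder_boundD[OF g'(1) ag] g(2)[of w] g'(2)[of v]
    by (intro add_mono mult_mono) auto
  finally show "\<bar>g v * g' v - g w * g' w\<bar> \<le> (C * G' + G * C') * r ^ k"
    by (simp add: algebra_simps)
qed

lemma holder_bound_inverse:
  assumes g: "holder_bound r C g" and low: "0 < \<eta>" "\<And>w. \<eta> \<le> g w"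
  shows "holder_bound r (C / \<eta>\<^sup>2) (\<lambda>w. 1 / g w)"
proof (rule holder_boundI)
  fix k and v w :: "nat \<Rightarrow> 'a" assume ag: "\<forall>i<k. v i = w i"
  have pos: "0 < g v" "0 < g w" using low by (meson less_le_trans)+
  have "1 / g v - 1 / g w = (g w - g v) / (g v * g w)"
    using pos by (simp add: field_simps)
  hence "\<bar>1 / g v - 1 / g w\<bar> = \<bar>g v - g w\<bar> / (g v * g w)"
    using pos by (simp add: abs_mult abs_minus_commute)
  also have "\<dots> \<le> (C * r ^ k) / (\<eta> * \<eta>)"
    using holder_boundD[OF g ag] low pos by (intro frac_le mult_mono) auto
  finally show "\<bar>1 / g v - 1 / g w\<bar> \<le> C / \<eta>\<^sup>2 * r ^ k"
    by (simp add: power2_eq_square)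
qed

lemma abs_exp_diff_le:
  fixes a b :: real
  assumes "a \<le> B" "b \<le> B"
  shows "\<bar>exp a - exp b\<bar> \<le> exp B * \<bar>a - b\<bar>"
proof -
  have *: "exp a - exp b \<le> exp B * (a - b)" if "b \<le> a" "a \<le> B" for a b :: real
  proof -
    have "exp a * (1 + (b - a)) \<le> exp a * exp (b - a)"
      by (intro mult_left_mono exp_ge_add_one_self) auto
    hence "exp a - exp b \<le> exp a * (a - b)" by (simp add: algebra_simps flip: exp_add)
    also have "\<dots> \<le> exp B * (a - b)" using that by (intro mult_right_mono) auto
    finally show ?thesis .
  qed
  show ?thesis
    using *[of a b] *[of b a] assms by (cases "b \<le> a") auto
qed

lemma holder_bound_exp:
  assumes g: "holder_bound r C g" "\<And>w. g w \<le> B"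
  shows "holder_bound r (exp B * C) (\<lambda>w. exp (g w))"
proof (rule holder_boundI)
  fix k and v w :: "nat \<Rightarrow> 'a" assume ag: "\<forall>i<k. v i = w i"
  have "\<bar>exp (g v) - exp (g w)\<bar> \<le> exp B * \<bar>g v - g w\<bar>"
    by (rule abs_exp_diff_le) (rule g(2))+
  also have "\<dots> \<le> exp B * (C * r ^ k)" by (intro mult_left_mono holder_boundD[OF g(1) ag]) auto
  finally show "\<bar>exp (g v) - exp (g w)\<bar> \<le> exp B * C * r ^ k" by (simp add: mult.assoc)
qed

lemma holder_bound_prepend:
  assumes "holder_bound r C g"
  shows "holder_bound r (C * r) (\<lambda>w. g (case_nat a w))"
proof (rule holder_boundI)
  fix k and v w :: "nat \<Rightarrow> 'a" assume ag: "\<forall>i<k. v i = w i"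
  have "\<bar>g (case_nat a v) - g (case_nat a w)\<bar> \<le> C * r ^ Suc k"
    by (rule holder_boundD[OF assms]) (auto simp: less_Suc_eq_0_disj ag)
  thus "\<bar>g (case_nat a v) - g (case_nat a w)\<bar> \<le> C * r * r ^ k" by (simp add: mult.assoc)
qed

lemma holder_bound_shift:
  assumes r: "0 < r" "r < 1" and g: "holder_bound r C g"
  shows "holder_bound r (C / r) (\<lambda>w. g (left_shift w))"
proof (rule holder_boundI)
  fix k and v w :: "nat \<Rightarrow> 'a" assume ag: "\<forall>i<k. v i = w i"
  have "\<bar>g (left_shift v) - g (left_shift w)\<bar> \<le> C * r ^ (k - 1)"
    by (rule holder_boundD[OF g]) (auto simp: left_shift_def ag)
  also have "\<dots> \<le> C / r * r ^ k"
  proof (cases k)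
    case 0
    have "C * r \<le> C" using holder_bound_nonneg[OF g] r by (simp add: mult_left_le)
    thus ?thesis using 0 r by (simp add: field_simps)
  qed (use r in simp)
  finally show "\<bar>g (left_shift v) - g (left_shift w)\<bar> \<le> C / r * r ^ k" .
qed

section \<open>Mixing of Markov transfer operators\<close>

definition transfer ::
    "((nat \<Rightarrow> 'l) \<Rightarrow> real) \<Rightarrow> ((nat \<Rightarrow> 'l::finite) \<Rightarrow> real) \<Rightarrow> (nat \<Rightarrow> 'l) \<Rightarrow> real" where
  "transfer p u w = (\<Sum>a\<in>UNIV. p (case_nat a w) * u (case_nat a w))"

lemma transfer_sum:
  "transfer p (\<lambda>v. \<Sum>i\<in>I. c i * u i v) = (\<lambda>w. \<Sum>i\<in>I. c i * transfer p (u i) w)"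
proof
  fix w
  have "transfer p (\<lambda>v. \<Sum>i\<in>I. c i * u i v) w =
      (\<Sum>a\<in>UNIV. \<Sum>i\<in>I. c i * (p (case_nat a w) * u i (case_nat a w)))"
    by (simp add: transfer_def sum_distrib_left mult.left_commute)
  also have "\<dots> = (\<Sum>i\<in>I. c i * transfer p (u i) w)"
    by (subst sum.swap) (simp add: transfer_def sum_distrib_left)
  finally show "transfer p (\<lambda>v. \<Sum>i\<in>I. c i * u i v) w = (\<Sum>i\<in>I. c i * transfer p (u i) w)" .
qed

lemma transfer_add: "transfer p (\<lambda>v. u v + u' v) = (\<lambda>w. transfer p u w + transfer p u' w)"
  by (simp add: fun_eq_iff transfer_def distrib_left sum.distrib)

lemma transfer_diff: "transfer p (\<lambda>v. u v - u' v) = (\<lambda>w. transfer p u w - transfer p u' w)"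
  by (simp add: fun_eq_iff transfer_def right_diff_distrib sum_subtractf)

definition markov_weight :: "real \<Rightarrow> real \<Rightarrow> real \<Rightarrow> ((nat \<Rightarrow> 'l::finite) \<Rightarrow> real) \<Rightarrow> bool" where
  "markov_weight r \<delta> D p \<longleftrightarrow>
     (\<forall>w. (\<Sum>a\<in>UNIV. p (case_nat a w)) = 1) \<and> (\<forall>v. \<delta> \<le> p v) \<and> holder_bound r D p"

lemma markov_weight_card:
  assumes "markov_weight r \<delta> D (p :: (nat \<Rightarrow> 'l::finite) \<Rightarrow> real)"
  shows "real CARD('l) * \<delta> \<le> 1"
proof -
  have "real CARD('l) * \<delta> = (\<Sum>a\<in>(UNIV::'l set). \<delta>)" by simp
  also have "\<dots> \<le> (\<Sum>a\<in>UNIV. p (case_nat a undefined))"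
    using assms by (intro sum_mono) (simp add: markov_weight_def)
  also have "\<dots> = 1" using assms by (simp add: markov_weight_def)
  finally show ?thesis .
qed

text \<open>
  Two averages of total mass \<open>m\<close> are compared through the largest value of \<open>x\<close>, which exceeds
  every value of \<open>y\<close> by at most \<open>c\<close>.
\<close>

lemma weighted_diff_le:
  fixes \<alpha> \<beta> x y :: "'a::finite \<Rightarrow> real"
  assumes pos: "\<And>a. 0 \<le> \<alpha> a" "\<And>a. 0 \<le> \<beta> a" and mass: "(\<Sum>a\<in>UNIV. \<alpha> a) = m" "(\<Sum>a\<in>UNIV. \<beta> a) = m"
    and le: "\<And>a b. x a - y b \<le> c"
  shows "(\<Sum>a\<in>UNIV. \<alpha> a * x a) - (\<Sum>a\<in>UNIV. \<beta> a * y a) \<le> m * c"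
proof -
  define X where "X = Max (range x)"
  have X: "x a \<le> X" for a unfolding X_def by (rule Max_ge) auto
  have "X \<in> range x" unfolding X_def by (rule Max_in) auto
  hence Y: "X - c \<le> y b" for b using le[of _ b] by (auto simp: algebra_simps)
  have "(\<Sum>a\<in>UNIV. \<alpha> a * x a) \<le> (\<Sum>a\<in>UNIV. \<alpha> a * X)"
    by (intro sum_mono mult_left_mono X pos)
  also have "\<dots> = m * X" by (simp add: mass flip: sum_distrib_right)
  finally have "(\<Sum>a\<in>UNIV. \<alpha> a * x a) \<le> m * X" .
  moreover have "(\<Sum>a\<in>UNIV. \<beta> a * (X - c)) \<le> (\<Sum>a\<in>UNIV. \<beta> a * y a)"
    by (intro sum_mono mult_left_mono Y pos)
  hence "m * (X - c) \<le> (\<Sum>a\<in>UNIV. \<beta> a * y a)"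
    by (simp only: mass flip: sum_distrib_right)
  ultimately show ?thesis by (simp add: algebra_simps)
qed

text \<open>
  A Doeblin coupling: with probability \<open>CARD('l) * \<delta>\<close> the same letter is prepended to both
  sequences, so that the values of \<open>u\<close> differ by at most \<open>e\<close>; otherwise they differ by at most
  the oscillation \<open>c\<close>.
\<close>

lemma transfer_coupling:
  fixes p :: "(nat \<Rightarrow> 'l::finite) \<Rightarrow> real"
  assumes p: "markov_weight r \<delta> D p" and \<delta>: "0 \<le> \<delta>" and c: "osc_bound c u"
    and e: "\<And>a. \<bar>u (case_nat a v) - u (case_nat a w)\<bar> \<le> e"
  shows "\<bar>transfer p u v - transfer p u w\<bar> \<le> real CARD('l) * \<delta> * e + (1 - real CARD('l) * \<delta>) * c"
proof -
  let ?s = "real CARD('l) * \<delta>"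
  have main: "transfer p u v - transfer p u w \<le> ?s * e + (1 - ?s) * c"
    if e: "\<And>a. \<bar>u (case_nat a v) - u (case_nat a w)\<bar> \<le> e" for v w
  proof -
    have split: "transfer p u z = \<delta> * (\<Sum>a\<in>UNIV. u (case_nat a z)) +
        (\<Sum>a\<in>UNIV. (p (case_nat a z) - \<delta>) * u (case_nat a z))" for z
      by (simp add: transfer_def left_diff_distrib sum_subtractf sum_distrib_left)
    have "(\<Sum>a\<in>UNIV. (p (case_nat a v) - \<delta>) * u (case_nat a v)) -
        (\<Sum>a\<in>UNIV. (p (case_nat a w) - \<delta>) * u (case_nat a w)) \<le> (1 - ?s) * c"
      using p osc_boundD[OF c]
      by (intro weighted_diff_le) (auto simp: markov_weight_def sum_subtractf abs_le_iff)
    moreover have "(\<Sum>a\<in>UNIV. u (case_nat a v)) - (\<Sum>a\<in>UNIV. u (case_nat a w)) \<le> real CARD('l) * e"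
    proof -
      have "(\<Sum>a\<in>UNIV. u (case_nat a v) - u (case_nat a w)) \<le> (\<Sum>a\<in>(UNIV::'l set). e)"
        using e by (intro sum_mono) (simp add: abs_le_iff)
      thus ?thesis by (simp add: sum_subtractf)
    qed
    hence "\<delta> * ((\<Sum>a\<in>UNIV. u (case_nat a v)) - (\<Sum>a\<in>UNIV. u (case_nat a w))) \<le> \<delta> * (real CARD('l) * e)"
      using \<delta> by (rule mult_left_mono)
    ultimately show ?thesis unfolding split by (simp add: algebra_simps)
  qed
  have "\<bar>u (case_nat a w) - u (case_nat a v)\<bar> \<le> e" for a
    using e[of a] by (simp add: abs_minus_commute)
  from main[OF this] main[OF e] show ?thesis by (simp add: abs_le_iff)
qed

lemma transfer_osc:
  fixes p :: "(nat \<Rightarrow> 'l::finite) \<Rightarrow> real"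
  assumes p: "markov_weight r \<delta> D p" "0 \<le> \<delta>" and c: "osc_bound c u"
  shows "osc_bound c (transfer p u)"
  using transfer_coupling[OF p c osc_boundD[OF c]] by (intro osc_boundI) (simp add: algebra_simps)

text \<open>
  Prepending a letter contracts distances by \<open>r\<close>, which gives the term \<open>r * b\<close>. The second term
  comes from the variation of the weight, which is only tested against the oscillation of \<open>u\<close>
  since the weights of both points have the same sum. This is the Lasota--Yorke inequality.
\<close>

lemma transfer_holder:
  fixes p :: "(nat \<Rightarrow> 'l::finite) \<Rightarrow> real"
  assumes r: "0 < r" "r < 1" and p: "markov_weight r \<delta> D p" "0 \<le> \<delta>"
    and c: "osc_bound c u" and b: "holder_bound r b u"
  shows "holder_bound r (r * b + c * (real CARD('l) * D)) (transfer p u)"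
proof (rule holder_boundI)
  fix k and v w :: "nat \<Rightarrow> 'l" assume ag: "\<forall>i<k. v i = w i"
  have sum1: "(\<Sum>a\<in>UNIV. p (case_nat a z)) = 1" and pos: "0 \<le> p z" for z
    using p by (auto simp: markov_weight_def intro: order_trans)
  have pD: "holder_bound r D p" using p by (simp add: markov_weight_def)
  have ag': "\<forall>i<Suc k. case_nat a v i = case_nat a w i" for a
    using ag by (auto split: nat.split)
  have eq: "transfer p u v - transfer p u w =
      (\<Sum>a\<in>UNIV. p (case_nat a v) * (u (case_nat a v) - u (case_nat a w)) +
         (p (case_nat a v) - p (case_nat a w)) * (u (case_nat a w) - u w))"
  proof -
    have "(\<Sum>a\<in>UNIV. (p (case_nat a v) - p (case_nat a w)) * u w) = 0"
      by (simp add: sum_subtractf sum1 flip: sum_distrib_right)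
    moreover have "(\<Sum>a\<in>UNIV. p (case_nat a v) * (u (case_nat a v) - u (case_nat a w)) +
         (p (case_nat a v) - p (case_nat a w)) * (u (case_nat a w) - u w)) =
         transfer p u v - transfer p u w - (\<Sum>a\<in>UNIV. (p (case_nat a v) - p (case_nat a w)) * u w)"
      unfolding transfer_def sum_subtractf[symmetric]
      by (intro sum.cong refl) (simp add: algebra_simps)
    ultimately show ?thesis by simp
  qed
  have "\<bar>transfer p u v - transfer p u w\<bar> \<le>
      (\<Sum>a\<in>UNIV. p (case_nat a v) * (b * r ^ Suc k) + (D * r ^ k) * c)"
    unfolding eq
  proof (rule order_trans[OF sum_abs sum_mono])
    fix a
    have "\<bar>p (case_nat a v) * (u (case_nat a v) - u (case_nat a w)) +
         (p (case_nat a v) - p (case_nat a w)) * (u (case_nat a w) - u w)\<bar> \<le>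
       p (case_nat a v) * \<bar>u (case_nat a v) - u (case_nat a w)\<bar> +
       \<bar>p (case_nat a v) - p (case_nat a w)\<bar> * \<bar>u (case_nat a w) - u w\<bar>"
      by (rule order_trans[OF abs_triangle_ineq]) (simp add: abs_mult pos)
    also have "\<dots> \<le> p (case_nat a v) * (b * r ^ Suc k) + (D * r ^ Suc k) * c"
      using holder_boundD[OF b ag'[of a]] holder_boundD[OF pD ag'[of a]] osc_boundD[OF c]
        holder_bound_nonneg[OF pD] r
      by (intro add_mono mult_mono mult_nonneg_nonneg pos order_refl) auto
    also have "\<dots> \<le> p (case_nat a v) * (b * r ^ Suc k) + (D * r ^ k) * c"
      using r holder_bound_nonneg[OF pD] osc_bound_nonneg[OF c]
      by (intro add_left_mono mult_right_mono mult_left_mono power_decreasing) auto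
    finally show "\<bar>p (case_nat a v) * (u (case_nat a v) - u (case_nat a w)) +
         (p (case_nat a v) - p (case_nat a w)) * (u (case_nat a w) - u w)\<bar> \<le>
       p (case_nat a v) * (b * r ^ Suc k) + (D * r ^ k) * c" .
  qed
  also have "\<dots> = (r * b + c * (real CARD('l) * D)) * r ^ k"
    by (simp add: sum.distrib sum1 algebra_simps flip: sum_distrib_left sum_distrib_right)
  finally show "\<bar>transfer p u v - transfer p u w\<bar> \<le> (r * b + c * (real CARD('l) * D)) * r ^ k" .
qed

lemma cocycle_add:
  "cocycle f A (m + n) x v = cocycle f A n ((f ^^ m) x) (cocycle f A m x v)"
proof (induction n)
  case (Suc n)
  have "(f ^^ n) ((f ^^ m) x) = (f ^^ (m + n)) x" by (simp add: add.commute[of m] funpow_add)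
  thus ?case using Suc by simp
qed simp

lemma cocycle_Suc_front: "cocycle f A (Suc n) x v = cocycle f A n (f x) (A x v)"
  using cocycle_add[of f A 1 n x v] by simp

context
  fixes r \<delta> D :: real and p :: "'m \<Rightarrow> (nat \<Rightarrow> 'l::finite) \<Rightarrow> real" and f :: "'m \<Rightarrow> 'm"
  assumes r: "0 < r" "r < 1" and \<delta>: "0 < \<delta>" and p: "\<And>x. markov_weight r \<delta> D (p x)"
begin

lemma cocycle_transfer_osc:
  "osc_bound c u \<Longrightarrow> osc_bound c (cocycle f (\<lambda>x. transfer (p x)) n x u)"
  by (induction n) (use transfer_osc[OF p] \<delta> in auto)

text \<open>
  The Lasota--Yorke inequality summed as a geometric series.
\<close>

lemma cocycle_transfer_holder:
  assumes c: "osc_bound c u" and b: "holder_bound r b u"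
  shows "holder_bound r (r ^ n * b + c * (real CARD('l) * D / (1 - r)))
           (cocycle f (\<lambda>x. transfer (p x)) n x u)"
proof (induction n)
  case 0
  have "0 \<le> D" using p by (meson holder_bound_nonneg markov_weight_def)
  hence "0 \<le> c * (real CARD('l) * D / (1 - r))"
    using r osc_bound_nonneg[OF c] by simp
  thus ?case using b r by (simp add: holder_bound_mono)
next
  case (Suc n)
  have "holder_bound r (r * (r ^ n * b + c * (real CARD('l) * D / (1 - r))) + c * (real CARD('l) * D))
     (cocycle f (\<lambda>x. transfer (p x)) (Suc n) x u)"
    using transfer_holder[OF r p _ cocycle_transfer_osc[OF c] Suc] \<delta> by simp
  also have "r * (r ^ n * b + c * (real CARD('l) * D / (1 - r))) + c * (real CARD('l) * D) =
     r ^ Suc n * b + c * (real CARD('l) * D / (1 - r))"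
    using r by (simp add: divide_simps) (simp add: algebra_simps)
  finally show ?case .
qed

text \<open>
  If the same letter is prepended in each of \<open>n\<close> steps, the two sequences end up agreeing on
  \<open>k + n\<close> coordinates; this has probability at least \<open>(CARD('l) * \<delta>) ^ n\<close>.
\<close>

lemma cocycle_transfer_coupling:
  assumes "osc_bound c u" "\<And>v w. \<forall>i<k + n. v i = w i \<Longrightarrow> \<bar>u v - u w\<bar> \<le> e"
    and "\<forall>i<k. v i = w i"
  shows "\<bar>cocycle f (\<lambda>x. transfer (p x)) n x u v - cocycle f (\<lambda>x. transfer (p x)) n x u w\<bar> \<le>
     (real CARD('l) * \<delta>) ^ n * e + (1 - (real CARD('l) * \<delta>) ^ n) * c"
  using assms
proof (induction n arbitrary: u x e)
  case (Suc n)
  define s where "s = real CARD('l) * \<delta>"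
  have "\<bar>cocycle f (\<lambda>x. transfer (p x)) n (f x) (transfer (p x) u) v -
         cocycle f (\<lambda>x. transfer (p x)) n (f x) (transfer (p x) u) w\<bar> \<le>
        s ^ n * (s * e + (1 - s) * c) + (1 - s ^ n) * c"
    unfolding s_def
  proof (rule Suc.IH[OF _ _ Suc.prems(3)])
    show "osc_bound c (transfer (p x) u)"
      using transfer_osc[OF p] \<delta> Suc.prems by auto
    fix v w :: "nat \<Rightarrow> 'l"
    assume "\<forall>i<k + n. v i = w i"
    hence "\<bar>u (case_nat a v) - u (case_nat a w)\<bar> \<le> e" for a
      by (intro Suc.prems(2)) (auto split: nat.split)
    thus "\<bar>transfer (p x) u v - transfer (p x) u w\<bar> \<le> real CARD('l) * \<delta> * e + (1 - real CARD('l) * \<delta>) * c"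
      using transfer_coupling[OF p _ Suc.prems(1)] \<delta> by auto
  qed
  also have "s ^ n * (s * e + (1 - s) * c) + (1 - s ^ n) * c = s ^ Suc n * e + (1 - s ^ Suc n) * c"
    by (simp add: algebra_simps)
  finally show ?case unfolding s_def by (simp only: cocycle_Suc_front)
qed simp

text \<open>
  On its own, neither oscillation nor Hoelder constant is contracted: coupling needs Hoelder
  regularity to profit from agreement of long words, and the Lasota--Yorke inequality leaves a
  multiple of the oscillation. With the Hoelder constant measured in units of \<open>M\<close> times
  the oscillation, for a large fixed \<open>M\<close>, a fixed number of steps contracts both bounds by the
  same factor, uniformly in the base point.
\<close>

lemma cocycle_transfer_contraction:
  obtains M \<kappa> N where "0 < M" "0 < \<kappa>" "\<kappa> < 1" "0 < N"
    "\<And>c u x. osc_bound c u \<Longrightarrow> holder_bound r (M * c) u \<Longrightarrow>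
       osc_bound (\<kappa> * c) (cocycle f (\<lambda>x. transfer (p x)) N x u) \<and>
       holder_bound r (M * (\<kappa> * c)) (cocycle f (\<lambda>x. transfer (p x)) N x u)"
proof -
  define E where "E = real CARD('l) * D / (1 - r)"
  \<comment> \<open>The choice of \<open>M\<close> makes \<open>E + 1/2 = M/2\<close>, so that the new Hoelder constant is at most \<open>M * c / 2\<close>
    as soon as \<open>r ^ N * M \<le> 1/2\<close>.\<close>
  define M where "M = 2 * E + 1"
  define s where "s = real CARD('l) * \<delta>"
  have "0 \<le> D" using p by (meson holder_bound_nonneg markov_weight_def)
  hence E: "0 \<le> E" using r by (simp add: E_def)
  hence M: "0 < M" by (simp add: M_def)
  have s: "0 < s" "s \<le> 1" using \<delta> markov_weight_card[OF p] by (auto simp: s_def)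
  obtain N0 where N0: "r ^ N0 < 1 / (2 * M)"
    using real_arch_pow_inv[of "1 / (2 * M)" r] r M by auto
  define N where "N = Suc N0"
  have N: "r ^ N < 1 / (2 * M)"
    using N0 r power_decreasing[of N0 N r] unfolding N_def by linarith
  define \<kappa> where "\<kappa> = 1 - s ^ N / 2"
  have sN: "0 < s ^ N" "s ^ N \<le> 1" using s by (auto simp: power_le_one)
  have \<kappa>: "1 / 2 \<le> \<kappa>" "\<kappa> < 1" using sN by (auto simp: \<kappa>_def)
  show ?thesis
  proof (rule that[of M \<kappa> N])
    fix c :: real and u :: "(nat \<Rightarrow> 'l) \<Rightarrow> real" and x
    assume c: "osc_bound c u" and b: "holder_bound r (M * c) u"
    have c0: "0 \<le> c" by (rule osc_bound_nonneg[OF c])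
    have rM: "r ^ N * M \<le> 1 / 2" using N M by (simp add: field_simps)
    have near: "\<bar>u v - u w\<bar> \<le> c / 2" if "\<forall>i<0 + N. v i = w i" for v w
    proof -
      have "\<bar>u v - u w\<bar> \<le> M * c * r ^ N" by (rule holder_boundD[OF b]) (use that in auto)
      also have "\<dots> \<le> (1/2) * c" using mult_right_mono[OF rM c0] by (simp add: algebra_simps)
      finally show ?thesis by simp
    qed
    have "osc_bound (\<kappa> * c) (cocycle f (\<lambda>x. transfer (p x)) N x u)"
    proof (rule osc_boundI)
      fix v w
      have "\<bar>cocycle f (\<lambda>x. transfer (p x)) N x u v - cocycle f (\<lambda>x. transfer (p x)) N x u w\<bar> \<le>
         s ^ N * (c / 2) + (1 - s ^ N) * c"
        unfolding s_def by (rule cocycle_transfer_coupling[OF c near]) auto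
      thus "\<bar>cocycle f (\<lambda>x. transfer (p x)) N x u v - cocycle f (\<lambda>x. transfer (p x)) N x u w\<bar> \<le> \<kappa> * c"
        by (simp add: \<kappa>_def algebra_simps)
    qed
    moreover have "r ^ N * (M * c) + c * E \<le> M * (\<kappa> * c)"
    proof -
      have "r ^ N * (M * c) + c * E = (r ^ N * M + E) * c" by (simp add: algebra_simps)
      also have "\<dots> \<le> (M / 2) * c"
        using rM by (intro mult_right_mono c0) (simp add: M_def)
      also have "\<dots> \<le> (M * \<kappa>) * c"
        using \<kappa> M by (intro mult_right_mono c0) simp
      finally show ?thesis by (simp add: algebra_simps)
    qed
    hence "holder_bound r (M * (\<kappa> * c)) (cocycle f (\<lambda>x. transfer (p x)) N x u)"
      using cocycle_transfer_holder[OF c b, of N x] r unfolding E_def[symmetric]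
      by (meson holder_bound_mono)
    ultimately show "osc_bound (\<kappa> * c) (cocycle f (\<lambda>x. transfer (p x)) N x u) \<and>
       holder_bound r (M * (\<kappa> * c)) (cocycle f (\<lambda>x. transfer (p x)) N x u)" ..
  next
    show "0 < M" "0 < \<kappa>" "\<kappa> < 1" "0 < N" using M \<kappa> by (auto simp: N_def)
  qed
qed

text \<open>
  The iterates become constant at a rate that depends neither on the base point nor on the choice
  of \<open>u\<close> in a bounded set of Hoelder functions.
\<close>

lemma uniform_mixing:
  assumes e: "0 < e"
  obtains N where "\<And>n x u. N \<le> n \<Longrightarrow> osc_bound c u \<Longrightarrow> holder_bound r b u \<Longrightarrow>
     osc_bound e (cocycle f (\<lambda>x. transfer (p x)) n x u)"
proof -
  obtain M \<kappa> N where M: "0 < M" "0 < \<kappa>" "\<kappa> < 1" "0 < N" and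
    contr: "\<And>c u x. osc_bound c u \<Longrightarrow> holder_bound r (M * c) u \<Longrightarrow>
       osc_bound (\<kappa> * c) (cocycle f (\<lambda>x. transfer (p x)) N x u) \<and>
       holder_bound r (M * (\<kappa> * c)) (cocycle f (\<lambda>x. transfer (p x)) N x u)"
    using cocycle_transfer_contraction by blast
  \<comment> \<open>Enlarging \<open>c\<close> puts the given class into the one-parameter family that is contracted.\<close>
  define c' where "c' = max c (b / M)"
  have iter: "osc_bound (\<kappa> ^ j * c') (cocycle f (\<lambda>x. transfer (p x)) (j * N) x u) \<and>
       holder_bound r (M * (\<kappa> ^ j * c')) (cocycle f (\<lambda>x. transfer (p x)) (j * N) x u)"
    if "osc_bound c u" "holder_bound r b u" for j u x
  proof (induction j)
    case 0
    have "b \<le> M * c'" using M by (simp add: c'_def field_simps max_def)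
    thus ?case using that r by (auto simp: c'_def intro: osc_bound_mono holder_bound_mono)
  next
    case (Suc j)
    from contr[OF conjunct1[OF Suc] conjunct2[OF Suc], of "(f ^^ (j * N)) x"]
    show ?case by (simp add: cocycle_add[symmetric] add.commute mult.assoc)
  qed
  obtain j where j: "\<kappa> ^ j < e / (\<bar>c'\<bar> + 1)"
    using real_arch_pow_inv[of "e / (\<bar>c'\<bar> + 1)" \<kappa>] M e by auto
  have "\<kappa> ^ j * c' \<le> \<kappa> ^ j * (\<bar>c'\<bar> + 1)" using M by (intro mult_left_mono) auto
  also have "\<dots> \<le> e" using j by (simp add: field_simps)
  finally have je: "\<kappa> ^ j * c' \<le> e" .
  show ?thesis
  proof (rule that[of "j * N"])
    fix n x and u :: "(nat \<Rightarrow> 'l) \<Rightarrow> real"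
    assume n: "j * N \<le> n" and u: "osc_bound c u" "holder_bound r b u"
    have "osc_bound e (cocycle f (\<lambda>x. transfer (p x)) (j * N) x u)"
      using iter[OF u, of j x] je osc_bound_mono by blast
    from cocycle_transfer_osc[OF this, of "n - j * N" "(f ^^ (j * N)) x"] n
    show "osc_bound e (cocycle f (\<lambda>x. transfer (p x)) n x u)"
      by (simp add: cocycle_add[symmetric])
  qed
qed

end

section \<open>Birkhoff's theorem for bounded functions\<close>

definition birkhoff_sum :: "('m \<Rightarrow> 'm) \<Rightarrow> ('m \<Rightarrow> real) \<Rightarrow> nat \<Rightarrow> 'm \<Rightarrow> real" where
  "birkhoff_sum f g n x = (\<Sum>i<n. g ((f ^^ i) x))"

lemma birkhoff_sum_Suc: "birkhoff_sum f g (Suc n) x = g x + birkhoff_sum f g n (f x)"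
  unfolding birkhoff_sum_def by (subst sum.lessThan_Suc_shift) (simp add: funpow_swap1)

text \<open>
  \<open>max_sum f g n\<close> is the maximum of the Birkhoff sums of lengths \<open>1, \<dots>, n + 1\<close>. The recursion
  says that the maximum along the orbit of \<open>x\<close> is determined by that along the orbit of \<open>f x\<close>.
\<close>

primrec max_sum :: "('m \<Rightarrow> 'm) \<Rightarrow> ('m \<Rightarrow> real) \<Rightarrow> nat \<Rightarrow> 'm \<Rightarrow> real" where
  "max_sum f g 0 x = g x"
| "max_sum f g (Suc n) x = g x + max 0 (max_sum f g n (f x))"

lemma max_sum_ge: "k \<le> n \<Longrightarrow> birkhoff_sum f g (Suc k) x \<le> max_sum f g n x"
proof (induction n arbitrary: k x)
  case 0 thus ?case by (simp add: birkhoff_sum_def)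
next
  case (Suc n)
  show ?case
  proof (cases k)
    case 0 thus ?thesis by (simp add: birkhoff_sum_def)
  next
    case (Suc j)
    have "birkhoff_sum f g (Suc j) (f x) \<le> max_sum f g n (f x)"
      using Suc.IH[of j "f x"] Suc.prems Suc by simp
    thus ?thesis unfolding Suc birkhoff_sum_Suc[of f g "Suc j"] by simp
  qed
qed

lemma max_sum_mono: "max_sum f g n x \<le> max_sum f g (Suc n) x"
  by (induction n arbitrary: x) (auto simp: max.coboundedI2)

lemma incseq_max_sum: "incseq (\<lambda>n. max_sum f g n x)"
  by (rule incseq_SucI) (rule max_sum_mono)

text \<open>
  Let \<open>E\<close> be the invariant set on which the Birkhoff sums are unbounded above and \<open>M n\<close> their
  running maxima. On \<open>E\<close> the differences \<open>M (n + 1) - M n \<circ> f = g + max 0 (- M n \<circ> f)\<close> converge to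
  \<open>g\<close> boundedly, and their integrals over \<open>E\<close> are nonnegative because \<open>M\<close> increases and
  \<open>E\<close> and \<open>\<mu>\<close> are invariant. Hence \<open>g\<close> has nonnegative integral over \<open>E\<close>, and by ergodicity
  \<open>E\<close> cannot have full measure if \<open>g\<close> has negative mean.
\<close>

lemma birkhoff_sum_bounded_above:
  fixes g :: "'m::topological_space \<Rightarrow> real"
  assumes erg: "ergodic_for f \<mu>" and g: "g \<in> borel_measurable \<mu>" and B: "\<And>x. \<bar>g x\<bar> \<le> B"
    and neg: "(\<integral>x. g x \<partial>\<mu>) < 0"
  shows "AE x in \<mu>. \<exists>K. \<forall>n. birkhoff_sum f g n x \<le> K"
proof -
  interpret prob_space \<mu> using erg by (simp add: ergodic_for_def)
  have f[measurable]: "f \<in> measurable \<mu> \<mu>" and inv: "distr \<mu> \<mu> f = \<mu>"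
    using erg by (auto simp: ergodic_for_def)
  note g[measurable]
  have meas[measurable]: "max_sum f g n \<in> borel_measurable \<mu>" for n
  proof (induction n)
    case (Suc n)
    note Suc[measurable]
    show ?case by simp
  qed simp
  have sp: "space \<mu> = UNIV"
    using erg sets_eq_imp_space_eq[of \<mu> borel] by (simp add: ergodic_for_def)
  define E where "E = {x. \<forall>K::nat. \<exists>n. real K < max_sum f g n x}"
  have "{x\<in>space \<mu>. \<forall>K::nat. \<exists>n. real K < max_sum f g n x} \<in> sets \<mu>" by measurable
  hence E[measurable]: "E \<in> sets \<mu>" by (simp add: E_def sp)
  have unb: "x \<in> E \<longleftrightarrow> (\<forall>K. \<exists>n. K < max_sum f g n x)" for x
    unfolding E_def mem_Collect_eq by (meson less_trans reals_Archimedean2)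
  have Einv: "f -` E = E"
  proof (intro set_eqI iffI)
    fix x assume "x \<in> f -` E"
    hence fx: "\<And>K. \<exists>n. K < max_sum f g n (f x)" using unb by auto
    show "x \<in> E" unfolding unb
    proof
      fix K
      obtain n where "K - g x < max_sum f g n (f x)" using fx by blast
      hence "K < max_sum f g (Suc n) x" by auto
      thus "\<exists>n. K < max_sum f g n x" ..
    qed
  next
    fix x assume "x \<in> E"
    hence x: "\<And>K. \<exists>n. K < max_sum f g n x" using unb by blast
    show "x \<in> f -` E" unfolding vimage_eq unb
    proof
      fix K
      obtain n where n: "max (g x + K) (max (g x) 0 + g x) < max_sum f g n x" using x by blast
      show "\<exists>n. K < max_sum f g n (f x)"
      proof (cases n)
        case 0 thus ?thesis using n by auto
      next
        case (Suc k) thus ?thesis using n by (intro exI[of _ k]) (auto simp: max_def split: if_splits)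
      qed
    qed
  qed
  have bound: "\<bar>max_sum f g n x\<bar> \<le> real (Suc n) * B" for n x
  proof (induction n arbitrary: x)
    case (Suc n)
    have "\<bar>max 0 (max_sum f g n (f x))\<bar> \<le> real (Suc n) * B"
      using Suc[of "f x"] by (auto simp: max_def)
    moreover have "real (Suc (Suc n)) * B = real (Suc n) * B + B" by (simp add: algebra_simps)
    moreover have "max_sum f g (Suc n) x = g x + max 0 (max_sum f g n (f x))" by simp
    ultimately show ?case using B[of x] unfolding abs_le_iff by linarith
  qed (use B in simp)
  have low: "- B \<le> max_sum f g n x" for n x
    using B[of x] max_sum_ge[of 0 n f g x] by (simp add: birkhoff_sum_def abs_le_iff)
  have int: "integrable \<mu> (\<lambda>x. indicator E x * max_sum f g n x)" for n
    by (rule integrable_const_bound[of _ "real (Suc n) * B"])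
      (use bound order_trans[OF abs_ge_zero bound] in \<open>auto simp: indicator_def abs_mult\<close>)
  have intf: "integrable \<mu> (\<lambda>x. indicator E x * max_sum f g n (f x))" for n
    by (rule integrable_const_bound[of _ "real (Suc n) * B"])
      (use bound order_trans[OF abs_ge_zero bound] in \<open>auto simp: indicator_def abs_mult\<close>)
  have shift: "(\<integral>x. indicator E x * max_sum f g n (f x) \<partial>\<mu>) = (\<integral>x. indicator E x * max_sum f g n x \<partial>\<mu>)" for n
  proof -
    have "(\<integral>x. indicator E x * max_sum f g n x \<partial>\<mu>) = (\<integral>x. indicator E x * max_sum f g n x \<partial>distr \<mu> \<mu> f)"
      by (simp add: inv)
    also have "\<dots> = (\<integral>x. indicator E (f x) * max_sum f g n (f x) \<partial>\<mu>)"
      by (rule integral_distr) measurable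
    also have "\<dots> = (\<integral>x. indicator E x * max_sum f g n (f x) \<partial>\<mu>)"
    proof -
      have "indicator E (f x) = (indicator E x :: real)" for x
        using Einv unfolding indicator_def by auto
      thus ?thesis by simp
    qed
    finally show ?thesis ..
  qed
  define D where "D n x = indicator E x * (g x + max 0 (- max_sum f g n (f x)))" for n x
  have D_eq: "D n x = indicator E x * max_sum f g (Suc n) x - indicator E x * max_sum f g n (f x)" for n x
    by (auto simp: D_def indicator_def max_def)
  have D_pos: "0 \<le> (\<integral>x. D n x \<partial>\<mu>)" for n
  proof -
    have "(\<integral>x. D n x \<partial>\<mu>) = (\<integral>x. indicator E x * max_sum f g (Suc n) x \<partial>\<mu>) - (\<integral>x. indicator E x * max_sum f g n x \<partial>\<mu>)"
      unfolding D_eq by (subst Bochner_Integration.integral_diff[OF int intf]) (simp only: shift)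
    moreover have "(\<integral>x. indicator E x * max_sum f g n x \<partial>\<mu>) \<le> (\<integral>x. indicator E x * max_sum f g (Suc n) x \<partial>\<mu>)"
      by (intro integral_mono int mult_left_mono max_sum_mono) auto
    ultimately show ?thesis by simp
  qed
  have "(\<lambda>n. \<integral>x. D n x \<partial>\<mu>) \<longlonglongrightarrow> (\<integral>x. indicator E x * g x \<partial>\<mu>)"
  proof (rule integral_dominated_convergence[where w = "\<lambda>_. 2 * B"])
    show "AE x in \<mu>. (\<lambda>n. D n x) \<longlonglongrightarrow> indicator E x * g x"
    proof (rule AE_I2, rule tendsto_eventually)
      fix x
      show "eventually (\<lambda>n. D n x = indicator E x * g x) sequentially"
      proof (cases "x \<in> E")
        case True
        hence "f x \<in> E" using Einv by auto
        then obtain n0 where "0 < max_sum f g n0 (f x)" using unb by blast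
        moreover have "max_sum f g n0 (f x) \<le> max_sum f g n (f x)" if "n0 \<le> n" for n
          using incseq_max_sum that by (rule incseqD)
        ultimately have "0 < max_sum f g n (f x)" if "n0 \<le> n" for n
          using that by (meson less_le_trans)
        thus ?thesis unfolding eventually_sequentially D_def by (intro exI[of _ n0]) (force simp: max_def)
      qed (simp add: D_def)
    qed
    show "AE x in \<mu>. norm (D n x) \<le> 2 * B" for n
    proof (rule AE_I2)
      fix x show "norm (D n x) \<le> 2 * B"
        using B[of x] low[of n "f x"] by (auto simp: D_def indicator_def max_def)
    qed
  qed (auto simp: D_def)
  hence Eg: "0 \<le> (\<integral>x. indicator E x * g x \<partial>\<mu>)"
    by (rule LIMSEQ_le_const) (use D_pos in blast)
  have "measure \<mu> E = 0 \<or> measure \<mu> E = 1"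
    using erg Einv E by (simp add: ergodic_for_def)
  moreover have "measure \<mu> E \<noteq> 1"
  proof
    assume "measure \<mu> E = 1"
    hence "AE x in \<mu>. x \<in> E" using E prob_eq_1 by blast
    hence "(\<integral>x. indicator E x * g x \<partial>\<mu>) = (\<integral>x. g x \<partial>\<mu>)"
      by (intro integral_cong_AE) (auto elim!: eventually_mono)
    thus False using Eg neg by simp
  qed
  ultimately have "AE x in \<mu>. x \<notin> E"
    using prob_eq_0[OF E] by blast
  thus ?thesis
  proof (eventually_elim)
    fix x assume "x \<notin> E"
    then obtain K where K: "\<And>n. max_sum f g n x \<le> K" using unb by (meson not_less)
    have "birkhoff_sum f g n x \<le> max K 0" for n
    proof (cases n)
      case 0 thus ?thesis by (simp add: birkhoff_sum_def)
    next
      case (Suc k)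
      show ?thesis using max_sum_ge[of k k f g x] K[of k] unfolding Suc by simp
    qed
    thus "\<exists>K. \<forall>n. birkhoff_sum f g n x \<le> K" by blast
  qed
qed

text \<open>
  Applied to \<open>\<plusminus> (g - \<integral> g d\<mu>) - e\<close>, whose mean is \<open>- e\<close>, the preceding lemma bounds the deviation of
  the Birkhoff sums from \<open>n * \<integral> g d\<mu>\<close> by \<open>n * e\<close> plus a constant. Countably many \<open>e\<close> suffice.
\<close>

theorem birkhoff_ergodic:
  fixes g :: "'m::topological_space \<Rightarrow> real"
  assumes erg: "ergodic_for f \<mu>" and g: "g \<in> borel_measurable \<mu>" and B: "\<And>x. \<bar>g x\<bar> \<le> B"
  shows "AE x in \<mu>. (\<lambda>n. birkhoff_sum f g n x / n) \<longlonglongrightarrow> (\<integral>x. g x \<partial>\<mu>)"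
proof -
  interpret prob_space \<mu> using erg by (simp add: ergodic_for_def)
  define I where "I = (\<integral>x. g x \<partial>\<mu>)"
  have int: "integrable \<mu> g"
    by (rule integrable_const_bound[of _ B]) (use B g in auto)
  have one: "AE x in \<mu>. \<exists>K. \<forall>n. s * (birkhoff_sum f g n x - n * I) - n * e \<le> K"
    if "0 < e" "\<bar>s\<bar> = 1" for s e :: real
  proof -
    let ?g = "\<lambda>x. s * (g x - I) - e"
    have "\<bar>?g x\<bar> \<le> B + \<bar>I\<bar> + e" for x
    proof -
      have "\<bar>?g x\<bar> \<le> \<bar>s * (g x - I)\<bar> + \<bar>e\<bar>" by (rule abs_triangle_ineq4)
      also have "\<dots> = \<bar>g x - I\<bar> + e" using that by (simp add: abs_mult)
      also have "\<dots> \<le> B + \<bar>I\<bar> + e" using B[of x] abs_triangle_ineq4[of "g x" I] by simp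
      finally show ?thesis .
    qed
    moreover have "(\<integral>x. ?g x \<partial>\<mu>) = - e"
      using int by (simp add: I_def prob_space)
    ultimately have "AE x in \<mu>. \<exists>K. \<forall>n. birkhoff_sum f ?g n x \<le> K"
      using that g by (intro birkhoff_sum_bounded_above[OF erg]) auto
    moreover have "birkhoff_sum f ?g n x = s * (birkhoff_sum f g n x - n * I) - n * e" for n x
      by (simp add: birkhoff_sum_def sum_subtractf algebra_simps sum_distrib_left)
    ultimately show ?thesis by simp
  qed
  have "AE x in \<mu>. \<forall>j. \<exists>K. \<forall>n. 1 * (birkhoff_sum f g n x - n * I) - n * inverse (real (Suc j)) \<le> K"
    unfolding AE_all_countable by (intro allI one) auto
  moreover have "AE x in \<mu>. \<forall>j. \<exists>K. \<forall>n. -1 * (birkhoff_sum f g n x - n * I) - n * inverse (real (Suc j)) \<le> K"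
    unfolding AE_all_countable by (intro allI one) auto
  ultimately show ?thesis
  proof eventually_elim
    fix x
    assume up: "\<forall>j. \<exists>K. \<forall>n. 1 * (birkhoff_sum f g n x - n * I) - n * inverse (real (Suc j)) \<le> K"
      and lo: "\<forall>j. \<exists>K. \<forall>n. -1 * (birkhoff_sum f g n x - n * I) - n * inverse (real (Suc j)) \<le> K"
    have "(\<lambda>n. birkhoff_sum f g n x / n) \<longlonglongrightarrow> I"
    proof (rule LIMSEQ_I)
      fix e :: real assume e: "0 < e"
      obtain j where j: "inverse (real (Suc j)) < e / 2"
        using reals_Archimedean[of "e / 2"] e by auto
      obtain K1 where K1: "\<And>n. birkhoff_sum f g n x - n * I - n * inverse (real (Suc j)) \<le> K1"
        using up by (metis mult_1)
      obtain K2 where K2: "\<And>n. - (birkhoff_sum f g n x - n * I) - n * inverse (real (Suc j)) \<le> K2"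
        using lo by (metis mult_minus1)
      obtain n0 where n0: "2 * (\<bar>K1\<bar> + \<bar>K2\<bar>) / e < real n0" using reals_Archimedean2 by blast
      show "\<exists>no. \<forall>n\<ge>no. norm (birkhoff_sum f g n x / n - I) < e"
      proof (intro exI[of _ "Suc n0"] allI impI)
        fix n assume n: "Suc n0 \<le> n"
        have "real n0 \<le> real n" using n by simp
        hence "2 * (\<bar>K1\<bar> + \<bar>K2\<bar>) / e < real n" using n0 by linarith
        hence nK: "\<bar>K1\<bar> + \<bar>K2\<bar> < n * (e / 2)" using e by (simp add: field_simps)
        have "n * inverse (real (Suc j)) \<le> n * (e / 2)" using j by (intro mult_left_mono) auto
        hence "\<bar>birkhoff_sum f g n x - n * I\<bar> < n * e"
          using K1[of n] K2[of n] nK unfolding abs_less_iff by linarith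
        moreover have "birkhoff_sum f g n x / n - I = (birkhoff_sum f g n x - n * I) / n"
          using n by (simp add: field_simps)
        ultimately show "norm (birkhoff_sum f g n x / n - I) < e"
          using n by (simp add: divide_simps mult.commute)
      qed
    qed
    thus "(\<lambda>n. birkhoff_sum f g n x / n) \<longlonglongrightarrow> (\<integral>x. g x \<partial>\<mu>)" by (simp add: I_def)
  qed
qed

section \<open>Joint continuity over the base and the shift\<close>

lemma compact_shift: "compact (UNIV :: (nat \<Rightarrow> 'l::{finite,discrete_topology}) set)"
proof -
  have "compact_space (product_topology (\<lambda>_::nat. euclidean :: 'l topology) UNIV)"
    unfolding compact_space_product_topology
    by (simp add: compact_space_def finite_imp_compact)
  thus ?thesis by (simp add: euclidean_product_topology compact_space_def)
qed

lemma continuous_case_nat: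
  "continuous_on UNIV (\<lambda>w. case_nat a w :: nat \<Rightarrow> 'l::topological_space)"
proof (rule continuous_on_coordinatewise_then_product)
  fix i show "continuous_on UNIV (\<lambda>w. case_nat a w i :: 'l)"
    by (cases i) (auto intro: continuous_on_product_coordinates)
qed

lemma continuous_left_shift: "continuous_on UNIV (left_shift :: (nat \<Rightarrow> 'l::topological_space) \<Rightarrow> _)"
  unfolding left_shift_def
  by (rule continuous_on_coordinatewise_then_product) (rule continuous_on_product_coordinates)

lemma left_shift_case_nat [simp]: "left_shift (case_nat a w) = w"
  by (simp add: left_shift_def)

lemma continuous_funpow:
  assumes "continuous_on UNIV (s :: 'a::topological_space \<Rightarrow> 'a)"
  shows "continuous_on UNIV (s ^^ n)"
proof (induction n)
  case (Suc n)
  thus ?case using continuous_on_compose2[OF assms Suc] by (simp add: o_def)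
qed (simp add: id_def)

text \<open>
  As the shift space is compact, joint continuity of \<open>F\<close> amounts to continuity of \<open>x \<mapsto> F x\<close> in
  the supremum norm (\<open>jointly_continuous_uniform_nhds\<close>), but it is inherited by sums, quotients
  and compositions without any estimate.
\<close>

definition jointly_continuous ::
    "('m::topological_space \<Rightarrow> (nat \<Rightarrow> 'l::topological_space) \<Rightarrow> real) \<Rightarrow> bool" where
  "jointly_continuous F \<longleftrightarrow> continuous_on UNIV (\<lambda>z. F (fst z) (snd z))"

lemma jointly_continuous_compose:
  assumes F: "jointly_continuous F" and s: "continuous_on UNIV s" and t: "continuous_on UNIV t"
  shows "jointly_continuous (\<lambda>x w. F (s x) (t w))"
proof -
  have "continuous_on UNIV (\<lambda>z. (s (fst z), t (snd z)))"
    by (intro continuous_on_Pair continuous_on_compose2[OF s] continuous_on_compose2[OF t]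
        continuous_on_fst continuous_on_snd continuous_on_id) auto
  from continuous_on_compose2[OF F[unfolded jointly_continuous_def] this]
  show ?thesis by (simp add: jointly_continuous_def)
qed

lemma jointly_continuous_base:
  assumes "jointly_continuous F" "continuous_on UNIV s"
  shows "jointly_continuous (\<lambda>x. F (s x))"
  using jointly_continuous_compose[OF assms continuous_on_id] by simp

lemma jointly_continuous_fibre:
  assumes "jointly_continuous F" "continuous_on UNIV t"
  shows "jointly_continuous (\<lambda>x w. F x (t w))"
  using jointly_continuous_compose[OF assms(1) continuous_on_id assms(2)] by simp

lemma jointly_continuous_const_fibre:
  assumes "continuous_on UNIV g"
  shows "jointly_continuous (\<lambda>x w. g x)"
  unfolding jointly_continuous_def
  by (rule continuous_on_compose2[OF assms continuous_on_fst[OF continuous_on_id]]) auto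

lemma jointly_continuous_const_base:
  assumes "continuous_on UNIV g"
  shows "jointly_continuous (\<lambda>x w. g w)"
  unfolding jointly_continuous_def
  by (rule continuous_on_compose2[OF assms continuous_on_snd[OF continuous_on_id]]) auto

lemma jointly_continuous_mult:
  "jointly_continuous F \<Longrightarrow> jointly_continuous G \<Longrightarrow> jointly_continuous (\<lambda>x w. F x w * G x w)"
  unfolding jointly_continuous_def by (intro continuous_intros)

lemma jointly_continuous_diff:
  "jointly_continuous F \<Longrightarrow> jointly_continuous G \<Longrightarrow> jointly_continuous (\<lambda>x w. F x w - G x w)"
  unfolding jointly_continuous_def by (intro continuous_intros)

lemma jointly_continuous_divide:
  "jointly_continuous F \<Longrightarrow> jointly_continuous G \<Longrightarrow> (\<And>x w. G x w \<noteq> 0) \<Longrightarrow>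
     jointly_continuous (\<lambda>x w. F x w / G x w)"
  unfolding jointly_continuous_def by (intro continuous_intros) auto

lemma jointly_continuous_exp:
  "jointly_continuous F \<Longrightarrow> jointly_continuous (\<lambda>x w. exp (F x w))"
  unfolding jointly_continuous_def by (intro continuous_intros)

lemma jointly_continuous_sum:
  "(\<And>i. i \<in> I \<Longrightarrow> jointly_continuous (F i)) \<Longrightarrow> jointly_continuous (\<lambda>x w. \<Sum>i\<in>I. F i x w)"
  unfolding jointly_continuous_def by (intro continuous_intros)

lemma jointly_continuous_at_point:
  assumes "jointly_continuous F"
  shows "continuous_on UNIV (\<lambda>x. F x w)"
proof -
  have "continuous_on UNIV (\<lambda>x. (x, w))" by (intro continuous_intros)
  from continuous_on_compose2[OF assms[unfolded jointly_continuous_def] this]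
  show ?thesis by simp
qed

lemma jointly_continuous_transfer:
  assumes "jointly_continuous p" "jointly_continuous u"
  shows "jointly_continuous (\<lambda>x. transfer (p x) (u x))"
  unfolding transfer_def
  by (intro jointly_continuous_sum jointly_continuous_mult jointly_continuous_fibre[OF _ continuous_case_nat] assms)

lemma jointly_continuous_cocycle_transfer:
  assumes p: "jointly_continuous p" and u: "jointly_continuous u" and f: "continuous_on UNIV f"
  shows "jointly_continuous (\<lambda>x. cocycle f (\<lambda>x. transfer (p x)) n x (u x))"
proof (induction n)
  case (Suc n)
  show ?case
    using jointly_continuous_transfer[OF jointly_continuous_base[OF p continuous_funpow[OF f]] Suc]
    by simp
qed (use u in simp)

lemma jointly_continuous_uniform_limit:
  fixes F :: "'m::topological_space \<Rightarrow> (nat \<Rightarrow> 'l::topological_space) \<Rightarrow> real"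
    and G :: "nat \<Rightarrow> 'm \<Rightarrow> (nat \<Rightarrow> 'l) \<Rightarrow> real"
  assumes G: "\<And>n. jointly_continuous (G n)"
    and lim: "\<And>e. 0 < e \<Longrightarrow> \<exists>N. \<forall>n\<ge>N. \<forall>x w. \<bar>G n x w - F x w\<bar> < e"
  shows "jointly_continuous F"
  unfolding jointly_continuous_def
proof (rule uniform_limit_theorem)
  show "eventually (\<lambda>n. continuous_on UNIV (\<lambda>z. G n (fst z) (snd z))) sequentially"
    using G by (simp add: jointly_continuous_def)
  show "uniform_limit UNIV (\<lambda>n z. G n (fst z) (snd z)) (\<lambda>z. F (fst z) (snd z)) sequentially"
    unfolding uniform_limit_iff eventually_sequentially
    using lim by (auto simp: dist_real_def)
qed simp

lemma jointly_continuous_uniform_nhds: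
  fixes F :: "'m::topological_space \<Rightarrow> (nat \<Rightarrow> 'l::{finite,discrete_topology}) \<Rightarrow> real"
  assumes "jointly_continuous F" "0 < e"
  shows "eventually (\<lambda>x. \<forall>w. \<bar>F x w - F x0 w\<bar> \<le> e) (nhds x0)"
proof -
  have "continuous_on (UNIV \<times> UNIV) (\<lambda>z. F (fst z) (snd z))"
    using assms(1) by (simp add: jointly_continuous_def)
  from continuous_on_prod_compactE[OF this compact_shift UNIV_I assms(2)]
  obtain X0 where X: "x0 \<in> X0" "open X0" "\<forall>x\<in>X0 \<inter> UNIV. \<forall>t\<in>UNIV.
      dist (F (fst (x, t)) (snd (x, t))) (F (fst (x0, t)) (snd (x0, t))) \<le> e" by metis
  thus ?thesis
    unfolding eventually_nhds by (intro exI[of _ X0]) (auto simp: dist_real_def)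
qed

lemma jointly_continuous_bounded:
  fixes F :: "'m::topological_space \<Rightarrow> (nat \<Rightarrow> 'l::{finite,discrete_topology}) \<Rightarrow> real"
  assumes "jointly_continuous F" "compact (UNIV :: 'm set)"
  obtains B where "0 < B" "\<And>x w. \<bar>F x w\<bar> \<le> B"
proof -
  have "compact (UNIV \<times> UNIV :: ('m \<times> (nat \<Rightarrow> 'l)) set)"
    by (rule compact_Times[OF assms(2) compact_shift])
  hence "compact ((\<lambda>z. F (fst z) (snd z)) ` UNIV)"
    using assms(1) by (intro compact_continuous_image) (auto simp: jointly_continuous_def)
  from bounded_pos[THEN iffD1, OF compact_imp_bounded[OF this]]
  obtain B where "0 < B" "\<forall>y\<in>range (\<lambda>z. F (fst z) (snd z)). norm y \<le> B" by blast
  thus ?thesis using that[of B] by fastforce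
qed

lemma continuous_on_bcontfun:
  fixes G :: "'m::topological_space \<Rightarrow> (nat \<Rightarrow> 'l::{finite,discrete_topology}) \<Rightarrow>\<^sub>C real"
  assumes "jointly_continuous (\<lambda>x. apply_bcontfun (G x))"
  shows "continuous_on UNIV G"
  unfolding continuous_on_def
proof (intro ballI tendstoI)
  fix x0 :: 'm and e :: real assume e: "0 < e"
  have "eventually (\<lambda>x. dist (G x) (G x0) < e) (nhds x0)"
    using jointly_continuous_uniform_nhds[OF assms, of "e/2" x0] e
  proof (simp, elim eventually_mono)
    fix x assume "\<forall>w. \<bar>G x w - G x0 w\<bar> * 2 \<le> e"
    hence "dist (G x) (G x0) \<le> e / 2" by (intro dist_bound) (auto simp: dist_real_def)
    thus "dist (G x) (G x0) < e" using e by simp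
  qed
  thus "eventually (\<lambda>x. dist (G x) (G x0) < e) (at x0 within UNIV)"
    by (auto simp: eventually_at_filter elim: eventually_mono)
qed

lemma apply_Bcontfun_holder:
  fixes g :: "(nat \<Rightarrow> 'l::{finite,discrete_topology}) \<Rightarrow> real"
  assumes "0 < r" "r < 1" "holder_bound r C g"
  shows "apply_bcontfun (Bcontfun g) = g" "Bcontfun g \<in> holder_space r"
proof -
  have "is_holder r g" using assms is_holder_iff by blast
  thus 1: "apply_bcontfun (Bcontfun g) = g"
    using is_holder_bcontfun[OF assms(1,2)] Bcontfun_inverse by blast
  thus "Bcontfun g \<in> holder_space r"
    using \<open>is_holder r g\<close> by (simp add: holder_space_def)
qed

section \<open>The normalised Ruelle operators\<close>

definition cocycle_prod :: "('m \<Rightarrow> 'm) \<Rightarrow> ('m \<Rightarrow> real) \<Rightarrow> nat \<Rightarrow> 'm \<Rightarrow> real" where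
  "cocycle_prod f \<rho> n x = (\<Prod>i<n. \<rho> ((f ^^ i) x))"

lemma cocycle_prod_Suc: "cocycle_prod f \<rho> (Suc n) x = cocycle_prod f \<rho> n x * \<rho> ((f ^^ n) x)"
  by (simp add: cocycle_prod_def)

lemma ruelle_fun_transfer: "ruelle_fun \<psi> u = transfer (\<lambda>v. exp (\<psi> v)) u"
  by (simp add: fun_eq_iff ruelle_fun_eq transfer_def mult.commute)

locale ruelle_setting =
  fixes f :: "'m::t2_space \<Rightarrow> 'm"
    and r :: real
    and \<phi> :: "'m \<Rightarrow> (nat \<Rightarrow> 'l::{finite,discrete_topology}) \<Rightarrow> real"
    and \<nu> :: "'m \<Rightarrow> (nat \<Rightarrow> 'l) measure"
    and \<rho> :: "'m \<Rightarrow> real"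
    and h :: "'m \<Rightarrow> (nat \<Rightarrow> 'l) \<Rightarrow>\<^sub>C real"
  assumes card: "CARD('l) \<ge> 2"
    and cpt: "compact (UNIV :: 'm set)"
    and homeo: "homeomorphism UNIV UNIV f (inv f)"
    and r: "0 < r" "r < 1"
    and urh: "uniformly_relatively_holder r \<phi>"
    and triple: "ruelle_triple r f \<phi> \<nu> \<rho> h"
begin

lemma f_cont: "continuous_on UNIV f" and finv_cont: "continuous_on UNIV (inv f)"
  and finv: "inv f (f x) = x" "f (inv f x) = x"
  using homeo by (auto simp: homeomorphism_def)

lemma iter_cont: "continuous_on UNIV (f ^^ n)" "continuous_on UNIV (inv f ^^ n)"
  by (intro continuous_funpow f_cont finv_cont)+

lemma f_finv_iter: "(f ^^ n) ((inv f ^^ n) x) = x"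
  by (induction n arbitrary: x) (simp_all add: funpow_swap1 finv)

lemma \<phi>_joint: "jointly_continuous \<phi>"
proof -
  have c: "continuous_on UNIV (\<lambda>(w, x). \<phi> x w)" using urh by (simp add: uniformly_relatively_holder_def)
  have "continuous_on UNIV (\<lambda>z::'m \<times> (nat \<Rightarrow> 'l). (snd z, fst z))" by (intro continuous_intros)
  from continuous_on_compose2[OF c this] show ?thesis by (simp add: jointly_continuous_def)
qed

lemma \<phi>_is_holder: "is_holder r (\<phi> x)"
  using urh by (simp add: uniformly_relatively_holder_def)

lemma \<phi>_bounds: obtains B C where "0 < B" "\<And>x w. \<bar>\<phi> x w\<bar> \<le> B" "\<And>x. holder_bound r C (\<phi> x)"
proof -
  obtain B where B: "0 < B" "\<And>x w. \<bar>\<phi> x w\<bar> \<le> B"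
    using jointly_continuous_bounded[OF \<phi>_joint cpt] by blast
  have "compact ((\<lambda>x. holder_const r (\<phi> x)) ` UNIV)"
    using urh cpt by (intro compact_continuous_image) (auto simp: uniformly_relatively_holder_def)
  then obtain C where C: "\<And>x. holder_const r (\<phi> x) \<le> C"
    using compact_imp_bounded[of "range (\<lambda>x. holder_const r (\<phi> x))"]
    by (auto simp: bounded_iff abs_le_iff)
  have "holder_bound r C (\<phi> x)" for x
    by (rule holder_bound_mono[OF holder_bound_holder_const[OF r card \<phi>_is_holder] C r(1)])
  with B show ?thesis using that by blast
qed

lemma \<rho>_pos: "0 < \<rho> x"
  and h_pos: "0 < h x w"
  and h_holder: "h x \<in> holder_space r"
  and \<nu>_prob: "prob_space (\<nu> x)"
  and \<nu>_sets: "sets (\<nu> x) = sets borel"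
  and dual: "(\<integral>w. ruelle (\<phi> x) g w \<partial>\<nu> (f x)) = \<rho> x * (\<integral>w. apply_bcontfun g w \<partial>\<nu> x)"
  and eigen: "ruelle (\<phi> x) (h x) = \<rho> x *\<^sub>R h (f x)"
  and h_int: "(\<integral>w. h x w \<partial>\<nu> x) = 1"
  using triple unfolding ruelle_triple_def by blast+

lemma h_bound: obtains C where "\<And>x. holder_bound r C (h x)"
proof -
  obtain C where C: "\<And>x. holder_const r (h x) \<le> C"
    using triple unfolding ruelle_triple_def by blast
  have "holder_bound r C (h x)" for x
    using holder_bound_mono[OF holder_bound_holder_const[OF r card] C r(1)] h_holder
    by (auto simp: holder_space_def)
  thus ?thesis using that by blast
qed

lemma ruelle_apply: "apply_bcontfun (ruelle (\<phi> x) g) = ruelle_fun (\<phi> x) (apply_bcontfun g)"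
  by (rule apply_ruelle[OF r \<phi>_is_holder])

lemma eigen_fun: "ruelle_fun (\<phi> x) (h x) w = \<rho> x * h (f x) w"
  by (metis ruelle_apply eigen scaleR_bcontfun.rep_eq real_scaleR_def)

lemma \<nu>_integrable:
  fixes g :: "(nat \<Rightarrow> 'l) \<Rightarrow>\<^sub>C real"
  shows "integrable (\<nu> x) (apply_bcontfun g)"
proof -
  interpret prob_space "\<nu> x" by (rule \<nu>_prob)
  have "apply_bcontfun g \<in> borel_measurable (\<nu> x)"
    using borel_measurable_continuous_onI[OF continuous_on_apply_bcontfun[of UNIV g]]
    by (simp cong: measurable_cong_sets add: \<nu>_sets)
  from integrable_const_bound[OF AE_I2 this, of "norm g"] norm_bounded[of g]
  show ?thesis by blast
qed

lemma \<nu>_integral_bounds: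
  fixes g :: "(nat \<Rightarrow> 'l) \<Rightarrow>\<^sub>C real"
  assumes "\<And>w. a \<le> apply_bcontfun g w" "\<And>w. apply_bcontfun g w \<le> b"
  shows "a \<le> (\<integral>w. apply_bcontfun g w \<partial>\<nu> x)" "(\<integral>w. apply_bcontfun g w \<partial>\<nu> x) \<le> b"
proof -
  interpret prob_space "\<nu> x" by (rule \<nu>_prob)
  show "a \<le> (\<integral>w. apply_bcontfun g w \<partial>\<nu> x)"
    by (intro integral_ge_const \<nu>_integrable AE_I2 assms)
  show "(\<integral>w. apply_bcontfun g w \<partial>\<nu> x) \<le> b"
    by (intro integral_le_const \<nu>_integrable AE_I2 assms)
qed

lemma \<rho>_bounds:
  assumes B: "\<And>x w. \<bar>\<phi> x w\<bar> \<le> B"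
  shows "real CARD('l) * exp (- B) \<le> \<rho> x" "\<rho> x \<le> real CARD('l) * exp B"
proof -
  interpret prob_space "\<nu> x" by (rule \<nu>_prob)
  have \<rho>: "\<rho> x = (\<integral>w. ruelle (\<phi> x) (const_bcontfun 1) w \<partial>\<nu> (f x))"
    unfolding dual by (simp add: const_bcontfun.rep_eq prob_space)
  have app: "ruelle (\<phi> x) (const_bcontfun 1) w = (\<Sum>a\<in>UNIV. exp (\<phi> x (case_nat a w)))" for w
    by (simp add: ruelle_apply ruelle_fun_eq const_bcontfun.rep_eq)
  have bnd: "exp (- B) \<le> exp (\<phi> x v)" "exp (\<phi> x v) \<le> exp B" for v
    using B[of x v] by (auto simp: abs_le_iff)
  show "real CARD('l) * exp (- B) \<le> \<rho> x"
    unfolding \<rho>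
  proof (rule \<nu>_integral_bounds(1))
    fix w show "real CARD('l) * exp (- B) \<le> ruelle (\<phi> x) (const_bcontfun 1) w"
      unfolding app using sum_mono[of UNIV "\<lambda>_. exp (- B)" "\<lambda>a. exp (\<phi> x (case_nat a w))", OF bnd(1)] by simp
    show "ruelle (\<phi> x) (const_bcontfun 1) w \<le> real CARD('l) * exp B"
      unfolding app using sum_mono[of UNIV "\<lambda>a. exp (\<phi> x (case_nat a w))" "\<lambda>_. exp B", OF bnd(2)] by simp
  qed
  show "\<rho> x \<le> real CARD('l) * exp B"
    unfolding \<rho>
  proof (rule \<nu>_integral_bounds(2))
    fix w show "real CARD('l) * exp (- B) \<le> ruelle (\<phi> x) (const_bcontfun 1) w"
      unfolding app using sum_mono[of UNIV "\<lambda>_. exp (- B)" "\<lambda>a. exp (\<phi> x (case_nat a w))", OF bnd(1)] by simp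
    show "ruelle (\<phi> x) (const_bcontfun 1) w \<le> real CARD('l) * exp B"
      unfolding app using sum_mono[of UNIV "\<lambda>a. exp (\<phi> x (case_nat a w))" "\<lambda>_. exp B", OF bnd(2)] by simp
  qed
qed

text \<open>
  Of the \<open>CARD('l) ^ n\<close> summands of the iterated operator, the one that prepends the given word
  \<open>z 0 \<dots> z (n - 1)\<close> is kept.
\<close>

lemma ruelle_iter_ge:
  assumes B: "\<And>x w. \<bar>\<phi> x w\<bar> \<le> B" and u: "\<And>v. 0 \<le> u v"
  shows "\<exists>v. (\<forall>i<n. v i = z i) \<and>
    exp (- B) ^ n * u v \<le> cocycle f (\<lambda>x. ruelle_fun (\<phi> x)) n x u w"
  using u
proof (induction n arbitrary: x u z)
  case 0 thus ?case by auto
next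
  case (Suc n)
  have one: "exp (- B) * u (case_nat (z 0) y) \<le> ruelle_fun (\<phi> x) u y" for y
  proof -
    have "exp (- B) * u (case_nat (z 0) y) \<le> u (case_nat (z 0) y) * exp (\<phi> x (case_nat (z 0) y))"
    proof -
      have "exp (- B) \<le> exp (\<phi> x (case_nat (z 0) y))"
        using B[of x "case_nat (z 0) y"] by (simp add: abs_le_iff)
      from mult_left_mono[OF this Suc.prems] show ?thesis
        by (subst mult.commute)
    qed
    also have "\<dots> \<le> ruelle_fun (\<phi> x) u y"
      unfolding ruelle_fun_eq using Suc.prems by (intro member_le_sum) auto
    finally show ?thesis .
  qed
  have nonneg: "\<And>y. 0 \<le> ruelle_fun (\<phi> x) u y"
    unfolding ruelle_fun_eq using Suc.prems by (intro sum_nonneg) auto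
  from Suc.IH[where z = "left_shift z" and x = "f x" and u = "ruelle_fun (\<phi> x) u", OF nonneg] obtain y where
    y: "\<forall>i<n. y i = left_shift z i" "exp (- B) ^ n * ruelle_fun (\<phi> x) u y \<le>
      cocycle f (\<lambda>x. ruelle_fun (\<phi> x)) n (f x) (ruelle_fun (\<phi> x) u) w" by (elim exE conjE)
  have "exp (- B) ^ n * (exp (- B) * u (case_nat (z 0) y)) \<le> exp (- B) ^ n * ruelle_fun (\<phi> x) u y"
    by (intro mult_left_mono one) auto
  hence "exp (- B) ^ Suc n * u (case_nat (z 0) y) \<le> cocycle f (\<lambda>x. ruelle_fun (\<phi> x)) (Suc n) x u w"
    using y(2) unfolding cocycle_Suc_front power_Suc2 mult.assoc by (rule order_trans)
  moreover have "\<forall>i<Suc n. case_nat (z 0) y i = z i"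
    using y(1) by (auto simp: left_shift_def split: nat.split)
  ultimately show ?case by (intro exI[of _ "case_nat (z 0) y"] conjI)
qed

lemma cocycle_prod_pos: "0 < cocycle_prod f \<rho> n x"
  unfolding cocycle_prod_def by (intro prod_pos \<rho>_pos)

lemma ruelle_fun_scale: "ruelle_fun \<psi> (\<lambda>v. c * u v) = (\<lambda>w. c * ruelle_fun \<psi> u w)"
  by (simp add: fun_eq_iff ruelle_fun_def sum_distrib_left mult.assoc)

text \<open>
  The weights of the Ruelle operator conjugated by \<open>h\<close>. They are transition probabilities
  (\<open>P_sum\<close>): \<open>P x (a w)\<close> is the probability of prepending \<open>a\<close> to \<open>w\<close>.
\<close>

definition P :: "'m \<Rightarrow> (nat \<Rightarrow> 'l) \<Rightarrow> real" where
  "P x v = h x v * exp (\<phi> x v) / (\<rho> x * h (f x) (left_shift v))"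

abbreviation T :: "'m \<Rightarrow> ((nat \<Rightarrow> 'l) \<Rightarrow> real) \<Rightarrow> (nat \<Rightarrow> 'l) \<Rightarrow> real" where
  "T x \<equiv> transfer (P x)"

lemma ruelle_conjugate:
  "ruelle_fun (\<phi> x) (\<lambda>v. h x v * u v) = (\<lambda>w. \<rho> x * h (f x) w * T x u w)"
proof
  fix w
  have "\<rho> x * h (f x) w \<noteq> 0" using \<rho>_pos[of x] h_pos[of "f x" w] by simp
  thus "ruelle_fun (\<phi> x) (\<lambda>v. h x v * u v) w = \<rho> x * h (f x) w * T x u w"
    unfolding ruelle_fun_eq transfer_def P_def sum_distrib_left
    by (intro sum.cong refl) (simp add: field_simps)
qed

lemma ruelle_conjugate_iter:
  "cocycle f (\<lambda>x. ruelle_fun (\<phi> x)) n x (\<lambda>v. h x v * u v) =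
     (\<lambda>w. cocycle_prod f \<rho> n x * (h ((f ^^ n) x) w * cocycle f T n x u w))"
proof (induction n)
  case (Suc n)
  show ?case
    by (simp add: Suc ruelle_fun_scale ruelle_conjugate cocycle_prod_Suc mult.assoc)
qed (simp add: cocycle_prod_def)

lemma h_iter:
  "cocycle f (\<lambda>x. ruelle_fun (\<phi> x)) n x (h x) = (\<lambda>w. cocycle_prod f \<rho> n x * h ((f ^^ n) x) w)"
proof (induction n)
  case (Suc n)
  show ?case
    by (simp add: Suc ruelle_fun_scale eigen_fun cocycle_prod_Suc mult.assoc fun_eq_iff)
qed (simp add: cocycle_prod_def)

text \<open>
  The upper bound holds since \<open>h x\<close> has mean 1 and uniformly bounded oscillation. For the lower
  bound, \<open>h x \<ge> 1/2\<close> somewhere and hence \<open>h x \<ge> 1/4\<close> on a cylinder whose length \<open>n\<close> does not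
  depend on \<open>x\<close>; the \<open>n\<close>-th iterate of the Ruelle operator carries this to all of the fibre
  over \<open>(f ^^ n) x\<close>, and every point of the base is of that form.
\<close>

lemma h_bounds: obtains \<eta> H where "0 < \<eta>" "0 < H" "\<And>x w. \<eta> \<le> h x w" "\<And>x w. h x w \<le> H"
proof -
  obtain B C0 where B: "0 < B" "\<And>x w. \<bar>\<phi> x w\<bar> \<le> B" by (rule \<phi>_bounds) blast
  obtain C where C: "\<And>x. holder_bound r C (h x)" by (rule h_bound) blast
  have C0: "0 \<le> C" using C holder_bound_nonneg by blast
  have up: "h x w \<le> 1 + C" for x w
  proof -
    have "h x w - C \<le> h x v" for v
      using osc_boundD[OF holder_bound_osc[OF C[of x]], of w v] by linarith
    moreover have "h x v \<le> h x w + C" for v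
      using osc_boundD[OF holder_bound_osc[OF C[of x]], of w v] by linarith
    ultimately have "h x w - C \<le> (\<integral>v. h x v \<partial>\<nu> x)" by (rule \<nu>_integral_bounds(1))
    thus ?thesis by (simp add: h_int)
  qed
  obtain n where n: "r ^ n < 1 / (4 * (C + 1))"
    using real_arch_pow_inv[of "1 / (4 * (C + 1))" r] r C0 by auto
  have Cn: "C * r ^ n \<le> 1 / 4"
  proof -
    have "C * r ^ n \<le> (C + 1) * r ^ n" using r by (intro mult_right_mono) auto
    thus ?thesis using n C0 by (simp add: field_simps)
  qed
  define R where "R = real CARD('l) * exp B"
  have R: "0 < R" by (simp add: R_def)
  define \<eta> where "\<eta> = exp (- B) ^ n * (1 / 4) / R ^ n"
  have low: "\<eta> \<le> h y w" for y w
  proof -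
    define x where "x = (inv f ^^ n) y"
    have y: "(f ^^ n) x = y" by (simp add: x_def f_finv_iter)
    have "\<exists>z. 1 / 2 \<le> h x z"
    proof (rule ccontr)
      assume "\<nexists>z. 1 / 2 \<le> h x z"
      hence "\<And>z. h x z \<le> 1 / 2" by (meson linear)
      hence "(\<integral>v. h x v \<partial>\<nu> x) \<le> 1 / 2"
        using h_pos[of x] by (intro \<nu>_integral_bounds(2)[of 0]) (auto intro: less_imp_le)
      thus False by (simp add: h_int)
    qed
    then obtain z where z: "1 / 2 \<le> h x z" ..
    obtain v where v: "\<forall>i<n. v i = z i"
        "exp (- B) ^ n * h x v \<le> cocycle f (\<lambda>x. ruelle_fun (\<phi> x)) n x (h x) w"
      using ruelle_iter_ge[OF B(2), of "h x" n z x w] h_pos[of x] by (auto intro: less_imp_le)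
    have "1 / 4 \<le> h x v"
      using holder_boundD[OF C[of x] v(1)] Cn z by linarith
    hence "exp (- B) ^ n * (1 / 4) \<le> exp (- B) ^ n * h x v" by (intro mult_left_mono) auto
    also have "\<dots> \<le> cocycle_prod f \<rho> n x * h y w" using v(2) by (simp add: h_iter y)
    also have "\<dots> \<le> R ^ n * h y w"
    proof (intro mult_right_mono)
      have "cocycle_prod f \<rho> n x \<le> (\<Prod>i<n. R)"
        unfolding cocycle_prod_def R_def
        by (intro prod_mono) (use \<rho>_pos \<rho>_bounds(2)[OF B(2)] in \<open>auto intro: less_imp_le\<close>)
      thus "cocycle_prod f \<rho> n x \<le> R ^ n" by simp
    qed (use h_pos[of y w] in simp)
    finally show ?thesis unfolding \<eta>_def using R by (simp add: field_simps)
  qed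
  show ?thesis
    by (rule that[of \<eta> "1 + C"]) (use R C0 low up in \<open>auto simp: \<eta>_def\<close>)
qed

lemma P_sum: "(\<Sum>a\<in>UNIV. P x (case_nat a w)) = 1"
proof -
  have "\<rho> x * h (f x) w \<noteq> 0" using \<rho>_pos[of x] h_pos[of "f x" w] by simp
  moreover have "ruelle_fun (\<phi> x) (h x) w = \<rho> x * h (f x) w * (\<Sum>a\<in>UNIV. P x (case_nat a w))"
    using fun_cong[OF ruelle_conjugate[of x "\<lambda>_. 1"], of w] by (simp add: transfer_def)
  ultimately show ?thesis by (simp add: eigen_fun)
qed

text \<open>
  The uniform ellipticity and regularity that mixing requires: all factors of \<open>P x\<close> are
  bounded, bounded away from 0 and Hoelder with constants that do not depend on \<open>x\<close>.
\<close>

lemma P_weight: obtains \<delta> D where "0 < \<delta>" "\<And>x. markov_weight r \<delta> D (P x)"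
proof -
  obtain B C\<phi> where B: "0 < B" "\<And>x w. \<bar>\<phi> x w\<bar> \<le> B" "\<And>x. holder_bound r C\<phi> (\<phi> x)"
    by (rule \<phi>_bounds) blast
  obtain C where C: "\<And>x. holder_bound r C (h x)" by (rule h_bound) blast
  obtain \<eta> H where h: "0 < \<eta>" "0 < H" "\<And>x w. \<eta> \<le> h x w" "\<And>x w. h x w \<le> H"
    by (rule h_bounds) blast
  define R R' where "R = real CARD('l) * exp B" and "R' = real CARD('l) * exp (- B)"
  have R: "0 < R" "0 < R'" by (simp_all add: R_def R'_def)
  have \<rho>: "R' \<le> \<rho> x" "\<rho> x \<le> R" for x
    unfolding R_def R'_def by (intro \<rho>_bounds B)+
  have B': "\<phi> x w \<le> B" "- B \<le> \<phi> x w" for x w using B(2)[of x w] by (auto simp: abs_le_iff)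
  define \<delta> where "\<delta> = \<eta> * exp (- B) / (R * H)"
  have low: "\<delta> \<le> P x v" for x v
    unfolding \<delta>_def P_def
    by (intro frac_le mult_mono mult_pos_pos \<rho> h)
      (use h h_pos R B' \<rho>_pos in \<open>auto intro: less_imp_le\<close>)
  define D1 where "D1 = C * exp B + H * (exp B * C\<phi>)"
  define D2 where "D2 = (1 / R') * (C / r / \<eta>\<^sup>2)"
  have habs: "\<bar>h x v\<bar> \<le> H" for x v using h(4)[of x v] h_pos[of x v] by simp
  have num: "holder_bound r D1 (\<lambda>v. h x v * exp (\<phi> x v))" for x
    unfolding D1_def
    by (intro holder_bound_mult holder_bound_exp C B r)
      (use habs B' in auto)
  have den: "holder_bound r D2 (\<lambda>v. (1 / \<rho> x) * (1 / h (f x) (left_shift v)))" for x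
  proof -
    have "holder_bound r (\<bar>1 / \<rho> x\<bar> * (C / r / \<eta>\<^sup>2)) (\<lambda>v. (1 / \<rho> x) * (1 / h (f x) (left_shift v)))"
      by (intro holder_bound_cmult holder_bound_inverse holder_bound_shift C h r)
    moreover have "0 \<le> C / r / \<eta>\<^sup>2" using holder_bound_nonneg[OF C] r by simp
    hence "\<bar>1 / \<rho> x\<bar> * (C / r / \<eta>\<^sup>2) \<le> (1 / R') * (C / r / \<eta>\<^sup>2)"
      using \<rho>(1)[of x] R \<rho>_pos[of x] by (intro mult_right_mono) (auto intro: frac_le)
    hence "\<bar>1 / \<rho> x\<bar> * (C / r / \<eta>\<^sup>2) \<le> D2" unfolding D2_def .
    ultimately show ?thesis using holder_bound_mono r by blast
  qed
  have "holder_bound r (D1 * (1 / (R' * \<eta>)) + (H * exp B) * D2) (P x)" for x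
  proof -
    have "holder_bound r (D1 * (1 / (R' * \<eta>)) + (H * exp B) * D2)
      (\<lambda>v. (h x v * exp (\<phi> x v)) * ((1 / \<rho> x) * (1 / h (f x) (left_shift v))))"
    proof (rule holder_bound_mult[OF r(1) num _ den])
      fix w
      show "\<bar>h x w * exp (\<phi> x w)\<bar> \<le> H * exp B"
        using h(2,4) h_pos[of x w] B' by (simp add: abs_mult mult_mono)
      have "1 / (\<rho> x * h (f x) (left_shift w)) \<le> 1 / (R' * \<eta>)"
        using R h \<rho> \<rho>_pos[of x] h_pos[of "f x" "left_shift w"] by (intro frac_le mult_mono mult_pos_pos) auto
      thus "\<bar>1 / \<rho> x * (1 / h (f x) (left_shift w))\<bar> \<le> 1 / (R' * \<eta>)"
        using \<rho>_pos[of x] h_pos[of "f x" "left_shift w"] by (simp add: abs_mult)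
    qed
    thus ?thesis by (simp add: P_def[abs_def])
  qed
  hence "markov_weight r \<delta> (D1 * (1 / (R' * \<eta>)) + (H * exp B) * D2) (P x)" for x
    by (simp add: markov_weight_def low P_sum)
  moreover have "0 < \<delta>" using h R by (simp add: \<delta>_def)
  ultimately show ?thesis using that by blast
qed

end

lemma cocycle_prod_Suc_front: "cocycle_prod f \<rho> (Suc n) x = \<rho> x * cocycle_prod f \<rho> n (f x)"
  unfolding cocycle_prod_def by (subst prod.lessThan_Suc_shift) (simp add: funpow_swap1)

lemma sum_lessThan_add:
  fixes g :: "nat \<Rightarrow> real"
  shows "(\<Sum>i<a + b. g i) = (\<Sum>i<a. g i) + (\<Sum>i<b. g (a + i))"
  by (induction b) (auto simp: add.assoc)

section \<open>Continuity of eigenvalues and eigenfunctions\<close>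

context ruelle_setting
begin

lemma nonzero: "apply_bcontfun (h x) w \<noteq> 0" "\<rho> x \<noteq> 0" "cocycle_prod f \<rho> n x \<noteq> 0"
  using h_pos[of x w] \<rho>_pos[of x] cocycle_prod_pos[of n x] by simp_all

lemma apply_cocycle_ruelle:
  "apply_bcontfun (cocycle f (\<lambda>x. ruelle (\<phi> x)) n x g) =
     cocycle f (\<lambda>x. ruelle_fun (\<phi> x)) n x (apply_bcontfun g)"
  by (induction n) (simp_all add: ruelle_apply)

lemma dual_iter:
  "(\<integral>w. apply_bcontfun (cocycle f (\<lambda>x. ruelle (\<phi> x)) n x g) w \<partial>\<nu> ((f ^^ n) x)) =
     cocycle_prod f \<rho> n x * (\<integral>w. apply_bcontfun g w \<partial>\<nu> x)"
  by (induction n) (simp_all add: dual cocycle_prod_Suc, simp add: cocycle_prod_def)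

text \<open>
  The \<open>n\<close>-th iterate of the Ruelle operator on the constant function 1 is
  \<open>unit_iterate n x\<close>, up to the explicit factors \<open>cocycle_prod f \<rho> n x\<close> and \<open>h\<close>
  (\<open>ruelle_iter_one\<close>). Since it tends to 1 uniformly, the eigenvalues and eigenfunctions can be read
  off from these iterates.
\<close>

definition unit_iterate :: "nat \<Rightarrow> 'm \<Rightarrow> (nat \<Rightarrow> 'l) \<Rightarrow> real" where
  "unit_iterate n x = cocycle f T n x (\<lambda>v. 1 / h x v)"

lemma ruelle_iter_one:
  "cocycle f (\<lambda>x. ruelle_fun (\<phi> x)) n x (\<lambda>_. 1) =
     (\<lambda>w. cocycle_prod f \<rho> n x * (h ((f ^^ n) x) w * unit_iterate n x w))"
proof -
  have "(\<lambda>v. h x v * (1 / h x v)) = (\<lambda>_. 1)"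
    by (simp add: nonzero)
  thus ?thesis
    using ruelle_conjugate_iter[of n x "\<lambda>v. 1 / h x v"] by (simp only: unit_iterate_def)
qed

text \<open>
  By duality \<open>unit_iterate n x\<close> has mean 1 for the probability measure with density
  \<open>h ((f ^^ n) x)\<close>, so that its distance from 1 is at most its oscillation.
\<close>

lemma unit_iterate_near_1:
  assumes osc: "osc_bound e (unit_iterate n x)"
  shows "\<bar>unit_iterate n x w - 1\<bar> \<le> e"
proof -
  let ?y = "(f ^^ n) x"
  define c where "c = unit_iterate n x w"
  define L where "L = cocycle f (\<lambda>x. ruelle (\<phi> x)) n x (const_bcontfun 1)"
  interpret prob_space "\<nu> x" by (rule \<nu>_prob)
  have pr: "cocycle_prod f \<rho> n x \<noteq> 0" using cocycle_prod_pos[of n x] by simp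
  have one: "apply_bcontfun (const_bcontfun 1) = (\<lambda>_. 1)"
    by (simp add: const_bcontfun.rep_eq fun_eq_iff)
  have L: "apply_bcontfun L v = cocycle_prod f \<rho> n x * (h ?y v * unit_iterate n x v)" for v
    by (simp add: L_def apply_cocycle_ruelle one ruelle_iter_one)
  have "(\<integral>v. apply_bcontfun L v \<partial>\<nu> ?y) = cocycle_prod f \<rho> n x"
    unfolding L_def dual_iter one by (simp add: prob_space)
  hence intq: "(\<integral>v. h ?y v * unit_iterate n x v \<partial>\<nu> ?y) = 1"
    unfolding L using pr by simp
  have iL: "integrable (\<nu> ?y) (\<lambda>v. h ?y v * unit_iterate n x v)"
    using \<nu>_integrable[of ?y L] pr unfolding L by simp
  have ih: "integrable (\<nu> ?y) (\<lambda>v. k * h ?y v)" for k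
    using \<nu>_integrable[of ?y "h ?y"] by simp
  have q: "unit_iterate n x v \<le> c + e" "c - e \<le> unit_iterate n x v" for v
    using osc_boundD[OF osc, of v w] by (auto simp: c_def)
  have "(\<integral>v. h ?y v * unit_iterate n x v \<partial>\<nu> ?y) \<le> (\<integral>v. (c + e) * h ?y v \<partial>\<nu> ?y)"
    using q h_pos[of ?y] by (intro integral_mono iL ih) (simp add: mult.commute)
  moreover have "(\<integral>v. (c - e) * h ?y v \<partial>\<nu> ?y) \<le> (\<integral>v. h ?y v * unit_iterate n x v \<partial>\<nu> ?y)"
    using q h_pos[of ?y] by (intro integral_mono iL ih) (simp add: mult.commute)
  ultimately show ?thesis
    unfolding intq by (simp add: h_int c_def abs_le_iff)
qed

lemma unit_iterate_uniform:
  assumes "0 < e"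
  shows "\<exists>N. \<forall>n\<ge>N. \<forall>x w. \<bar>unit_iterate n x w - 1\<bar> \<le> e"
proof -
  obtain \<delta> D where P: "0 < \<delta>" "\<And>x. markov_weight r \<delta> D (P x)" by (rule P_weight) blast
  obtain C where C: "\<And>x. holder_bound r C (h x)" by (rule h_bound) blast
  obtain \<eta> H where h: "0 < \<eta>" "\<And>x w. \<eta> \<le> h x w" by (rule h_bounds) blast
  have hb: "holder_bound r (C / \<eta>\<^sup>2) (\<lambda>v. 1 / h x v)" for x
    by (rule holder_bound_inverse[OF C h])
  obtain N where N: "\<And>n x u. N \<le> n \<Longrightarrow> osc_bound (C / \<eta>\<^sup>2) u \<Longrightarrow> holder_bound r (C / \<eta>\<^sup>2) u \<Longrightarrow>
     osc_bound e (cocycle f T n x u)"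
    using uniform_mixing[where p = P and f = f, OF r P assms] by metis
  have "osc_bound e (unit_iterate n x)" if "N \<le> n" for n x
    unfolding unit_iterate_def by (rule N[OF that holder_bound_osc[OF hb] hb])
  hence "\<forall>n\<ge>N. \<forall>x w. \<bar>unit_iterate n x w - 1\<bar> \<le> e"
    by (intro allI impI unit_iterate_near_1)
  thus ?thesis ..
qed

lemma ruelle_iter_one_joint:
  "jointly_continuous (\<lambda>x. cocycle f (\<lambda>x. ruelle_fun (\<phi> x)) n x (\<lambda>_. 1))"
  unfolding ruelle_fun_transfer
  by (intro jointly_continuous_cocycle_transfer jointly_continuous_exp \<phi>_joint f_cont
      jointly_continuous_const_base) simp

text \<open>
  In the quotient of the iterates of lengths \<open>n + 1\<close> at \<open>x\<close> and \<open>n\<close> at \<open>f x\<close>, evaluated at one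
  point of the common fibre, all factors cancel except \<open>\<rho> x\<close> and two values that tend to 1.
\<close>

lemma \<rho>_cont: "continuous_on UNIV \<rho>"
proof -
  obtain B C0 where B: "0 < B" "\<And>x w. \<bar>\<phi> x w\<bar> \<le> B" by (rule \<phi>_bounds) blast
  define R where "R = real CARD('l) * exp B"
  have R: "0 < R" "\<And>x. \<rho> x \<le> R" unfolding R_def by (simp, intro \<rho>_bounds B)
  define L where "L n x = cocycle f (\<lambda>x. ruelle_fun (\<phi> x)) n x (\<lambda>_. 1)" for n x
  have L: "L n x w = cocycle_prod f \<rho> n x * (h ((f ^^ n) x) w * unit_iterate n x w)" for n x w
    by (simp add: L_def ruelle_iter_one)
  have L_cont: "continuous_on UNIV (\<lambda>x. L n x w)" for n w
    unfolding L_def by (rule jointly_continuous_at_point[OF ruelle_iter_one_joint])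
  have L_pos: "0 < L n x w" for n x w
  proof (unfold L_def, induction n arbitrary: w)
    case (Suc n)
    thus ?case unfolding cocycle.simps o_def ruelle_fun_eq by (intro sum_pos mult_pos_pos) auto
  qed simp
  define w0 :: "nat \<Rightarrow> 'l" where "w0 = undefined"
  define G where "G n x = L (Suc n) x w0 / L n (f x) w0" for n x
  have G: "G n x = \<rho> x * unit_iterate (Suc n) x w0 / unit_iterate n (f x) w0" for n x
  proof -
    have "cocycle_prod f \<rho> n (f x) \<noteq> 0" "h ((f ^^ n) (f x)) w0 \<noteq> 0"
      using cocycle_prod_pos[of n "f x"] h_pos[of "(f ^^ n) (f x)" w0] by simp_all
    thus ?thesis
      unfolding G_def L cocycle_prod_Suc_front by (simp add: funpow_swap1)
  qed
  have "jointly_continuous (\<lambda>x (w :: nat \<Rightarrow> 'l). \<rho> x)"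
  proof (rule jointly_continuous_uniform_limit[where G = "\<lambda>n x w. G n x"])
    fix n
    have "continuous_on UNIV (\<lambda>x. L n (f x) w0)"
      using continuous_on_compose2[OF L_cont f_cont] by simp
    moreover have "L n (f x) w0 \<noteq> 0" for x using L_pos[of n "f x" w0] by simp
    ultimately have "continuous_on UNIV (\<lambda>x. L (Suc n) x w0 / L n (f x) w0)"
      by (intro continuous_on_divide L_cont) auto
    hence "continuous_on UNIV (G n)" by (simp add: G_def[abs_def])
    thus "jointly_continuous (\<lambda>x (w :: nat \<Rightarrow> 'l). G n x)" by (rule jointly_continuous_const_fibre)
  next
    fix e :: real assume e: "0 < e"
    define e' where "e' = min (1 / 2) (e / (8 * R))"
    have e': "0 < e'" "e' \<le> 1 / 2" "e' \<le> e / (8 * R)" using e R by (auto simp: e'_def)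
    obtain N where N: "\<And>n x w. N \<le> n \<Longrightarrow> \<bar>unit_iterate n x w - 1\<bar> \<le> e'"
      using unit_iterate_uniform[OF e'(1)] by blast
    have "\<bar>G n x - \<rho> x\<bar> < e" if "N \<le> n" for n x
    proof -
      define a b where "a = unit_iterate (Suc n) x w0" and "b = unit_iterate n (f x) w0"
      have a: "\<bar>a - 1\<bar> \<le> e'" and b: "\<bar>b - 1\<bar> \<le> e'"
        using N[of "Suc n"] N[of n] that by (simp_all add: a_def b_def)
      have b2: "1 / 2 \<le> b" using b e' by (simp add: abs_le_iff)
      have "G n x - \<rho> x = \<rho> x * (a - b) / b"
        using b2 unfolding G a_def[symmetric] b_def[symmetric] by (simp add: field_simps)
      hence "\<bar>G n x - \<rho> x\<bar> = \<rho> x * \<bar>a - b\<bar> / b"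
        using b2 \<rho>_pos[of x] by (simp add: abs_mult)
      also have "\<dots> \<le> R * (2 * e') / (1 / 2)"
      proof (intro frac_le mult_mono)
        show "\<bar>a - b\<bar> \<le> 2 * e'" using a b by linarith
      qed (use R e' b2 in auto)
      also have "\<dots> = 4 * R * e'" by simp
      also have "\<dots> \<le> e / 2" using e'(3) R by (simp add: field_simps)
      also have "\<dots> < e" using e by simp
      finally show ?thesis .
    qed
    thus "\<exists>N. \<forall>n\<ge>N. \<forall>x (w :: nat \<Rightarrow> 'l). \<bar>G n x - \<rho> x\<bar> < e" by blast
  qed
  thus ?thesis by (rule jointly_continuous_at_point)
qed

lemma cocycle_prod_cont: "continuous_on UNIV (cocycle_prod f \<rho> n)"
  unfolding cocycle_prod_def
  by (intro continuous_on_prod continuous_on_compose2[OF \<rho>_cont iter_cont(1)]) auto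

text \<open>
  The normalised iterates that start at \<open>(inv f ^^ n) x\<close> arrive in the fibre over \<open>x\<close> and converge
  uniformly to \<open>h x\<close>.
\<close>

lemma h_joint: "jointly_continuous (\<lambda>x. apply_bcontfun (h x))"
proof -
  obtain \<eta> H where h: "0 < H" "\<And>x w. h x w \<le> H" by (rule h_bounds) blast
  define G where "G n x w = cocycle f (\<lambda>x. ruelle_fun (\<phi> x)) n ((inv f ^^ n) x) (\<lambda>_. 1) w /
      cocycle_prod f \<rho> n ((inv f ^^ n) x)" for n x w
  have G: "G n x w = h x w * unit_iterate n ((inv f ^^ n) x) w" for n x w
    using cocycle_prod_pos[of n "(inv f ^^ n) x"]
    by (simp add: G_def ruelle_iter_one f_finv_iter)
  show ?thesis
  proof (rule jointly_continuous_uniform_limit[where G = G])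
    fix n
    show "jointly_continuous (G n)"
      unfolding G_def[abs_def]
      by (intro jointly_continuous_divide jointly_continuous_const_fibre
          jointly_continuous_base[OF ruelle_iter_one_joint iter_cont(2)]
          continuous_on_compose2[OF cocycle_prod_cont iter_cont(2)])
        (auto simp: nonzero)
  next
    fix e :: real assume e: "0 < e"
    obtain N where N: "\<And>n x w. N \<le> n \<Longrightarrow> \<bar>unit_iterate n x w - 1\<bar> \<le> e / (2 * H)"
      using unit_iterate_uniform[of "e / (2 * H)"] e h by (meson divide_pos_pos zero_less_mult_iff zero_less_numeral)
    have "\<bar>G n x w - h x w\<bar> < e" if "N \<le> n" for n x w
    proof -
      have "G n x w - h x w = h x w * (unit_iterate n ((inv f ^^ n) x) w - 1)"
        by (simp add: G algebra_simps)
      hence "\<bar>G n x w - h x w\<bar> = h x w * \<bar>unit_iterate n ((inv f ^^ n) x) w - 1\<bar>"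
        using h_pos[of x w] by (simp add: abs_mult)
      also have "\<dots> \<le> H * (e / (2 * H))"
        using N[OF that] h h_pos[of x w] by (intro mult_mono) auto
      also have "\<dots> < e" using e h by simp
      finally show ?thesis .
    qed
    thus "\<exists>N. \<forall>n\<ge>N. \<forall>x w. \<bar>G n x w - h x w\<bar> < e" by blast
  qed
qed

lemma P_joint: "jointly_continuous P"
proof -
  have "jointly_continuous (\<lambda>x v. h x v * exp (\<phi> x v) / (\<rho> x * h (f x) (left_shift v)))"
    by (intro jointly_continuous_divide jointly_continuous_mult jointly_continuous_exp h_joint
        \<phi>_joint jointly_continuous_const_fibre[OF \<rho>_cont]
        jointly_continuous_compose[OF h_joint f_cont continuous_left_shift])
      (simp add: nonzero)
  thus ?thesis by (simp add: P_def[abs_def])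
qed

section \<open>A finite-dimensional bundle on which the normalised operators are nilpotent\<close>

lemma T_left_shift: "T x (\<lambda>v. g (left_shift v)) = g"
  by (simp add: fun_eq_iff transfer_def P_sum flip: sum_distrib_right)

lemma T_const: "T x (\<lambda>_. c) = (\<lambda>_. c)"
  using T_left_shift[of x "\<lambda>_. c"] .

lemma T_abs_le:
  assumes "\<And>v. \<bar>u v\<bar> \<le> m"
  shows "\<bar>T x u w\<bar> \<le> m"
proof -
  obtain \<delta> D where "0 < \<delta>" "\<And>x. markov_weight r \<delta> D (P x)" by (rule P_weight) blast
  hence pos: "0 \<le> P x v" for v by (meson markov_weight_def less_imp_le order_trans)
  have "\<bar>T x u w\<bar> \<le> (\<Sum>a\<in>UNIV. P x (case_nat a w) * m)"
    unfolding transfer_def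
    by (rule order_trans[OF sum_abs sum_mono]) (simp add: abs_mult pos mult_left_mono assms)
  also have "\<dots> = m" by (simp add: P_sum flip: sum_distrib_right)
  finally show ?thesis .
qed

text \<open>
  Composition with the shift is a right inverse of \<open>T x\<close> (\<open>T_left_shift\<close>), so this is the
  projection onto the kernel of \<open>T x\<close> along the functions that do not depend on the first
  coordinate.
\<close>

definition kernel_part :: "'m \<Rightarrow> ((nat \<Rightarrow> 'l) \<Rightarrow> real) \<Rightarrow> (nat \<Rightarrow> 'l) \<Rightarrow> real" where
  "kernel_part x u v = u v - T x u (left_shift v)"

lemma T_kernel_part: "T x (kernel_part x u) = (\<lambda>_. 0)"
  unfolding kernel_part_def transfer_diff T_left_shift by simp

lemma kernel_part_left_shift: "kernel_part x (\<lambda>v. g (left_shift v)) = (\<lambda>_. 0)"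
  by (simp add: fun_eq_iff kernel_part_def T_left_shift)

lemma kernel_part_diff:
  "kernel_part x (\<lambda>v. u v - u' v) = (\<lambda>w. kernel_part x u w - kernel_part x u' w)"
  by (simp add: fun_eq_iff kernel_part_def transfer_diff)

lemma kernel_part_sum:
  "kernel_part x (\<lambda>v. \<Sum>i\<in>I. c i * u i v) = (\<lambda>w. \<Sum>i\<in>I. c i * kernel_part x (u i) w)"
  by (simp add: fun_eq_iff kernel_part_def transfer_sum right_diff_distrib sum_subtractf)

lemma kernel_part_holder:
  assumes "\<exists>C. holder_bound r C u"
  shows "\<exists>C. holder_bound r C (kernel_part x u)"
proof -
  obtain C where C: "holder_bound r C u" using assms ..
  obtain \<delta> D where P: "0 < \<delta>" "\<And>x. markov_weight r \<delta> D (P x)" by (rule P_weight) blast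
  have "holder_bound r (r * C + C * (real CARD('l) * D)) (T x u)"
    using transfer_holder[OF r P(2) _ holder_bound_osc[OF C] C] P(1) by simp
  from holder_bound_add[OF C holder_bound_cmult[OF holder_bound_shift[OF r this], of "-1"]]
  have "holder_bound r (C + \<bar>- 1\<bar> * ((r * C + C * (real CARD('l) * D)) / r)) (kernel_part x u)"
    by (simp add: kernel_part_def[abs_def])
  thus ?thesis ..
qed

text \<open>
  For \<open>i < d\<close> and \<open>j < N\<close>, the function with index \<open>j * d + i\<close> is the kernel part of \<open>\<xi> i\<close> over
  \<open>(f ^^ j) x\<close> composed with \<open>j\<close> shifts; the last one, with index \<open>N * d\<close>, is the constant 1.
\<close>

primrec bundle_fun ::
    "(nat \<Rightarrow> (nat \<Rightarrow> 'l) \<Rightarrow> real) \<Rightarrow> nat \<Rightarrow> nat \<Rightarrow> nat \<Rightarrow> 'm \<Rightarrow> (nat \<Rightarrow> 'l) \<Rightarrow> real" where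
  "bundle_fun \<xi> d 0 i x = (\<lambda>w. 1)"
| "bundle_fun \<xi> d (Suc N) i x =
     (if i < d then kernel_part x (\<xi> i) else (\<lambda>w. bundle_fun \<xi> d N (i - d) (f x) (left_shift w)))"

lemma bundle_fun_last: "bundle_fun \<xi> d N (N * d) x = (\<lambda>w. 1)"
  by (induction N arbitrary: x) auto

definition comb ::
    "(nat \<Rightarrow> (nat \<Rightarrow> 'l) \<Rightarrow> real) \<Rightarrow> nat \<Rightarrow> nat \<Rightarrow> (nat \<Rightarrow> real) \<Rightarrow> 'm \<Rightarrow> (nat \<Rightarrow> 'l) \<Rightarrow> real" where
  "comb \<xi> d N c x w = (\<Sum>i<Suc (N * d). c i * bundle_fun \<xi> d N i x w)"

lemma comb_0: "comb \<xi> d 0 c x = (\<lambda>w. c 0)"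
  by (simp add: fun_eq_iff comb_def)

text \<open>
  The recursive structure of the bundle: a kernel element plus a shifted element of the bundle with
  one level less over \<open>f x\<close>. Consequently \<open>T x\<close> strips off one level (\<open>T_comb_Suc\<close>).
\<close>

lemma comb_Suc:
  "comb \<xi> d (Suc N) c x = (\<lambda>w. kernel_part x (\<lambda>v. \<Sum>i<d. c i * \<xi> i v) w +
     comb \<xi> d N (\<lambda>i. c (d + i)) (f x) (left_shift w))"
proof
  fix w
  have "comb \<xi> d (Suc N) c x w = (\<Sum>i<d + Suc (N * d). c i * bundle_fun \<xi> d (Suc N) i x w)"
    by (simp add: comb_def)
  also have "\<dots> = (\<Sum>i<d. c i * kernel_part x (\<xi> i) w) +
      comb \<xi> d N (\<lambda>i. c (d + i)) (f x) (left_shift w)"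
    unfolding sum_lessThan_add comb_def by simp
  finally show "comb \<xi> d (Suc N) c x w = kernel_part x (\<lambda>v. \<Sum>i<d. c i * \<xi> i v) w +
     comb \<xi> d N (\<lambda>i. c (d + i)) (f x) (left_shift w)"
    by (simp add: kernel_part_sum)
qed

lemma T_comb_Suc: "T x (comb \<xi> d (Suc N) c x) = comb \<xi> d N (\<lambda>i. c (d + i)) (f x)"
  unfolding comb_Suc transfer_add T_kernel_part T_left_shift by simp

text \<open>
  Bundles with more levels are larger: a constant is itself a shifted constant. Together with
  \<open>T_comb_Suc\<close> this makes the bundle invariant.
\<close>

lemma comb_embed:
  "\<exists>c'. comb \<xi> d (Suc N) c' x = comb \<xi> d N c x \<and> c' (Suc N * d) = c (N * d)"
proof (induction N arbitrary: x c)
  case 0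
  have "comb \<xi> d (Suc 0) (\<lambda>i. if i < d then 0 else c 0) x = comb \<xi> d 0 c x"
    unfolding comb_Suc comb_0 by (simp add: fun_eq_iff kernel_part_def T_const)
  thus ?case by (intro exI[of _ "\<lambda>i. if i < d then 0 else c 0"]) simp
next
  case (Suc N)
  obtain c' where c': "comb \<xi> d (Suc N) c' (f x) = comb \<xi> d N (\<lambda>i. c (d + i)) (f x)"
      "c' (Suc N * d) = c (d + N * d)"
    using Suc.IH[of "f x" "\<lambda>i. c (d + i)"] by blast
  define c'' where "c'' = (\<lambda>i. if i < d then c i else c' (i - d))"
  have "(\<lambda>i. c'' (d + i)) = c'" and sum: "(\<Sum>i<d. c'' i * \<xi> i v) = (\<Sum>i<d. c i * \<xi> i v)" for v
    by (auto simp: c''_def)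
  hence "comb \<xi> d (Suc (Suc N)) c'' x = comb \<xi> d (Suc N) c x"
    by (subst (1 2) comb_Suc) (simp only: c'(1))
  moreover have "c'' (Suc (Suc N) * d) = c (Suc N * d)"
    using c'(2) by (simp add: c''_def)
  ultimately show ?case by blast
qed

lemma T_comb: "\<exists>c'. T x (comb \<xi> d N c x) = comb \<xi> d N c' (f x) \<and> c' (N * d) = c (N * d)"
proof (cases N)
  case 0
  thus ?thesis by (intro exI[of _ c]) (simp add: comb_0 T_const)
next
  case (Suc M)
  thus ?thesis
    using comb_embed[of \<xi> d M "f x" "\<lambda>i. c (d + i)"] unfolding Suc T_comb_Suc by auto metis
qed

lemma T_iter_comb: "cocycle f T N x (comb \<xi> d N c x) = (\<lambda>_. c (N * d))"
proof (induction N arbitrary: x c)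
  case (Suc N)
  show ?case unfolding cocycle_Suc_front T_comb_Suc Suc by simp
qed (simp add: comb_0)

text \<open>
  Modelled on the indicator functions of the cylinders of length \<open>n\<close> whose first letter is not
  \<open>a0\<close>, with representatives \<open>z i\<close> of these cylinders. The functions of \<open>n\<close> coordinates are
  the sums of combinations of these indicators and of functions that do not depend on the first
  coordinate; the latter have no kernel part, and on the former the kernel part is injective.
\<close>

definition cylinder_family ::
    "nat \<Rightarrow> 'l \<Rightarrow> nat \<Rightarrow> (nat \<Rightarrow> (nat \<Rightarrow> 'l) \<Rightarrow> real) \<Rightarrow> (nat \<Rightarrow> nat \<Rightarrow> 'l) \<Rightarrow> bool" where
  "cylinder_family n a0 d \<xi> z \<longleftrightarrow>
     (\<forall>i<d. \<exists>C. holder_bound r C (\<xi> i)) \<and>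
     (\<forall>i<d. \<forall>j<d. \<xi> i (z j) = (if i = j then 1 else 0)) \<and>
     (\<forall>i<d. \<forall>w. w 0 = a0 \<longrightarrow> \<xi> i w = 0) \<and>
     (\<forall>w. w 0 \<noteq> a0 \<longrightarrow> (\<exists>j<d. (\<forall>k<n. z j k = w k) \<and> (\<forall>i<d. \<xi> i w = \<xi> i (z j))))"

lemma cylinder_family_exists:
  assumes n: "0 < n"
  obtains d \<xi> z where "0 < d" "cylinder_family n a0 d \<xi> z"
proof -
  define Wd where "Wd = {xs :: 'l list. length xs = n \<and> hd xs \<noteq> a0}"
  have "finite {xs :: 'l list. set xs \<subseteq> UNIV \<and> length xs = n}" by (rule finite_lists_length_eq) simp
  hence fin: "finite Wd" by (rule finite_subset[rotated]) (auto simp: Wd_def)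
  define d where "d = card Wd"
  obtain e where e: "bij_betw e {0..<d} Wd"
    unfolding d_def using ex_bij_betw_nat_finite[OF fin] by blast
  have eW: "length (e i) = n" "hd (e i) \<noteq> a0" if "i < d" for i
    using bij_betwE[OF e] that by (auto simp: Wd_def)
  define \<xi> where "\<xi> i w = (if map w [0..<n] = e i then 1 else 0 :: real)" for i and w :: "nat \<Rightarrow> 'l"
  define z where "z i k = (if k < n then e i ! k else a0)" for i k
  have zmap: "map (z j) [0..<n] = e j" if "j < d" for j
    by (rule nth_equalityI) (auto simp: z_def eW that)
  have "\<exists>b. b \<noteq> a0"
  proof (rule ccontr)
    assume "\<nexists>b. b \<noteq> a0"
    hence "UNIV = {a0}" by auto
    hence "CARD('l) = card {a0}" by (rule arg_cong)
    thus False using card by simp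
  qed
  then obtain b where "b \<noteq> a0" ..
  hence "replicate n b \<in> Wd" using n by (cases n) (auto simp: Wd_def)
  hence d: "0 < d" unfolding d_def using fin by (auto simp: card_gt_0_iff)
  have "holder_bound r ((1 / r) ^ n) (\<xi> i)" for i
  proof (rule holder_boundI)
    fix k and v w :: "nat \<Rightarrow> 'l" assume ag: "\<forall>i<k. v i = w i"
    show "\<bar>\<xi> i v - \<xi> i w\<bar> \<le> (1 / r) ^ n * r ^ k"
    proof (cases "n \<le> k")
      case True
      hence eq: "map v [0..<n] = map w [0..<n]" using ag by auto
      have "\<xi> i v = \<xi> i w" unfolding \<xi>_def eq ..
      thus ?thesis using r by simp
    next
      case False
      have "\<bar>\<xi> i v - \<xi> i w\<bar> \<le> 1" by (auto simp: \<xi>_def)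
      also have "1 \<le> (1 / r) ^ n * r ^ k"
        using False r power_decreasing[of k n r] by (simp add: power_divide)
      finally show ?thesis .
    qed
  qed
  moreover have "\<xi> i (z j) = (if i = j then 1 else 0)" if "i < d" "j < d" for i j
    using zmap[OF that(2)] inj_onD[OF bij_betw_imp_inj_on[OF e], of i j] that by (auto simp: \<xi>_def)
  moreover have "\<xi> i w = 0" if "i < d" "w 0 = a0" for i w
  proof -
    have "map w [0..<n] \<noteq> e i"
    proof
      assume "map w [0..<n] = e i"
      hence "hd (map w [0..<n]) = hd (e i)" by simp
      thus False using n eW(2)[OF that(1)] that(2) by (simp add: hd_map)
    qed
    thus ?thesis by (simp add: \<xi>_def)
  qed
  moreover have "\<exists>j<d. (\<forall>k<n. z j k = w k) \<and> (\<forall>i<d. \<xi> i w = \<xi> i (z j))" if "w 0 \<noteq> a0" for w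
  proof -
    have "map w [0..<n] \<in> Wd" using n that by (simp add: Wd_def hd_map)
    then obtain j where j: "j < d" "e j = map w [0..<n]"
      using bij_betw_imp_surj_on[OF e] by (auto simp: image_iff)
    have "\<forall>k<n. z j k = w k" by (simp add: z_def j(2))
    moreover have "\<forall>i<d. \<xi> i w = \<xi> i (z j)" by (simp add: \<xi>_def zmap[OF j(1)] j(2))
    ultimately show ?thesis using j(1) by blast
  qed
  ultimately have "cylinder_family n a0 d \<xi> z" unfolding cylinder_family_def by blast
  with d show ?thesis using that by blast
qed

text \<open>
  \<open>T\<close> strips off the levels one by one, so it suffices to treat a combination \<open>v\<close> of the \<open>\<xi> i\<close>
  whose kernel part is 0. Such a \<open>v\<close> does not depend on the first coordinate and
  vanishes where that is \<open>a0\<close>; hence it is 0.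
\<close>

lemma comb_eq_zero:
  assumes fam: "cylinder_family n a0 d \<xi> z" and "comb \<xi> d N c x = (\<lambda>_. 0)"
  shows "\<forall>i<Suc (N * d). c i = 0"
  using assms(2)
proof (induction N arbitrary: x c)
  case 0
  thus ?case by (simp add: comb_0 fun_eq_iff)
next
  case (Suc N)
  have "comb \<xi> d N (\<lambda>i. c (d + i)) (f x) = (\<lambda>_. 0)"
    using T_comb_Suc[of x \<xi> d N c] unfolding Suc.prems T_const by simp
  from Suc.IH[OF this] have tail: "\<forall>i<Suc (N * d). c (d + i) = 0" .
  define v where "v = (\<lambda>w. \<Sum>i<d. c i * \<xi> i w)"
  have "comb \<xi> d N (\<lambda>i. c (d + i)) (f x) w = 0" for w using tail by (simp add: comb_def)
  hence kp: "kernel_part x v w = 0" for w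
    using fun_cong[OF comb_Suc[of \<xi> d N c x], of w] Suc.prems by (simp add: v_def)
  hence Tv: "v w = T x v (left_shift w)" for w by (simp add: kernel_part_def)
  have v0: "v w = 0" if "w 0 = a0" for w using fam that by (simp add: v_def cylinder_family_def)
  have vz: "v w = 0" for w
    using Tv[of w] Tv[of "case_nat a0 (left_shift w)"] v0[of "case_nat a0 (left_shift w)"] by simp
  have head: "c j = 0" if "j < d" for j
  proof -
    have "v (z j) = (\<Sum>i<d. if i = j then c i else 0)"
      unfolding v_def using fam that by (intro sum.cong) (auto simp: cylinder_family_def)
    also have "\<dots> = c j" using that by simp
    finally show ?thesis using vz by simp
  qed
  show ?case
  proof (intro allI impI)
    fix i assume "i < Suc (Suc N * d)"
    thus "c i = 0" using head[of i] tail[rule_format, of "i - d"] by (cases "i < d") auto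
  qed
qed

text \<open>
  The martingale decomposition of \<open>u\<close>, with each of the \<open>N\<close> kernel parts replaced by that of a
  combination of the \<open>\<xi> i\<close>. The bounds \<open>c\<close> and \<open>b\<close> are preserved by \<open>T\<close>, so that each
  replacement costs the same \<open>4 * (b * r ^ n)\<close>; the term \<open>e\<close> is the price for replacing
  \<open>T ^ N u\<close> by a constant.
\<close>

lemma comb_approx:
  assumes fam: "cylinder_family n a0 d \<xi> z"
    and P: "0 < \<delta>" "\<And>x. markov_weight r \<delta> D (P x)"
    and b: "r * b + c * (real CARD('l) * D) \<le> b"
    and u: "osc_bound c u" "holder_bound r b u" "osc_bound e (cocycle f T N x u)"
  shows "\<exists>cf. \<forall>w. \<bar>u w - comb \<xi> d N cf x w\<bar> \<le> real N * (4 * (b * r ^ n)) + e"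
  using u
proof (induction N arbitrary: x u)
  case 0
  hence "\<forall>w. \<bar>u w - comb \<xi> d 0 (\<lambda>_. u undefined) x w\<bar> \<le> real 0 * (4 * (b * r ^ n)) + e"
    using osc_boundD[of e u] by (simp add: comb_0)
  thus ?case by blast
next
  case (Suc N)
  have Tu: "osc_bound c (T x u)" "holder_bound r b (T x u)"
    using transfer_osc[OF P(2)] transfer_holder[OF r P(2)] Suc.prems P(1) b holder_bound_mono r(1)
    by (auto, blast)
  obtain cf1 where cf1: "\<And>w. \<bar>T x u w - comb \<xi> d N cf1 (f x) w\<bar> \<le> real N * (4 * (b * r ^ n)) + e"
    using Suc.IH[OF Tu, of "f x"] Suc.prems(3) unfolding cocycle_Suc_front by blast
  \<comment> \<open>Subtracting a function of the shifted sequence does not change the kernel part, and achieves that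
    the difference vanishes on sequences that start with \<open>a0\<close>.\<close>
  define u0 where "u0 = (\<lambda>w. u w - u (case_nat a0 (left_shift w)))"
  define v where "v = (\<lambda>w. \<Sum>i<d. u0 (z i) * \<xi> i w)"
  have near: "\<bar>u0 w - v w\<bar> \<le> 2 * (b * r ^ n)" for w
  proof (cases "w 0 = a0")
    case True
    have "case_nat a0 (left_shift w) = w"
      using True by (auto simp: left_shift_def fun_eq_iff split: nat.split)
    hence "u0 w = 0" by (simp add: u0_def)
    moreover have "v w = 0" using fam True by (simp add: v_def cylinder_family_def)
    ultimately show ?thesis using holder_bound_nonneg[OF Suc.prems(2)] r by simp
  next
    case False
    then obtain j where j: "j < d" "\<forall>k<n. z j k = w k" "\<forall>i<d. \<xi> i w = \<xi> i (z j)"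
      using fam unfolding cylinder_family_def by blast
    have "v w = (\<Sum>i<d. if i = j then u0 (z i) else 0)"
      unfolding v_def using fam j by (intro sum.cong) (auto simp: cylinder_family_def)
    hence "v w = u0 (z j)" using j by simp
    moreover have "\<bar>u w - u (z j)\<bar> \<le> b * r ^ n"
      by (rule holder_boundD[OF Suc.prems(2)]) (use j in auto)
    moreover have "\<bar>u (case_nat a0 (left_shift w)) - u (case_nat a0 (left_shift (z j)))\<bar> \<le> b * r ^ n"
      by (rule holder_boundD[OF Suc.prems(2)]) (use j in \<open>auto simp: left_shift_def split: nat.split\<close>)
    ultimately show ?thesis unfolding u0_def by linarith
  qed
  have kp: "kernel_part x u0 = kernel_part x u"
    unfolding u0_def kernel_part_diff using kernel_part_left_shift[of x "\<lambda>y. u (case_nat a0 y)"] by simp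
  have kp_near: "\<bar>kernel_part x u w - kernel_part x v w\<bar> \<le> 4 * (b * r ^ n)" for w
  proof -
    have "kernel_part x u w - kernel_part x v w = (u0 w - v w) - T x (\<lambda>w. u0 w - v w) (left_shift w)"
      unfolding kp[symmetric] using fun_cong[OF kernel_part_diff[of x u0 v], of w]
      by (simp add: kernel_part_def)
    moreover have "\<bar>T x (\<lambda>w. u0 w - v w) (left_shift w)\<bar> \<le> 2 * (b * r ^ n)"
      by (rule T_abs_le[OF near])
    ultimately show ?thesis using near[of w] by linarith
  qed
  define cf where "cf = (\<lambda>i. if i < d then u0 (z i) else cf1 (i - d))"
  have cf: "comb \<xi> d (Suc N) cf x w = kernel_part x v w + comb \<xi> d N cf1 (f x) (left_shift w)" for w
    unfolding comb_Suc by (simp add: cf_def v_def)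
  have "\<bar>u w - comb \<xi> d (Suc N) cf x w\<bar> \<le> real (Suc N) * (4 * (b * r ^ n)) + e" for w
  proof -
    have "u w = kernel_part x u w + T x u (left_shift w)" by (simp add: kernel_part_def)
    hence "\<bar>u w - comb \<xi> d (Suc N) cf x w\<bar> \<le> 4 * (b * r ^ n) + (real N * (4 * (b * r ^ n)) + e)"
      using kp_near[of w] cf1[of "left_shift w"] unfolding cf by linarith
    thus ?thesis by (simp add: algebra_simps)
  qed
  thus ?case by blast
qed

lemma bundle_fun_holder:
  assumes "\<forall>i<d. \<exists>C. holder_bound r C (\<xi> i)"
  shows "\<exists>C. holder_bound r C (bundle_fun \<xi> d N i x)"
proof (induction N arbitrary: i x)
  case 0
  show ?case using holder_bound_const[OF r(1), of 0 1] by auto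
next
  case (Suc N)
  show ?case
  proof (cases "i < d")
    case True
    thus ?thesis using kernel_part_holder assms by simp
  next
    case False
    obtain C where "holder_bound r C (bundle_fun \<xi> d N (i - d) (f x))" using Suc by blast
    from holder_bound_shift[OF r this] False show ?thesis by auto
  qed
qed

lemma holder_continuous: "holder_bound r C u \<Longrightarrow> continuous_on UNIV (u :: (nat \<Rightarrow> 'l) \<Rightarrow> real)"
  using is_holder_bcontfun[OF r] is_holder_iff[OF r] by (auto simp: bcontfun_def)

lemma bundle_fun_joint:
  assumes "\<forall>i<d. \<exists>C. holder_bound r C (\<xi> i)"
  shows "jointly_continuous (bundle_fun \<xi> d N i)"
proof (induction N arbitrary: i)
  case 0
  show ?case by (simp add: jointly_continuous_def)
next
  case (Suc N)
  show ?case
  proof (cases "i < d")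
    case True
    then obtain C where "holder_bound r C (\<xi> i)" using assms by blast
    hence \<xi>: "jointly_continuous (\<lambda>x. \<xi> i)"
      by (intro jointly_continuous_const_base holder_continuous)
    have "jointly_continuous (\<lambda>x v. \<xi> i v - T x (\<xi> i) (left_shift v))"
      by (intro jointly_continuous_diff \<xi> jointly_continuous_fibre[OF _ continuous_left_shift]
          jointly_continuous_transfer P_joint)
    thus ?thesis using True by (simp add: kernel_part_def[abs_def])
  next
    case False
    thus ?thesis
      using jointly_continuous_compose[OF Suc f_cont continuous_left_shift, of "i - d"] by simp
  qed
qed

end

section \<open>Families of vectors with unique coefficients\<close>

text \<open>
  Turns uniqueness of coefficients, which \<open>comb_eq_zero\<close> provides for the bundle, into the
  statements on spans and dimensions by which bundles and splittings are defined.
\<close>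

lemma independent_family:
  fixes e :: "nat \<Rightarrow> 'v::real_vector"
  assumes uniq: "\<And>c. (\<Sum>i<m. c i *\<^sub>R e i) = 0 \<Longrightarrow> \<forall>i<m. c i = 0"
  shows "inj_on e {..<m}" "independent (e ` {..<m})"
    "span (e ` {..<m}) = range (\<lambda>c. \<Sum>i<m. c i *\<^sub>R e i)" "dim (range (\<lambda>c. \<Sum>i<m. c i *\<^sub>R e i)) = m"
proof -
  show inj: "inj_on e {..<m}"
  proof (rule inj_onI, rule ccontr)
    fix i j assume ij: "i \<in> {..<m}" "j \<in> {..<m}" "e i = e j" "i \<noteq> j"
    have "(\<Sum>k<m. ((if k = i then 1 else 0) - (if k = j then 1 else 0)) *\<^sub>R e k) = e i - e j"
      using ij by (simp add: scaleR_left_diff_distrib sum_subtractf if_distrib[of "\<lambda>t. t *\<^sub>R _"] cong: if_cong)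
    hence "\<forall>k<m. (if k = i then 1 else 0) - (if k = j then 1 else 0) = (0::real)"
      using ij by (intro uniq) simp
    thus False using ij by (metis diff_zero lessThan_iff zero_neq_one)
  qed
  show ind: "independent (e ` {..<m})"
  proof (rule independent_if_scalars_zero)
    fix g v assume g: "(\<Sum>v\<in>e ` {..<m}. g v *\<^sub>R v) = 0" and v: "v \<in> e ` {..<m}"
    have "(\<Sum>i<m. g (e i) *\<^sub>R e i) = 0" using g by (simp add: sum.reindex[OF inj])
    from uniq[OF this] v show "g v = 0" by auto
  qed simp
  show sp: "span (e ` {..<m}) = range (\<lambda>c. \<Sum>i<m. c i *\<^sub>R e i)"
  proof (intro set_eqI iffI)
    fix v assume "v \<in> span (e ` {..<m})"
    then obtain g where "v = (\<Sum>v\<in>e ` {..<m}. g v *\<^sub>R v)" by (auto simp: span_finite)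
    hence "v = (\<Sum>i<m. g (e i) *\<^sub>R e i)" by (simp add: sum.reindex[OF inj])
    thus "v \<in> range (\<lambda>c. \<Sum>i<m. c i *\<^sub>R e i)" by (intro range_eqI[of _ _ "\<lambda>i. g (e i)"])
  next
    fix v assume "v \<in> range (\<lambda>c. \<Sum>i<m. c i *\<^sub>R e i)"
    then obtain c where "v = (\<Sum>i<m. c i *\<^sub>R e i)" by blast
    thus "v \<in> span (e ` {..<m})" using span_sum[of "{..<m}" "\<lambda>i. c i *\<^sub>R e i" "e ` {..<m}"]
      by (simp add: span_scale span_base)
  qed
  show "dim (range (\<lambda>c. \<Sum>i<m. c i *\<^sub>R e i)) = m"
    unfolding sp[symmetric] dim_span dim_eq_card_independent[OF ind] by (simp add: card_image[OF inj])
qed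

lemma apply_bcontfun_sum:
  fixes F :: "'i \<Rightarrow> ('x::topological_space \<Rightarrow>\<^sub>C real)"
  shows "finite I \<Longrightarrow> apply_bcontfun (\<Sum>i\<in>I. F i) w = (\<Sum>i\<in>I. apply_bcontfun (F i) w)"
  by (induction I rule: finite_induct) (simp_all add: zero_bcontfun.rep_eq plus_bcontfun.rep_eq)

context ruelle_setting
begin

section \<open>The Ruelle operators as a continuous family of positive operators\<close>

lemma ruelle_apply_sum:
  "ruelle (\<phi> x) g w = (\<Sum>a\<in>UNIV. g (case_nat a w) * exp (\<phi> x (case_nat a w)))"
  by (simp add: ruelle_apply ruelle_fun_eq)

lemma ruelle_positive: "positive_operator r (ruelle (\<phi> x))"
  unfolding positive_operator_def ruelle_apply_sum by (auto intro!: sum_nonneg)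

lemma holder_space_iff:
  "g \<in> holder_space r \<longleftrightarrow> (\<exists>C. holder_bound r C (apply_bcontfun g))"
  unfolding holder_space_def mem_Collect_eq by (rule is_holder_iff[OF r])

lemma ruelle_scaleR: "ruelle (\<phi> x) (c *\<^sub>R g) = c *\<^sub>R ruelle (\<phi> x) g"
  by (rule bcontfun_eqI)
    (simp add: ruelle_apply_sum scaleR_bcontfun.rep_eq sum_distrib_left mult.assoc)

lemma ruelle_add: "ruelle (\<phi> x) (g + g') = ruelle (\<phi> x) g + ruelle (\<phi> x) g'"
  by (rule bcontfun_eqI)
    (simp add: ruelle_apply_sum plus_bcontfun.rep_eq distrib_right sum.distrib)

lemma abs_le_holder_norm:
  assumes "g \<in> holder_space r"
  shows "\<bar>apply_bcontfun g w\<bar> \<le> (SUP w. \<bar>apply_bcontfun g w\<bar>)"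
proof (rule cSUP_upper)
  show "bdd_above (range (\<lambda>w. \<bar>apply_bcontfun g w\<bar>))"
    by (intro bdd_aboveI2[of _ _ "norm g"]) (use norm_bounded[of g] in simp)
qed simp

lemma ruelle_holder_operator: "holder_operator r (ruelle (\<phi> x))"
proof -
  obtain B C where B: "0 < B" "\<And>x w. \<bar>\<phi> x w\<bar> \<le> B" "\<And>x. holder_bound r C (\<phi> x)"
    by (rule \<phi>_bounds) blast
  have C0: "0 \<le> C" using B(3) holder_bound_nonneg by blast
  have B': "\<phi> x w \<le> B" for w using B(2)[of x w] by (simp add: abs_le_iff)
  have bound: "holder_bound r (\<Sum>a\<in>(UNIV::'l set). (c * exp B + S * (exp B * C)) * r)
      (apply_bcontfun (ruelle (\<phi> x) g))"
    if "holder_bound r c (apply_bcontfun g)" "\<And>w. \<bar>apply_bcontfun g w\<bar> \<le> S" for g c S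
  proof -
    have "holder_bound r (c * exp B + S * (exp B * C)) (\<lambda>v. g v * exp (\<phi> x v))"
      by (intro holder_bound_mult holder_bound_exp r B that B') (simp add: B')
    hence "holder_bound r (\<Sum>a\<in>(UNIV::'l set). (c * exp B + S * (exp B * C)) * r)
      (\<lambda>w. \<Sum>a\<in>UNIV. g (case_nat a w) * exp (\<phi> x (case_nat a w)))"
      by (intro holder_bound_sum r holder_bound_prepend[where g = "\<lambda>v. apply_bcontfun g v * exp (\<phi> x v)"]) auto
    thus ?thesis by (simp add: ruelle_apply_sum[abs_def] ruelle_apply ruelle_fun_eq[abs_def])
  qed
  have maps: "ruelle (\<phi> x) g \<in> holder_space r" if mem: "g \<in> holder_space r" for g
  proof -
    obtain c where c: "holder_bound r c (apply_bcontfun g)"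
      using mem[unfolded holder_space_iff] by (rule exE)
    have "\<And>w. \<bar>apply_bcontfun g w\<bar> \<le> norm g" using norm_bounded[of g] by simp
    from bound[OF c this] show ?thesis unfolding holder_space_iff by (rule exI)
  qed
  have "holder_norm r (ruelle (\<phi> x) g) \<le> (real CARD('l) * (2 * exp B + exp B * C)) * holder_norm r g"
    if g: "g \<in> holder_space r" for g
  proof -
    define S c where "S = (SUP w. \<bar>apply_bcontfun g w\<bar>)" and "c = holder_const r (apply_bcontfun g)"
    have S: "\<bar>apply_bcontfun g w\<bar> \<le> S" for w unfolding S_def by (rule abs_le_holder_norm[OF g])
    have c: "holder_bound r c (apply_bcontfun g)"
      unfolding c_def using g by (intro holder_bound_holder_const r card) (simp add: holder_space_def)
    have S0: "0 \<le> S" using S[of undefined] by linarith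
    have c0: "0 \<le> c" using holder_bound_nonneg[OF c] .
    have "holder_const r (apply_bcontfun (ruelle (\<phi> x) g)) \<le> real CARD('l) * ((c * exp B + S * (exp B * C)) * r)"
      using holder_const_le[OF r card bound[OF c S]] by simp
    also have "\<dots> \<le> real CARD('l) * ((c * exp B + S * (exp B * C)) * 1)"
      using r S0 c0 C0 by (intro mult_left_mono) auto
    finally have 1: "holder_const r (apply_bcontfun (ruelle (\<phi> x) g)) \<le> real CARD('l) * (c * exp B + S * (exp B * C))"
      by simp
    have 2: "(SUP w. \<bar>apply_bcontfun (ruelle (\<phi> x) g) w\<bar>) \<le> real CARD('l) * (S * exp B)"
    proof (rule cSUP_least)
      fix w
      have "\<bar>ruelle (\<phi> x) g w\<bar> \<le> (\<Sum>a\<in>(UNIV::'l set). S * exp B)"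
        unfolding ruelle_apply_sum
        by (rule order_trans[OF sum_abs sum_mono]) (use S S0 B' in \<open>auto simp: abs_mult intro!: mult_mono\<close>)
      thus "\<bar>ruelle (\<phi> x) g w\<bar> \<le> real CARD('l) * (S * exp B)" by simp
    qed simp
    have "holder_norm r (ruelle (\<phi> x) g) \<le> real CARD('l) * (S * exp B + (c * exp B + S * (exp B * C)))"
      using 1 2 by (simp add: holder_norm_def distrib_left)
    also have "\<dots> \<le> real CARD('l) * ((2 * exp B + exp B * C) * (S + c))"
    proof (rule mult_left_mono)
      have "(2 * exp B + exp B * C) * (S + c) - (S * exp B + (c * exp B + S * (exp B * C))) =
          exp B * S + exp B * c + exp B * C * c" by (simp add: algebra_simps)
      also have "0 \<le> \<dots>" using S0 c0 C0 by simp
      finally show "S * exp B + (c * exp B + S * (exp B * C)) \<le> (2 * exp B + exp B * C) * (S + c)" by simp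
    qed simp
    finally show ?thesis by (simp add: holder_norm_def S_def c_def mult.assoc)
  qed
  thus ?thesis
    unfolding holder_operator_def
    by (intro conjI ballI allI maps ruelle_add ruelle_scaleR
        exI[of _ "real CARD('l) * (2 * exp B + exp B * C)"])
qed

lemma ruelle_continuous_family: "continuous_operator_family r (\<lambda>x. ruelle (\<phi> x))"
  unfolding continuous_operator_family_def
proof (intro allI impI)
  fix x0 and e :: real assume e: "0 < e"
  define k where "k = real CARD('l)"
  have k: "0 < k" by (simp add: k_def)
  have "eventually (\<lambda>x. \<forall>w. \<bar>exp (\<phi> x w) - exp (\<phi> x0 w)\<bar> \<le> e / k) (nhds x0)"
    by (rule jointly_continuous_uniform_nhds[OF jointly_continuous_exp[OF \<phi>_joint]]) (use e k in simp)
  thus "eventually (\<lambda>x. \<forall>g\<in>holder_space r. norm (ruelle (\<phi> x) g - ruelle (\<phi> x0) g) \<le> e * norm g) (nhds x0)"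
  proof eventually_elim
    fix x assume x: "\<forall>w. \<bar>exp (\<phi> x w) - exp (\<phi> x0 w)\<bar> \<le> e / k"
    show "\<forall>g\<in>holder_space r. norm (ruelle (\<phi> x) g - ruelle (\<phi> x0) g) \<le> e * norm g"
    proof (intro ballI norm_bound)
      fix g :: "(nat \<Rightarrow> 'l) \<Rightarrow>\<^sub>C real" and w
      have "(ruelle (\<phi> x) g - ruelle (\<phi> x0) g) w =
         (\<Sum>a\<in>UNIV. g (case_nat a w) * (exp (\<phi> x (case_nat a w)) - exp (\<phi> x0 (case_nat a w))))"
        by (simp add: minus_bcontfun.rep_eq ruelle_apply_sum right_diff_distrib sum_subtractf)
      also have "norm \<dots> \<le> (\<Sum>a\<in>(UNIV::'l set). norm g * (e / k))"
        unfolding real_norm_def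
      proof (rule order_trans[OF sum_abs sum_mono])
        fix a
        show "\<bar>g (case_nat a w) * (exp (\<phi> x (case_nat a w)) - exp (\<phi> x0 (case_nat a w)))\<bar> \<le> norm g * (e / k)"
          unfolding abs_mult using norm_bounded[of g "case_nat a w"] x by (intro mult_mono) auto
      qed
      also have "\<dots> = e * norm g" using k by (simp add: k_def)
      finally show "norm ((ruelle (\<phi> x) g - ruelle (\<phi> x0) g) w) \<le> e * norm g" .
    qed
  qed
qed

section \<open>The invariant bundle and its spectrum\<close>

text \<open>
  The number \<open>N\<close> of levels is chosen first, so that \<open>T ^ N\<close> makes all relevant functions almost
  constant, and then the word length \<open>n\<close>, so that \<open>N\<close> approximations by functions of \<open>n\<close>
  coordinates remain small.
\<close>

lemma bundle_parameters:
  assumes e: "0 < \<epsilon>"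
  shows "\<exists>N>0. \<exists>n>0. \<forall>a0 d \<xi> z x g.
     cylinder_family n a0 d \<xi> z \<longrightarrow> (\<forall>w. \<bar>g w\<bar> \<le> 1) \<longrightarrow> holder_bound r 1 g \<longrightarrow>
       (\<exists>c. \<forall>w. \<bar>g w - h x w * comb \<xi> d N c x w\<bar> \<le> \<epsilon>)"
proof -
  obtain \<delta> D where P: "0 < \<delta>" "\<And>x. markov_weight r \<delta> D (P x)" by (rule P_weight) blast
  obtain C where C: "\<And>x. holder_bound r C (h x)" by (rule h_bound) blast
  obtain \<eta> H where h: "0 < \<eta>" "0 < H" "\<And>x w. \<eta> \<le> h x w" "\<And>x w. h x w \<le> H"
    by (rule h_bounds) blast
  have D0: "0 \<le> D" using P(2) by (meson holder_bound_nonneg markov_weight_def)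
  define c where "c = 1 * (1 / \<eta>) + 1 * (C / \<eta>\<^sup>2)"
  \<comment> \<open>At least the Hoelder constant \<open>c\<close> of \<open>u\<close> below, and large enough for the Lasota--Yorke inequality to preserve it.\<close>
  define b where "b = max c (c * (real CARD('l) * D) / (1 - r))"
  have c0: "0 < c" using h holder_bound_nonneg[OF C] by (simp add: c_def add_pos_nonneg)
  have b0: "0 < b" using c0 by (simp add: b_def)
  have "c * (real CARD('l) * D) / (1 - r) \<le> b" by (simp add: b_def)
  hence b: "r * b + c * (real CARD('l) * D) \<le> b" using r by (simp add: field_simps)
  define e' where "e' = \<epsilon> / (2 * H)"
  have e': "0 < e'" using e h by (simp add: e'_def)
  obtain N0 where N0: "\<And>n x u. N0 \<le> n \<Longrightarrow> osc_bound c u \<Longrightarrow> holder_bound r b u \<Longrightarrow>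
     osc_bound e' (cocycle f T n x u)"
    using uniform_mixing[where p = P and f = f, OF r P e'] by metis
  define N where "N = Suc N0"
  obtain n0 where n0: "r ^ n0 < e' / (real N * (4 * b))"
    using real_arch_pow_inv[of "e' / (real N * (4 * b))" r] e' b0 r by (auto simp: N_def)
  define n where "n = Suc n0"
  have "r ^ n \<le> r ^ n0" using r by (simp add: n_def power_decreasing mult_left_le_one_le)
  hence "r ^ n \<le> e' / (real N * (4 * b))" using n0 by simp
  hence small: "real N * (4 * (b * r ^ n)) \<le> e'"
  proof -
    have q: "0 < real N * (4 * b)" using b0 by (simp add: N_def)
    have "r ^ n * (real N * (4 * b)) \<le> e'"
      using \<open>r ^ n \<le> e' / (real N * (4 * b))\<close> by (simp only: pos_le_divide_eq[OF q])
    moreover have "r ^ n * (real N * (4 * b)) = real N * (4 * (b * r ^ n))" by simp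
    ultimately show ?thesis by simp
  qed
  show ?thesis
  proof (rule exI[of _ N], rule conjI[rotated], rule exI[of _ n], intro conjI allI impI)
    fix a0 d \<xi> z x and g :: "(nat \<Rightarrow> 'l) \<Rightarrow> real"
    assume fam: "cylinder_family n a0 d \<xi> z" and "\<forall>w. \<bar>g w\<bar> \<le> 1" and g: "holder_bound r 1 g"
    hence g1: "\<And>w. \<bar>g w\<bar> \<le> 1" by blast
    define u where "u = (\<lambda>w. g w * (1 / h x w))"
    have inv_abs: "\<bar>1 / h x w\<bar> \<le> 1 / \<eta>" for w
      using h(1) h(3)[of x w] h_pos[of x w] by (simp add: frac_le)
    have uc: "holder_bound r c u"
      unfolding u_def c_def
      by (rule holder_bound_mult[OF r(1) g g1 holder_bound_inverse[OF C h(1,3)] inv_abs])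
    have u: "osc_bound c u" "holder_bound r b u"
      using uc holder_bound_osc holder_bound_mono[OF uc _ r(1), of b] by (auto simp: b_def)
    obtain cf where cf: "\<And>w. \<bar>u w - comb \<xi> d N cf x w\<bar> \<le> real N * (4 * (b * r ^ n)) + e'"
      using comb_approx[OF fam P b u N0[OF _ u, of N x]] by (auto simp: N_def)
    have "\<bar>g w - h x w * comb \<xi> d N cf x w\<bar> \<le> \<epsilon>" for w
    proof -
      have "g w - h x w * comb \<xi> d N cf x w = h x w * (u w - comb \<xi> d N cf x w)"
        by (simp add: u_def right_diff_distrib nonzero)
      hence "\<bar>g w - h x w * comb \<xi> d N cf x w\<bar> = h x w * \<bar>u w - comb \<xi> d N cf x w\<bar>"
        using h_pos[of x w] by (simp add: abs_mult)
      also have "\<dots> \<le> H * (2 * e')"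
        using cf[of w] small h(2) h(4)[of x w] h_pos[of x w] by (intro mult_mono) auto
      also have "\<dots> = \<epsilon>" using h by (simp add: e'_def)
      finally show ?thesis .
    qed
    thus "\<exists>c. \<forall>w. \<bar>g w - h x w * comb \<xi> d N c x w\<bar> \<le> \<epsilon>" by blast
  qed (simp_all add: N_def n_def)
qed

context
  fixes n d N :: nat and a0 :: 'l and \<xi> :: "nat \<Rightarrow> (nat \<Rightarrow> 'l) \<Rightarrow> real" and z :: "nat \<Rightarrow> nat \<Rightarrow> 'l"
  assumes fam: "cylinder_family n a0 d \<xi> z" and N: "0 < N" and d: "0 < d"
begin

text \<open>
  Multiplication by \<open>h x\<close> undoes the normalisation: combinations of the frame are \<open>h x\<close> times
  elements of the bundle on which \<open>T\<close> acts, and \<open>h x\<close> itself is the last vector of the frame.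
\<close>

definition frame :: "nat \<Rightarrow> 'm \<Rightarrow> (nat \<Rightarrow> 'l) \<Rightarrow>\<^sub>C real" where
  "frame i x = Bcontfun (\<lambda>w. h x w * bundle_fun \<xi> d N i x w)"

definition section_of :: "(nat \<Rightarrow> real) \<Rightarrow> 'm \<Rightarrow> (nat \<Rightarrow> 'l) \<Rightarrow>\<^sub>C real" where
  "section_of c x = (\<Sum>i<Suc (N * d). c i *\<^sub>R frame i x)"

lemma frame: "apply_bcontfun (frame i x) = (\<lambda>w. h x w * bundle_fun \<xi> d N i x w)"
  "frame i x \<in> holder_space r"
proof -
  obtain C where C: "holder_bound r C (h x)" by (rule h_bound) blast
  obtain C' where C': "holder_bound r C' (bundle_fun \<xi> d N i x)"
    using bundle_fun_holder[of d \<xi> N i x] fam unfolding cylinder_family_def by blast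
  have bnd: "\<bar>g w\<bar> \<le> \<bar>g undefined\<bar> + C" if "holder_bound r C g" for C w and g :: "(nat \<Rightarrow> 'l) \<Rightarrow> real"
    using osc_boundD[OF holder_bound_osc[OF that], of w undefined] by linarith
  from holder_bound_mult[OF r(1) C bnd[OF C] C' bnd[OF C']] apply_Bcontfun_holder[OF r]
  show "apply_bcontfun (frame i x) = (\<lambda>w. h x w * bundle_fun \<xi> d N i x w)"
    "frame i x \<in> holder_space r" unfolding frame_def by blast+
qed

lemma frame_cont: "continuous_on UNIV (frame i)"
proof (rule continuous_on_bcontfun)
  have "jointly_continuous (\<lambda>x w. h x w * bundle_fun \<xi> d N i x w)"
    using fam by (intro jointly_continuous_mult h_joint bundle_fun_joint) (simp add: cylinder_family_def)
  thus "jointly_continuous (\<lambda>x. apply_bcontfun (frame i x))" by (simp add: frame)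
qed

lemma section_of: "apply_bcontfun (section_of c x) = (\<lambda>w. h x w * comb \<xi> d N c x w)"
proof
  fix w
  show "apply_bcontfun (section_of c x) w = h x w * comb \<xi> d N c x w"
    unfolding section_of_def comb_def apply_bcontfun_sum[OF finite_lessThan] sum_distrib_left
    by (intro sum.cong refl) (simp add: scaleR_bcontfun.rep_eq frame mult.left_commute)
qed

lemma section_of_eq_0:
  assumes "section_of c x = 0"
  shows "\<forall>i<Suc (N * d). c i = 0"
proof (rule comb_eq_zero[OF fam])
  show "comb \<xi> d N c x = (\<lambda>_. 0)"
  proof
    fix w
    have "h x w * comb \<xi> d N c x w = 0"
      using fun_cong[OF section_of[of c x], of w] assms by (simp add: zero_bcontfun.rep_eq)
    thus "comb \<xi> d N c x w = 0" by (simp add: nonzero)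
  qed
qed

lemma section_of_holder: "section_of c x \<in> holder_space r"
proof -
  have add: "g + g' \<in> holder_space r" if mem: "g \<in> holder_space r" "g' \<in> holder_space r" for g g' :: "(nat \<Rightarrow> 'l) \<Rightarrow>\<^sub>C real"
  proof -
    obtain C C' where "holder_bound r C (apply_bcontfun g)" "holder_bound r C' (apply_bcontfun g')"
      using mem[unfolded holder_space_iff] by (elim exE)
    from holder_bound_add[OF this] show ?thesis
      unfolding holder_space_iff plus_bcontfun.rep_eq by (rule exI)
  qed
  have scale: "k *\<^sub>R g \<in> holder_space r" if mem: "g \<in> holder_space r" for k and g :: "(nat \<Rightarrow> 'l) \<Rightarrow>\<^sub>C real"
  proof -
    obtain C where "holder_bound r C (apply_bcontfun g)"
      using mem[unfolded holder_space_iff] by (rule exE)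
    from holder_bound_cmult[OF this, of k] show ?thesis
      unfolding holder_space_iff scaleR_bcontfun.rep_eq real_scaleR_def by (rule exI)
  qed
  have zero: "(0 :: (nat \<Rightarrow> 'l) \<Rightarrow>\<^sub>C real) \<in> holder_space r"
    using scale[OF h_holder, of 0] by simp
  have "(\<Sum>i\<in>I. c i *\<^sub>R frame i x) \<in> holder_space r" if "finite I" for I
    using that by (induction I rule: finite_induct) (simp_all add: zero add scale frame(2))
  from this[OF finite_lessThan] show ?thesis unfolding section_of_def .
qed

lemma section_of_last: "section_of (\<lambda>i. if i = N * d then t else 0) x = t *\<^sub>R h x"
proof (rule bcontfun_eqI)
  fix w
  have "comb \<xi> d N (\<lambda>i. if i = N * d then t else 0) x w = t"
    unfolding comb_def by (simp add: bundle_fun_last if_distrib[of "\<lambda>t. t * _"] cong: if_cong)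
  thus "section_of (\<lambda>i. if i = N * d then t else 0) x w = (t *\<^sub>R h x) w"
    by (simp add: section_of scaleR_bcontfun.rep_eq)
qed

lemma section_of_add: "section_of c x + section_of c' x = section_of (\<lambda>i. c i + c' i) x"
  by (simp add: section_of_def scaleR_left_distrib sum.distrib)

lemma section_of_scale: "k *\<^sub>R section_of c x = section_of (\<lambda>i. k * c i) x"
  by (simp add: section_of_def scaleR_sum_right scaleR_right_distrib)

lemma ruelle_section_of:
  "\<exists>c'. ruelle (\<phi> x) (section_of c x) = section_of c' (f x) \<and> c' (N * d) = \<rho> x * c (N * d)"
proof -
  obtain c' where c': "T x (comb \<xi> d N c x) = comb \<xi> d N c' (f x)" "c' (N * d) = c (N * d)"
    using T_comb by blast
  have "ruelle (\<phi> x) (section_of c x) = \<rho> x *\<^sub>R section_of c' (f x)"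
  proof (rule bcontfun_eqI)
    fix w
    show "ruelle (\<phi> x) (section_of c x) w = (\<rho> x *\<^sub>R section_of c' (f x)) w"
      unfolding ruelle_apply section_of ruelle_conjugate c'(1)
      by (simp add: scaleR_bcontfun.rep_eq section_of)
  qed
  thus ?thesis unfolding section_of_scale using c'(2) by (intro exI[of _ "\<lambda>i. \<rho> x * c' i"]) simp
qed

text \<open>
  The nilpotency that yields both the exponent \<open>-\<infinity>\<close> and the domination: after \<open>N\<close> steps only
  the coefficient of \<open>h x\<close> is left.
\<close>

lemma cocycle_section_of:
  assumes "N \<le> k"
  shows "cocycle f (\<lambda>x. ruelle (\<phi> x)) k x (section_of c x) =
     (cocycle_prod f \<rho> k x * c (N * d)) *\<^sub>R h ((f ^^ k) x)"
proof (rule bcontfun_eqI)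
  fix w
  have const: "cocycle f T j y (\<lambda>_. t) = (\<lambda>_. t)" for j y t
    by (induction j) (simp_all add: T_const)
  have "cocycle f T k x (comb \<xi> d N c x) = (\<lambda>_. c (N * d))"
    using cocycle_add[of f T N "k - N" x "comb \<xi> d N c x"] assms by (simp add: T_iter_comb const)
  thus "cocycle f (\<lambda>x. ruelle (\<phi> x)) k x (section_of c x) w =
     ((cocycle_prod f \<rho> k x * c (N * d)) *\<^sub>R h ((f ^^ k) x)) w"
    by (simp add: apply_cocycle_ruelle section_of ruelle_conjugate_iter scaleR_bcontfun.rep_eq)
qed

definition W :: "'m \<Rightarrow> ((nat \<Rightarrow> 'l) \<Rightarrow>\<^sub>C real) set" where
  "W x = range (\<lambda>c. section_of c x)"

text \<open>
  The complement of the line spanned by \<open>h x\<close>: the coefficient with index \<open>N * d\<close> is that of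
  \<open>h x\<close>.
\<close>

definition F :: "'m \<Rightarrow> ((nat \<Rightarrow> 'l) \<Rightarrow>\<^sub>C real) set" where
  "F x = (\<lambda>c. section_of c x) ` {c. c (N * d) = 0}"

lemma W_frame:
  "inj_on (\<lambda>i. frame i x) {..<Suc (N * d)}" "independent ((\<lambda>i. frame i x) ` {..<Suc (N * d)})"
  "span ((\<lambda>i. frame i x) ` {..<Suc (N * d)}) = W x"
  using independent_family[where m = "Suc (N * d)" and e = "\<lambda>i. frame i x"] section_of_eq_0[of _ x]
  unfolding W_def section_of_def by auto

lemma F_dim: "dim (F x) = N * d"
proof -
  have eq: "section_of c x = (\<Sum>i<N * d. c i *\<^sub>R frame i x)" if "c (N * d) = 0" for c
    using that by (simp add: section_of_def)
  have "F x = range (\<lambda>c. \<Sum>i<N * d. c i *\<^sub>R frame i x)"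
  proof (intro set_eqI iffI)
    fix v assume "v \<in> F x" thus "v \<in> range (\<lambda>c. \<Sum>i<N * d. c i *\<^sub>R frame i x)" using eq by (auto simp: F_def)
  next
    fix v assume "v \<in> range (\<lambda>c. \<Sum>i<N * d. c i *\<^sub>R frame i x)"
    then obtain c where "v = (\<Sum>i<N * d. c i *\<^sub>R frame i x)" by blast
    hence "v = section_of (\<lambda>i. if i = N * d then 0 else c i) x"
      by (simp add: section_of_def)
    thus "v \<in> F x" by (auto simp: F_def)
  qed
  also have "dim \<dots> = N * d"
  proof (rule independent_family(4))
    fix c :: "nat \<Rightarrow> real" assume c: "(\<Sum>i<N * d. c i *\<^sub>R frame i x) = 0"
    have "section_of (\<lambda>i. if i = N * d then 0 else c i) x = 0"
      using c by (simp add: section_of_def)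
    note zero = section_of_eq_0[OF this, rule_format]
    show "\<forall>i<N * d. c i = 0"
    proof (intro allI impI)
      fix i assume "i < N * d" thus "c i = 0" using zero[of i] by simp
    qed
  qed
  finally show ?thesis .
qed

lemma F_subspace: "subspace (F x)"
proof (rule subspaceI)
  show "0 \<in> F x" unfolding F_def by (rule image_eqI[of _ _ "\<lambda>_. 0"]) (simp_all add: section_of_def)
  show "v + w \<in> F x" if vw: "v \<in> F x" "w \<in> F x" for v w
  proof -
    obtain c c' where "v = section_of c x" "w = section_of c' x" "c (N * d) = 0" "c' (N * d) = 0"
      using vw by (auto simp: F_def)
    thus ?thesis by (auto simp: F_def section_of_add)
  qed
  show "k *\<^sub>R v \<in> F x" if "v \<in> F x" for k v
    using that by (auto simp: F_def section_of_scale)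
qed

definition L :: "'m \<Rightarrow> ((nat \<Rightarrow> 'l) \<Rightarrow>\<^sub>C real) set" where
  "L x = {t *\<^sub>R h x | t. t \<in> UNIV}"

lemma h_ne_0: "h x \<noteq> 0"
  using nonzero(1)[of x undefined] by (auto simp: zero_bcontfun.rep_eq)

lemma L_span: "L x = span {h x}"
  by (auto simp: L_def span_singleton)

lemma L_dim: "dim (L x) = 1"
  unfolding L_span dim_span using h_ne_0 by (simp add: dim_eq_card_independent)

lemma W_decomposition:
  "section_of c x = c (N * d) *\<^sub>R h x + section_of (\<lambda>i. if i = N * d then 0 else c i) x"
proof -
  have "(\<lambda>i. (if i = N * d then c (N * d) else 0) + (if i = N * d then 0 else c i)) = c" by auto
  thus ?thesis unfolding section_of_last[symmetric] section_of_add by simp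
qed

lemma direct_sum:
  "direct_sum_decomp (W x) {..<2} (\<lambda>i. if i = 0 then L x else F x)"
proof -
  have two: "{..<2::nat} = {0, 1}" by auto
  have "W x = {(\<Sum>i\<in>{0, 1::nat}. v i) | v. \<forall>i\<in>{0, 1}. v i \<in> (if i = 0 then L x else F x)}"
  proof (intro set_eqI iffI)
    fix v assume "v \<in> W x"
    then obtain c where v: "v = section_of c x" by (auto simp: W_def)
    show "v \<in> {(\<Sum>i\<in>{0, 1::nat}. v i) | v. \<forall>i\<in>{0, 1}. v i \<in> (if i = 0 then L x else F x)}"
      using W_decomposition[of c x] unfolding v mem_Collect_eq
      by (intro exI[of _ "\<lambda>i. if i = 0 then c (N * d) *\<^sub>R h x else section_of (\<lambda>i. if i = N * d then 0 else c i) x"])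
        (auto simp: L_def F_def)
  next
    fix v assume "v \<in> {(\<Sum>i\<in>{0, 1::nat}. v i) | v. \<forall>i\<in>{0, 1}. v i \<in> (if i = 0 then L x else F x)}"
    then obtain t c where "v = t *\<^sub>R h x + section_of c x" by (auto simp: L_def F_def)
    thus "v \<in> W x" by (auto simp: W_def section_of_add section_of_last[symmetric])
  qed
  moreover have "v 0 = 0 \<and> v 1 = 0" if v: "v 0 \<in> L x" "v 1 \<in> F x" "v 0 + v 1 = 0" for v :: "nat \<Rightarrow> _"
  proof -
    obtain t c where tc: "v 0 = t *\<^sub>R h x" "v 1 = section_of c x" "c (N * d) = 0"
      using v by (auto simp: L_def F_def)
    have "section_of (\<lambda>i. (if i = N * d then t else 0) + c i) x = 0"
      using v(3) unfolding tc by (simp add: section_of_last[symmetric] section_of_add)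
    from section_of_eq_0[OF this, rule_format, of "N * d"] tc have "t = 0" by simp
    thus ?thesis using v(3) tc by simp
  qed
  ultimately show ?thesis
    unfolding direct_sum_decomp_def subspace_sum_def two
    using F_subspace L_span by (auto simp: subspace_span)
qed

lemma L_nontrivial: "L x \<noteq> {0}"
proof -
  have "1 *\<^sub>R h x \<in> L x" unfolding L_def by blast
  thus ?thesis using h_ne_0 by auto
qed

lemma F_nontrivial: "F x \<noteq> {0}"
proof
  assume "F x = {0}"
  moreover have "dim {0 :: (nat \<Rightarrow> 'l) \<Rightarrow>\<^sub>C real} = 0"
    using dim_span[of "{} :: ((nat \<Rightarrow> 'l) \<Rightarrow>\<^sub>C real) set"]
      dim_eq_card_independent[OF independent_empty, where 'a = "(nat \<Rightarrow> 'l) \<Rightarrow>\<^sub>C real"] by simp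
  ultimately have "dim (F x) = 0" by simp
  thus False using F_dim N d by simp
qed

lemma ruelle_h_scale: "ruelle (\<phi> x) (t *\<^sub>R h x) = (t * \<rho> x) *\<^sub>R h (f x)"
  by (simp add: ruelle_scaleR eigen)

lemma ruelle_L: "ruelle (\<phi> x) ` L x = L (f x)"
proof (intro set_eqI iffI)
  fix v assume "v \<in> ruelle (\<phi> x) ` L x"
  thus "v \<in> L (f x)" by (auto simp: L_def ruelle_h_scale)
next
  fix v assume "v \<in> L (f x)"
  then obtain t where "v = t *\<^sub>R h (f x)" by (auto simp: L_def)
  hence "v = ruelle (\<phi> x) ((t / \<rho> x) *\<^sub>R h x)" by (simp add: ruelle_h_scale nonzero)
  moreover have "(t / \<rho> x) *\<^sub>R h x \<in> L x" unfolding L_def by blast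
  ultimately show "v \<in> ruelle (\<phi> x) ` L x" by (rule image_eqI)
qed

lemma ruelle_F: "ruelle (\<phi> x) ` F x \<subseteq> F (f x)"
proof
  fix v assume "v \<in> ruelle (\<phi> x) ` F x"
  then obtain c where "v = ruelle (\<phi> x) (section_of c x)" "c (N * d) = 0" by (auto simp: F_def)
  thus "v \<in> F (f x)" using ruelle_section_of[of x c] by (auto simp: F_def)
qed

lemma ruelle_W: "ruelle (\<phi> x) ` W x \<subseteq> W (f x)"
  using ruelle_section_of[of x] by (fastforce simp: W_def)

lemma growth_F:
  assumes "c (N * d) = 0"
  shows "growth f (\<lambda>x. ruelle (\<phi> x)) x (section_of c x) \<longlonglongrightarrow> -\<infinity>"
proof (rule tendsto_eventually)
  show "eventually (\<lambda>k. growth f (\<lambda>x. ruelle (\<phi> x)) x (section_of c x) k = -\<infinity>) sequentially"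
    using eventually_ge_at_top[of N]
  proof eventually_elim
    fix k assume k: "N \<le> k"
    thus "growth f (\<lambda>x. ruelle (\<phi> x)) x (section_of c x) k = -\<infinity>"
      using assms N by (simp add: growth_def cocycle_section_of log_ereal_def)
  qed
qed

lemma norm_h_bounds: obtains \<eta> H where "0 < \<eta>" "\<And>x. \<eta> \<le> norm (h x)" "\<And>x. norm (h x) \<le> H"
proof -
  obtain \<eta> H where h: "0 < \<eta>" "0 < H" "\<And>x w. \<eta> \<le> h x w" "\<And>x w. h x w \<le> H"
    by (rule h_bounds) blast
  have "\<eta> \<le> norm (h x)" for x
    using norm_bounded[of "h x" undefined] h(3)[of x undefined] by simp
  moreover have "norm (h x) \<le> H" for x
    using h(4)[of x] h_pos[of x] by (intro norm_bound) (simp add: abs_of_pos)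
  ultimately show ?thesis using that h(1) by blast
qed

lemma growth_eq:
  assumes c: "c (N * d) \<noteq> 0" and k: "N \<le> k"
  shows "growth f (\<lambda>x. ruelle (\<phi> x)) x (section_of c x) k =
    ereal (birkhoff_sum f (\<lambda>x. ln (\<rho> x)) k x / real k + ln (\<bar>c (N * d)\<bar> * norm (h ((f ^^ k) x))) / real k)"
proof -
  have pos: "0 < cocycle_prod f \<rho> k x" by (rule cocycle_prod_pos)
  have hpos: "0 < norm (h ((f ^^ k) x))" using h_ne_0 by simp
  have ln_prod: "ln (cocycle_prod f \<rho> k x) = birkhoff_sum f (\<lambda>x. ln (\<rho> x)) k x"
    unfolding cocycle_prod_def birkhoff_sum_def by (intro ln_prod) (simp_all add: nonzero \<rho>_pos)
  have "norm (cocycle f (\<lambda>x. ruelle (\<phi> x)) k x (section_of c x)) =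
     cocycle_prod f \<rho> k x * (\<bar>c (N * d)\<bar> * norm (h ((f ^^ k) x)))"
    using pos by (simp add: cocycle_section_of[OF k] abs_mult)
  moreover have "ln (cocycle_prod f \<rho> k x * (\<bar>c (N * d)\<bar> * norm (h ((f ^^ k) x)))) =
     birkhoff_sum f (\<lambda>x. ln (\<rho> x)) k x + ln (\<bar>c (N * d)\<bar> * norm (h ((f ^^ k) x)))"
    using pos hpos c by (simp add: ln_mult ln_prod)
  moreover have "0 < cocycle_prod f \<rho> k x * (\<bar>c (N * d)\<bar> * norm (h ((f ^^ k) x)))"
    using pos hpos c by simp
  ultimately show ?thesis
    by (simp add: growth_def log_ereal_def not_le[symmetric] add_divide_distrib)
qed

lemma ln_norm_bounded:
  assumes "c \<noteq> 0"
  obtains K where "\<And>x. \<bar>ln (\<bar>c\<bar> * norm (h x))\<bar> \<le> K"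
proof -
  obtain \<eta> H where h: "0 < \<eta>" "\<And>x. \<eta> \<le> norm (h x)" "\<And>x. norm (h x) \<le> H"
    by (rule norm_h_bounds) blast
  have "\<bar>ln (\<bar>c\<bar> * norm (h x))\<bar> \<le> \<bar>ln (\<bar>c\<bar> * \<eta>)\<bar> + \<bar>ln (\<bar>c\<bar> * H)\<bar>" for x
  proof -
    have p: "0 < norm (h x)" using h(1) h(2)[of x] by linarith
    have "ln (\<bar>c\<bar> * \<eta>) \<le> ln (\<bar>c\<bar> * norm (h x))"
      using assms h(1) h(2)[of x] p by (intro ln_mono mult_left_mono) auto
    moreover have "ln (\<bar>c\<bar> * norm (h x)) \<le> ln (\<bar>c\<bar> * H)"
      using assms h(3)[of x] p by (intro ln_mono mult_left_mono) auto
    ultimately show ?thesis by linarith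
  qed
  thus ?thesis using that by blast
qed

lemma growth_L:
  assumes c: "c (N * d) \<noteq> 0"
    and birk: "(\<lambda>k. birkhoff_sum f (\<lambda>x. ln (\<rho> x)) k x / real k) \<longlonglongrightarrow> I"
  shows "growth f (\<lambda>x. ruelle (\<phi> x)) x (section_of c x) \<longlonglongrightarrow> ereal I"
proof -
  obtain K where K: "\<And>x. \<bar>ln (\<bar>c (N * d)\<bar> * norm (h x))\<bar> \<le> K" by (rule ln_norm_bounded[OF c]) blast
  have "(\<lambda>k. ln (\<bar>c (N * d)\<bar> * norm (h ((f ^^ k) x))) / real k) \<longlonglongrightarrow> 0"
  proof (rule Lim_null_comparison)
    show "eventually (\<lambda>k. norm (ln (\<bar>c (N * d)\<bar> * norm (h ((f ^^ k) x))) / real k) \<le> K / real k) sequentially"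
      using K by (intro always_eventually allI) (simp add: divide_right_mono)
    show "(\<lambda>k. K / real k) \<longlonglongrightarrow> 0" by (rule lim_const_over_n)
  qed
  from tendsto_add[OF birk this]
  have "(\<lambda>k. ereal (birkhoff_sum f (\<lambda>x. ln (\<rho> x)) k x / real k +
     ln (\<bar>c (N * d)\<bar> * norm (h ((f ^^ k) x))) / real k)) \<longlonglongrightarrow> ereal I" by simp
  moreover have "eventually (\<lambda>k. growth f (\<lambda>x. ruelle (\<phi> x)) x (section_of c x) k =
    ereal (birkhoff_sum f (\<lambda>x. ln (\<rho> x)) k x / real k +
     ln (\<bar>c (N * d)\<bar> * norm (h ((f ^^ k) x))) / real k)) sequentially"
    using eventually_ge_at_top[of N] by eventually_elim (rule growth_eq[where c = c, OF c])
  ultimately show ?thesis by (simp add: tendsto_cong)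
qed

lemma ln_\<rho>_bounded: obtains K where "\<And>x. \<bar>ln (\<rho> x)\<bar> \<le> K"
proof -
  obtain B C0 where B: "0 < B" "\<And>x w. \<bar>\<phi> x w\<bar> \<le> B" by (rule \<phi>_bounds) blast
  define a b where "a = real CARD('l) * exp (- B)" and "b = real CARD('l) * exp B"
  have ab: "a \<le> \<rho> x" "\<rho> x \<le> b" for x unfolding a_def b_def by (intro \<rho>_bounds B)+
  have "0 < a" by (simp add: a_def)
  have "\<bar>ln (\<rho> x)\<bar> \<le> \<bar>ln a\<bar> + \<bar>ln b\<bar>" for x
    using ln_mono[OF ab(1)[of x] \<open>0 < a\<close>] ln_mono[OF ab(2)[of x] \<rho>_pos] by linarith
  thus ?thesis using that by blast
qed

text \<open>
  Along a vector with a nonzero component in the direction of \<open>h x\<close>, the growth rates stay bounded below over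
  every point of the base, because \<open>ln \<rho>\<close> and \<open>ln (norm (h x))\<close> are bounded.
\<close>

lemma minus_infinity_F: "minus_infinity_space f (\<lambda>x. ruelle (\<phi> x)) W x \<subseteq> F x"
proof
  fix v assume v: "v \<in> minus_infinity_space f (\<lambda>x. ruelle (\<phi> x)) W x"
  then obtain c where c: "v = section_of c x" by (auto simp: minus_infinity_space_def W_def)
  have lim: "growth f (\<lambda>x. ruelle (\<phi> x)) x v \<longlonglongrightarrow> -\<infinity>"
    using v by (simp add: minus_infinity_space_def)
  have "c (N * d) = 0"
  proof (rule ccontr)
    assume c0: "c (N * d) \<noteq> 0"
    obtain K where K: "\<And>x. \<bar>ln (\<bar>c (N * d)\<bar> * norm (h x))\<bar> \<le> K" by (rule ln_norm_bounded[OF c0]) blast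
    obtain K' where K': "\<And>x. \<bar>ln (\<rho> x)\<bar> \<le> K'" by (rule ln_\<rho>_bounded) blast
    have "eventually (\<lambda>k. growth f (\<lambda>x. ruelle (\<phi> x)) x v k < ereal (- (K' + K))) sequentially"
      using order_tendstoD(2)[OF lim, of "ereal (- (K' + K))"] by simp
    then obtain k0 where k0: "\<And>k. k0 \<le> k \<Longrightarrow> growth f (\<lambda>x. ruelle (\<phi> x)) x v k < ereal (- (K' + K))"
      unfolding eventually_sequentially by blast
    define k where "k = max k0 N"
    have k: "k0 \<le> k" "N \<le> k" "0 < real k" using N by (auto simp: k_def)
    have "\<bar>birkhoff_sum f (\<lambda>x. ln (\<rho> x)) k x\<bar> \<le> (\<Sum>i<k. K')"
      unfolding birkhoff_sum_def by (rule order_trans[OF sum_abs sum_mono]) (rule K')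
    hence "- (K' * real k) \<le> birkhoff_sum f (\<lambda>x. ln (\<rho> x)) k x" by (simp add: mult.commute)
    hence 1: "- K' \<le> birkhoff_sum f (\<lambda>x. ln (\<rho> x)) k x / real k"
      using k by (simp add: pos_le_divide_eq)
    have K0: "0 \<le> K" using K[of x] by linarith
    have "K * 1 \<le> K * real k" using k K0 by (intro mult_left_mono) auto
    hence "- K * real k \<le> ln (\<bar>c (N * d)\<bar> * norm (h ((f ^^ k) x)))"
      using K[of "(f ^^ k) x"] by linarith
    hence 2: "- K \<le> ln (\<bar>c (N * d)\<bar> * norm (h ((f ^^ k) x))) / real k"
      using k by (simp add: pos_le_divide_eq)
    show False using k0[OF k(1)] 1 2 unfolding c growth_eq[where c = c, OF c0 k(2)] by simp
  qed
  thus "v \<in> F x" using c by (auto simp: F_def)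
qed

text \<open>
  The \<open>N\<close>-th iterate vanishes on \<open>F x\<close> and is injective on the line spanned by \<open>h x\<close>.
\<close>

lemma W_dominated: "dominated f (\<lambda>x. ruelle (\<phi> x)) W UNIV L F"
proof -
  let ?A = "\<lambda>x. ruelle (\<phi> x)"
  have "invariant_splitting f ?A W UNIV 2 (\<lambda>i. if i = 0 then L else F)"
  proof -
    have "(\<lambda>i::nat. (if i = 0 then L else F) x) = (\<lambda>i. if i = 0 then L x else F x)" for x
      by (intro ext) simp
    moreover have "f ` UNIV = UNIV" using homeo by (simp add: homeomorphism_def)
    ultimately show ?thesis
      unfolding invariant_splitting_def
      using direct_sum L_nontrivial F_nontrivial ruelle_L ruelle_F L_dim F_dim by auto
  qed
  moreover have "inj_on (cocycle f ?A N x) (L x)" for x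
  proof (rule inj_onI)
    fix v w assume "v \<in> L x" "w \<in> L x" and eq: "cocycle f ?A N x v = cocycle f ?A N x w"
    then obtain s t where st: "v = s *\<^sub>R h x" "w = t *\<^sub>R h x" by (auto simp: L_def)
    have scale: "cocycle f ?A N x (t *\<^sub>R h x) = (cocycle_prod f \<rho> N x * t) *\<^sub>R h ((f ^^ N) x)" for t
      using cocycle_section_of[OF order_refl, where c = "\<lambda>i. if i = N * d then t else 0" and x = x]
      unfolding section_of_last by simp
    have "(cocycle_prod f \<rho> N x * s) *\<^sub>R h ((f ^^ N) x) = (cocycle_prod f \<rho> N x * t) *\<^sub>R h ((f ^^ N) x)"
      using eq unfolding st scale .
    thus "v = w" unfolding st using h_ne_0 nonzero(3) by simp
  qed
  moreover have "norm_on (cocycle f ?A N x) (F x) = 0" for x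
  proof -
    have "{norm (cocycle f ?A N x v) | v. v \<in> F x \<and> norm v \<le> 1} = {0}"
    proof (intro set_eqI iffI)
      fix t assume "t \<in> {norm (cocycle f ?A N x v) | v. v \<in> F x \<and> norm v \<le> 1}"
      thus "t \<in> {0}" by (auto simp: F_def cocycle_section_of)
    next
      fix t :: real assume "t \<in> {0}"
      moreover have "0 \<in> F x" using F_subspace subspace_0 by blast
      moreover have "cocycle f ?A N x v = 0" if "v \<in> F x" for v
        using that by (auto simp: F_def cocycle_section_of)
      ultimately show "t \<in> {norm (cocycle f ?A N x v) | v. v \<in> F x \<and> norm v \<le> 1}"
        by (auto intro!: exI[of _ 0])
    qed
    thus ?thesis by (simp add: norm_on_def)
  qed
  ultimately have "k_dominated N f ?A W UNIV L F"
    unfolding k_dominated_def using minus_infinity_F by simp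
  thus ?thesis unfolding dominated_def using N by (intro exI[of _ N]) simp
qed

lemma W_oseledets:
  assumes erg: "ergodic_for f \<mu>"
  defines "lam \<equiv> \<lambda>i::nat. if i = 0 then ereal (\<integral>x. ln (\<rho> x) \<partial>\<mu>) else -\<infinity>"
    and "E \<equiv> \<lambda>(i::nat) x. if i = 0 then L x else F x"
  shows "oseledets f \<mu> (\<lambda>x. ruelle (\<phi> x)) W 2 lam E"
    "integrable \<mu> (\<lambda>x. ln (\<rho> x))"
    "AE x in \<mu>. F x = slow_space f (\<lambda>x. ruelle (\<phi> x)) W (lam 0) x"
proof -
  let ?A = "\<lambda>x. ruelle (\<phi> x)"
  interpret prob_space \<mu> using erg by (simp add: ergodic_for_def)
  obtain K where K: "\<And>x. \<bar>ln (\<rho> x)\<bar> \<le> K" by (rule ln_\<rho>_bounded) blast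
  have "continuous_on UNIV (\<lambda>x. ln (\<rho> x))"
    by (intro continuous_on_ln \<rho>_cont) (simp add: nonzero)
  hence meas: "(\<lambda>x. ln (\<rho> x)) \<in> borel_measurable \<mu>"
    using erg borel_measurable_continuous_onI
    by (auto simp: ergodic_for_def cong: measurable_cong_sets)
  show "integrable \<mu> (\<lambda>x. ln (\<rho> x))"
    by (rule integrable_const_bound[of _ K]) (use K meas in auto)
  define I where "I = (\<integral>x. ln (\<rho> x) \<partial>\<mu>)"
  have birk: "AE x in \<mu>. (\<lambda>k. birkhoff_sum f (\<lambda>x. ln (\<rho> x)) k x / real k) \<longlonglongrightarrow> I"
    unfolding I_def by (rule birkhoff_ergodic[OF erg meas K])
  have lam0: "lam 0 = ereal I" by (simp add: lam_def I_def)
  show "oseledets f \<mu> ?A W 2 lam E"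
    unfolding oseledets_def
  proof (intro conjI)
    show "\<forall>i j. i < j \<and> j < 2 \<longrightarrow> lam j < lam i" "\<forall>i<2. lam i < \<infinity>" by (auto simp: lam_def)
    show "AE x in \<mu>. direct_sum_decomp (W x) {..<2} (\<lambda>i. E i x) \<and>
        (\<forall>i<2. E i x \<noteq> {0} \<and>
           (lam i \<noteq> -\<infinity> \<longrightarrow> ?A x ` E i x = E i (f x)) \<and>
           (lam i = -\<infinity> \<longrightarrow> ?A x ` E i x \<subseteq> E i (f x)) \<and>
           (\<forall>v\<in>E i x - {0}. growth f ?A x v \<longlonglongrightarrow> lam i))"
      using birk
    proof eventually_elim
      fix x assume x: "(\<lambda>k. birkhoff_sum f (\<lambda>x. ln (\<rho> x)) k x / real k) \<longlonglongrightarrow> I"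
      have gL: "growth f ?A x v \<longlonglongrightarrow> lam 0" if v: "v \<in> L x" "v \<noteq> 0" for v
      proof -
        obtain t where t: "v = t *\<^sub>R h x" using v by (auto simp: L_def)
        hence "t \<noteq> 0" using v by auto
        thus ?thesis unfolding t lam0 section_of_last[symmetric] by (intro growth_L x) simp
      qed
      have gF: "growth f ?A x v \<longlonglongrightarrow> lam i" if v: "v \<in> F x" "i \<noteq> 0" for v i
        using v growth_F[of _ x] by (auto simp: F_def lam_def)
      show "direct_sum_decomp (W x) {..<2} (\<lambda>i. E i x) \<and>
        (\<forall>i<2. E i x \<noteq> {0} \<and>
           (lam i \<noteq> -\<infinity> \<longrightarrow> ?A x ` E i x = E i (f x)) \<and>
           (lam i = -\<infinity> \<longrightarrow> ?A x ` E i x \<subseteq> E i (f x)) \<and>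
           (\<forall>v\<in>E i x - {0}. growth f ?A x v \<longlonglongrightarrow> lam i))"
      proof (intro conjI allI impI ballI)
        show "direct_sum_decomp (W x) {..<2} (\<lambda>i. E i x)" unfolding E_def by (rule direct_sum)
        fix i :: nat
        show "E i x \<noteq> {0}" unfolding E_def using L_nontrivial F_nontrivial by simp
        show "?A x ` E i x \<subseteq> E i (f x)" unfolding E_def using ruelle_L ruelle_F by simp
        show "?A x ` E i x = E i (f x)" if "lam i \<noteq> -\<infinity>"
          using that unfolding E_def lam_def using ruelle_L by (simp split: if_splits)
        fix v assume "v \<in> E i x - {0}"
        thus "growth f ?A x v \<longlonglongrightarrow> lam i"
          using gL[of v] gF[of v i] unfolding E_def by (cases "i = 0") auto
      qed
    qed
  qed
  show "AE x in \<mu>. F x = slow_space f ?A W (lam 0) x"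
    using birk
  proof eventually_elim
    fix x assume x: "(\<lambda>k. birkhoff_sum f (\<lambda>x. ln (\<rho> x)) k x / real k) \<longlonglongrightarrow> I"
    have "limsup (growth f ?A x (section_of c x)) < lam 0 \<longleftrightarrow> c (N * d) = 0" for c
    proof (cases "c (N * d) = 0")
      case True
      thus ?thesis using lim_imp_Limsup[OF _ growth_F[where c = c, OF True, of x]] by (simp add: lam0)
    next
      case False
      thus ?thesis using lim_imp_Limsup[OF _ growth_L[where c = c, OF False x]] by (simp add: lam0)
    qed
    thus "F x = slow_space f ?A W (lam 0) x"
      by (auto simp: F_def slow_space_def W_def)
  qed
qed

lemma W_continuous: "continuous_bundle (Suc (N * d)) W"
  unfolding continuous_bundle_def
proof
  fix x0
  show "\<exists>U e. open U \<and> x0 \<in> U \<and> (\<forall>i<Suc (N * d). continuous_on U (e i)) \<and>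
        (\<forall>x\<in>U. inj_on (\<lambda>i. e i x) {..<Suc (N * d)} \<and> independent ((\<lambda>i. e i x) ` {..<Suc (N * d)}) \<and>
                span ((\<lambda>i. e i x) ` {..<Suc (N * d)}) = W x)"
    by (intro exI[of _ UNIV] exI[of _ frame] conjI ballI allI impI open_UNIV UNIV_I frame_cont W_frame)
qed

lemma h_in_W: "h x \<in> W x"
  using section_of_last[of 1 x] rangeI[of "\<lambda>c. section_of c x" "\<lambda>i. if i = N * d then 1 else 0"]
  by (simp only: W_def scaleR_one)

lemma W_dense:
  assumes approx: "\<And>g. (\<And>w. \<bar>g w\<bar> \<le> 1) \<Longrightarrow> holder_bound r 1 g \<Longrightarrow>
       \<exists>c. \<forall>w. \<bar>g w - h x w * comb \<xi> d N c x w\<bar> \<le> \<epsilon>"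
  shows "sup_dense_in \<epsilon> (W x) {g \<in> holder_space r. holder_norm r (apply_bcontfun g) \<le> 1}"
  unfolding sup_dense_in_def
proof
  fix g :: "(nat \<Rightarrow> 'l) \<Rightarrow>\<^sub>C real" assume g: "g \<in> {g \<in> holder_space r. holder_norm r (apply_bcontfun g) \<le> 1}"
  hence gH: "g \<in> holder_space r" by simp
  have hb: "holder_bound r (holder_const r (apply_bcontfun g)) (apply_bcontfun g)"
    using gH by (intro holder_bound_holder_const r card) (simp add: holder_space_def)
  have S: "\<bar>apply_bcontfun g w\<bar> \<le> (SUP w. \<bar>apply_bcontfun g w\<bar>)" for w
    by (rule abs_le_holder_norm[OF gH])
  have "0 \<le> (SUP w. \<bar>apply_bcontfun g w\<bar>)" using S[of undefined] by linarith
  hence c1: "holder_const r (apply_bcontfun g) \<le> 1" and S1: "(SUP w. \<bar>apply_bcontfun g w\<bar>) \<le> 1"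
    using g holder_bound_nonneg[OF hb] by (auto simp: holder_norm_def)
  have "\<bar>apply_bcontfun g w\<bar> \<le> 1" for w using S[of w] S1 by linarith
  then obtain c where c: "\<forall>w. \<bar>g w - h x w * comb \<xi> d N c x w\<bar> \<le> \<epsilon>"
    using approx[OF _ holder_bound_mono[OF hb c1 r(1)]] by metis
  have "dist g (section_of c x) \<le> \<epsilon>"
    by (rule dist_bound) (simp add: dist_real_def section_of c)
  thus "\<exists>u\<in>W x. dist g u \<le> \<epsilon>" by (auto simp: W_def)
qed

end

end

theorem theoremB:
  fixes f :: "'m::t2_space \<Rightarrow> 'm"
    and \<mu> :: "'m measure"
    and r \<epsilon> :: real
    and \<phi> :: "'m \<Rightarrow> (nat \<Rightarrow> 'l::{finite,discrete_topology}) \<Rightarrow> real"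
    and \<nu> :: "'m \<Rightarrow> (nat \<Rightarrow> 'l) measure"
    and \<rho> :: "'m \<Rightarrow> real"
    and h :: "'m \<Rightarrow> (nat \<Rightarrow> 'l) \<Rightarrow>\<^sub>C real"
  assumes "CARD('l) \<ge> 2"
    and "compact (UNIV :: 'm set)"
    and "homeomorphism UNIV UNIV f (inv f)"
    and "ergodic_for f \<mu>"
    and "0 < r" "r < 1"
    and "uniformly_relatively_holder r \<phi>"
    and "ruelle_triple r f \<phi> \<nu> \<rho> h"
    and "\<epsilon> > 0"
  shows "\<exists>m A W.
    (\<forall>x. holder_operator r (A x) \<and> positive_operator r (A x)) \<and>
    continuous_operator_family r A \<and>
    continuous_bundle m W \<and> (\<forall>x. W x \<subseteq> holder_space r) \<and>
    (\<forall>x. h x \<in> W x \<and> sup_dense_in \<epsilon> (W x) {g \<in> holder_space r. holder_norm r g \<le> 1}) \<and>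
    (\<forall>x. A x ` W x \<subseteq> W (f x) \<and>
         (\<forall>g\<in>W x. norm (A x g - ruelle (\<phi> x) g) \<le> \<epsilon> * norm g)) \<and>
    (\<exists>k lam E. oseledets f \<mu> A W k lam E \<and> k \<ge> 1 \<and>
       integrable \<mu> (\<lambda>x. ln (\<rho> x)) \<and> lam 0 = ereal (\<integral>x. ln (\<rho> x) \<partial>\<mu>) \<and>
       (\<forall>x. E 0 x = {t *\<^sub>R h x | t. t \<in> UNIV}) \<and>
       (\<exists>F. (AE x in \<mu>. F x = slow_space f A W (lam 0) x) \<and> dominated f A W UNIV (E 0) F) \<and>
       (k = 2 \<or> (k \<ge> 3 \<and> defines_dominated_splitting f \<mu> A W k E)))"
proof -
  interpret ruelle_setting f r \<phi> \<nu> \<rho> h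
    by unfold_locales (fact assms)+
  obtain N n where N: "0 < N" "0 < n" and approx: "\<forall>a0 d \<xi> z x g.
     cylinder_family n a0 d \<xi> z \<longrightarrow> (\<forall>w. \<bar>g w\<bar> \<le> 1) \<longrightarrow> holder_bound r 1 g \<longrightarrow>
       (\<exists>c. \<forall>w. \<bar>g w - h x w * comb \<xi> d N c x w\<bar> \<le> \<epsilon>)"
    using bundle_parameters[OF \<open>\<epsilon> > 0\<close>] by (elim exE conjE)
  obtain d \<xi> z where d: "0 < d" and fam: "cylinder_family n undefined d \<xi> z"
    by (rule cylinder_family_exists[OF N(2)]) (rule that)
  note ctx = fam N(1) d
  let ?A = "\<lambda>x. ruelle (\<phi> x)"
  let ?W = "W d N \<xi>"
  let ?lam = "\<lambda>i::nat. if i = 0 then ereal (\<integral>x. ln (\<rho> x) \<partial>\<mu>) else -\<infinity>"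
  let ?E = "\<lambda>(i::nat) x. if i = 0 then L x else F d N \<xi> x"
  have "\<exists>k lam E. oseledets f \<mu> ?A ?W k lam E \<and> k \<ge> 1 \<and>
       integrable \<mu> (\<lambda>x. ln (\<rho> x)) \<and> lam 0 = ereal (\<integral>x. ln (\<rho> x) \<partial>\<mu>) \<and>
       (\<forall>x. E 0 x = {t *\<^sub>R h x | t. t \<in> UNIV}) \<and>
       (\<exists>F. (AE x in \<mu>. F x = slow_space f ?A ?W (lam 0) x) \<and> dominated f ?A ?W UNIV (E 0) F) \<and>
       (k = 2 \<or> (k \<ge> 3 \<and> defines_dominated_splitting f \<mu> ?A ?W k E))"
  proof (intro exI[of _ 2] exI[of _ ?lam] exI[of _ ?E] conjI)
    show "oseledets f \<mu> ?A ?W 2 ?lam ?E" by (rule W_oseledets(1)[OF ctx assms(4)])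
    show "integrable \<mu> (\<lambda>x. ln (\<rho> x))" by (rule W_oseledets(2)[OF ctx assms(4)])
    show "\<exists>F. (AE x in \<mu>. F x = slow_space f ?A ?W (?lam 0) x) \<and> dominated f ?A ?W UNIV (?E 0) F"
      using W_oseledets(3)[OF ctx assms(4)] W_dominated[OF ctx]
      by (intro exI[of _ "F d N \<xi>"]) simp
  qed (simp_all add: L_def[OF ctx])
  moreover have "sup_dense_in \<epsilon> (?W x) {g \<in> holder_space r. holder_norm r (apply_bcontfun g) \<le> 1}" for x
    by (rule W_dense[OF ctx approx[rule_format, OF fam]])
  moreover have "?W x \<subseteq> holder_space r" for x
    unfolding W_def[OF ctx] using section_of_holder[OF ctx] by auto
  moreover have "norm (?A x g - ruelle (\<phi> x) g) \<le> \<epsilon> * norm g" for x g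
    using \<open>\<epsilon> > 0\<close> by simp
  ultimately show ?thesis
    using ruelle_holder_operator ruelle_positive ruelle_continuous_family W_continuous[OF ctx]
      h_in_W[OF ctx] ruelle_W[OF ctx]
    by (intro exI[of _ "Suc (N * d)"] exI[of _ ?A] exI[of _ ?W]) simp
qed

end
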